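(* Let $\omega$ be a non-quasianalytic subadditive weight function, $\varphi\in\mathcal{S}_\omega(\mathbb R^d)\setminus\{0\}$ and $\Lambda=\alpha\mathbb Z^d\times\beta\mathbb Z^d$ with $\alpha,\beta>0$ such that $\{x_\sigma\}_{\sigma\in\Lambda}:=\{\Pi(\sigma)\varphi\}_{\sigma\in\Lambda}$ is a frame in $L^2(\mathbb R^d)$. (i) Fix $\mu\ge0$ and let $\{y_\sigma\}_{\sigma\in\Lambda}\subset M^2_{m_\mu}(\mathbb R^d)$ satisfy: for every $\lambda\ge0$ there exists $\varepsilon_\lambda>0$ with $\sum_{\sigma\in\Lambda}e^{\lambda\omega(\sigma)}\|x_\sigma-y_\sigma\|^2_{M^2_{m_\mu}}\le\varepsilon_\lambda$. Then for every $u\in M^2_{m_{-\mu}}(\mathbb R^d)$, $\mathrm{WF}^G_\omega(u)=\mathrm{WF}^{\{y_\sigma\}}_\omega(u)$. (ii) Let $\{y_\sigma\}_{\sigma\in\Lambda}\subset\mathcal{S}_\omega(\mathbb R^d)$ satisfy: for every $\lambda,\mu\ge0$ there exists $\varepsilon_{\lambda,\mu}>0$ with $\sum_{\sigma\in\Lambda}e^{\lambda\omega(\sigma)}\|x_\sigma-y_\sigma\|^2_{M^2_{m_\mu}}\le\varepsilon_{\lambda,\mu}$. Then for every $u\in\mathcal{S}'_\omega(\mathbb R^d)$, $\mathrm{WF}^G_\omega(u)=\mathrm{WF}^{\{y_\sigma\}}_\omega(u)$.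
   Context: A non-quasianalytic subadditive weight function is a continuous increasing function $\omega:[0,+\infty)\to[0,+\infty)$ such that: ($\alpha$) $\omega(t_1+t_2)\le\omega(t_1)+\omega(t_2)$ for all $t_1,t_2\ge0$; ($\beta$) $\int_1^{+\infty}\omega(t)t^{-2}\,dt<+\infty$; ($\gamma$) there exist $a\in\mathbb R$, $b>0$ with $\omega(t)\ge a+b\log(1+t)$ for all $t\ge0$; ($\delta$) $\varphi(t):=\omega(e^t)$ is convex. For $\zeta$ in $\mathbb R^n$ one writes $\omega(\zeta):=\omega(|\zeta|)$. The space $\mathcal{S}_\omega(\mathbb R^d)$ is the set of Schwartz functions $f$ such that for all $\lambda>0$ and $\alpha\in\mathbb N_0^d$, $\sup_x|D^\alpha f(x)|e^{\lambda\omega(x)}<\infty$ and $\sup_\xi|D^\alpha\hat f(\xi)|e^{\lambda\omega(\xi)}<\infty$, where $\hat f(\xi)=\int f(x)e^{-ix\cdot\xi}dx$; $\mathcal{S}'_\omega(\mathbb R^d)$ is its strong dual, with duality $\langle\cdot,\cdot\rangle$ conjugate-linear in the second argument. For $z=(x,\xi)\in\mathbb R^{2d}$, $\Pi(z)f(t)=e^{it\cdot\xi}f(t-x)$, and $V_\varphi f(z)=\langle f,\Pi(z)\varphi\rangle$ is the short-time Fourier transform. A family $\{x_\sigma\}$ is a frame in $L^2$ if $A\|f\|^2\le\sum_\sigma|\langle f,x_\sigma\rangle|^2\le B\|f\|^2$ for some $A,B>0$ and all $f\in L^2$. For $\mu\in\mathbb R$, $m_\mu(z)=e^{\mu\omega(z)}$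 and the modulation space $M^2_{m_\mu}(\mathbb R^d)=\{f\in\mathcal{S}'_\omega(\mathbb R^d):\|f\|_{M^2_{m_\mu}}:=\|V_\varphi f\cdot m_\mu\|_{L^2(\mathbb R^{2d})}<\infty\}$ (window $\varphi$ fixed; different windows give equivalent norms); $M^2_{m_{-\mu}}$ is the dual of $M^2_{m_\mu}$, so $\langle u,y\rangle$ is defined for $u\in M^2_{m_{-\mu}}$, $y\in M^2_{m_\mu}$. Gabor wave front set: for $u\in\mathcal{S}'_\omega(\mathbb R^d)$, $z_0\in\mathbb R^{2d}\setminus\{0\}$ is not in $\mathrm{WF}^G_\omega(u)$ iff there is an open conic set $\Gamma\subseteq\mathbb R^{2d}\setminus\{0\}$ containing $z_0$ with $\sup_{\sigma\in\Lambda\cap\Gamma}e^{\lambda\omega(\sigma)}|\langle u,\Pi(\sigma)\varphi\rangle|<\infty$ for all $\lambda>0$ (this is independent of the window $\varphi\in\mathcal{S}_\omega\setminus\{0\}$ and lattice giving a Gabor frame). For a family $\{y_\sigma\}_{\sigma\in\Lambda}$ such that $\langle u,y_\sigma\rangle$ is defined, $z_0\in\mathbb R^{2d}\setminus\{0\}$ is not in $\mathrm{WF}^{\{y_\sigma\}}_\omega(u)$ iff there is an open conic set $\Gamma\subseteq\mathbb R^{2d}\setminus\{0\}$ containing $z_0$ with $\sup_{\sigma\in\Lambda\cap\Gamma}e^{\lambda\omega(\sigma)}|\langle u,y_\sigma\rangle|<\infty$ for all $\lambda>0$. *)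

theory Defs
  imports "HOL-Analysis.Analysis"
begin

definition weight_function :: "(real \<Rightarrow> real) \<Rightarrow> bool" where
  "weight_function w \<longleftrightarrow>
     continuous_on {0..} w \<and> mono_on {0..} w \<and> (\<forall>t\<ge>0. w t \<ge> 0) \<and>
     (\<forall>t1\<ge>0. \<forall>t2\<ge>0. w (t1 + t2) \<le> w t1 + w t2) \<and>
     (\<lambda>t. w t / t\<^sup>2) integrable_on {1..} \<and>
     (\<exists>a b. b > 0 \<and> (\<forall>t\<ge>0. w t \<ge> a + b * ln (1 + t))) \<and>
     convex_on UNIV (\<lambda>t. w (exp t))"

primrec dpart :: "'n list \<Rightarrow> (real^'n::finite \<Rightarrow> complex) \<Rightarrow> real^'n \<Rightarrow> complex" where
  "dpart [] f = f"
| "dpart (i # is) f =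
     (\<lambda>x. vector_derivative (\<lambda>t. dpart is f (x + t *\<^sub>R axis i 1)) (at 0))"

definition smooth_fun :: "(real^'n::finite \<Rightarrow> complex) \<Rightarrow> bool" where
  "smooth_fun f \<longleftrightarrow>
     (\<forall>is x i. ((\<lambda>t. dpart is f (x + t *\<^sub>R axis i 1)) has_vector_derivative
                  dpart (i # is) f x) (at 0)) \<and>
     (\<forall>is. continuous_on UNIV (dpart is f))"

definition fourier :: "(real^'n::finite \<Rightarrow> complex) \<Rightarrow> real^'n \<Rightarrow> complex" where
  "fourier f \<xi> = (LINT x|lborel. f x * cis (- (x \<bullet> \<xi>)))"

definition wbounded :: "(real \<Rightarrow> real) \<Rightarrow> real \<Rightarrow> ('a::real_normed_vector \<Rightarrow> complex) \<Rightarrow> bool" where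
  "wbounded w lam g \<longleftrightarrow> (\<exists>C. \<forall>x. cmod (g x) * exp (lam * w (norm x)) \<le> C)"

definition S_omega :: "(real \<Rightarrow> real) \<Rightarrow> (real^'n::finite \<Rightarrow> complex) set" where
  "S_omega w = {f. smooth_fun f \<and> smooth_fun (fourier f) \<and>
     (\<forall>lam>0. \<forall>is. wbounded w lam (dpart is f) \<and> wbounded w lam (dpart is (fourier f)))}"

definition seminorm_S :: "(real \<Rightarrow> real) \<Rightarrow> nat \<Rightarrow> 'n list \<Rightarrow> (real^'n::finite \<Rightarrow> complex) \<Rightarrow> real" where
  "seminorm_S w N is f =
     (SUP x. cmod (dpart is f x) * exp (real N * w (norm x))) +
     (SUP \<xi>. cmod (dpart is (fourier f) \<xi>) * exp (real N * w (norm \<xi>)))"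

type_synonym 'n udistr = "(real^'n \<Rightarrow> complex) \<Rightarrow> complex"

definition S_omega_dual :: "(real \<Rightarrow> real) \<Rightarrow> ('n::finite) udistr set" where
  "S_omega_dual w = {u.
     (\<forall>f\<in>S_omega w. \<forall>g\<in>S_omega w. u (\<lambda>x. f x + g x) = u f + u g) \<and>
     (\<forall>c. \<forall>f\<in>S_omega w. u (\<lambda>x. c * f x) = cnj c * u f) \<and>
     (\<exists>C N. \<forall>f\<in>S_omega w. cmod (u f) \<le> C * (\<Sum>is\<in>{is::'n list. length is \<le> N}. seminorm_S w N is f))}"

definition fun_distr :: "(real^'n::finite \<Rightarrow> complex) \<Rightarrow> 'n udistr" where
  "fun_distr g = (\<lambda>f. LINT t|lborel. g t * cnj (f t))"

definition tf_shift :: "(real^'n::finite) \<times> (real^'n) \<Rightarrow> (real^'n \<Rightarrow> complex) \<Rightarrow> real^'n \<Rightarrow> complex" where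
  "tf_shift z f t = cis (t \<bullet> snd z) * f (t - fst z)"

definition stft :: "(real^'n::finite \<Rightarrow> complex) \<Rightarrow> 'n udistr \<Rightarrow> (real^'n) \<times> (real^'n) \<Rightarrow> complex" where
  "stft \<phi> u z = u (tf_shift z \<phi>)"

definition M2 :: "(real \<Rightarrow> real) \<Rightarrow> (real^'n::finite \<Rightarrow> complex) \<Rightarrow> real \<Rightarrow> 'n udistr set" where
  "M2 w \<phi> \<mu> = {u. u \<in> S_omega_dual w \<and>
      integrable lborel (\<lambda>z. (cmod (stft \<phi> u z) * exp (\<mu> * w (norm z)))\<^sup>2)}"

definition M2_norm :: "(real \<Rightarrow> real) \<Rightarrow> (real^'n::finite \<Rightarrow> complex) \<Rightarrow> real \<Rightarrow> 'n udistr \<Rightarrow> real" where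
  "M2_norm w \<phi> \<mu> u = sqrt (LINT z|lborel. (cmod (stft \<phi> u z) * exp (\<mu> * w (norm z)))\<^sup>2)"

text \<open>Duality pairing M2_{-mu} x M2_{mu}, via the STFT orthogonality relation
  (it extends \<langle>u, f\<rangle> = u f for f in S_omega).\<close>
definition M2_pair :: "(real^'n::finite \<Rightarrow> complex) \<Rightarrow> 'n udistr \<Rightarrow> 'n udistr \<Rightarrow> complex" where
  "M2_pair \<phi> u y =
     (LINT z|lborel. stft \<phi> u z * cnj (stft \<phi> y z)) /
     complex_of_real ((2 * pi) ^ CARD('n) * (LINT t|lborel. (cmod (\<phi> t))\<^sup>2))"

definition L2_fun :: "(real^'n::finite \<Rightarrow> complex) \<Rightarrow> bool" where
  "L2_fun f \<longleftrightarrow> f \<in> borel_measurable lborel \<and> integrable lborel (\<lambda>t. (cmod (f t))\<^sup>2)"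

definition L2_inner :: "(real^'n::finite \<Rightarrow> complex) \<Rightarrow> (real^'n \<Rightarrow> complex) \<Rightarrow> complex" where
  "L2_inner f g = (LINT t|lborel. f t * cnj (g t))"

definition L2_normsq :: "(real^'n::finite \<Rightarrow> complex) \<Rightarrow> real" where
  "L2_normsq f = (LINT t|lborel. (cmod (f t))\<^sup>2)"

definition is_frame :: "'i set \<Rightarrow> ('i \<Rightarrow> real^'n::finite \<Rightarrow> complex) \<Rightarrow> bool" where
  "is_frame I x \<longleftrightarrow> (\<exists>A B. A > 0 \<and> B > 0 \<and> (\<forall>f. L2_fun f \<longrightarrow>
       (\<lambda>\<sigma>. (cmod (L2_inner f (x \<sigma>)))\<^sup>2) summable_on I \<and>
       A * L2_normsq f \<le> (\<Sum>\<^sub>\<infinity>\<sigma>\<in>I. (cmod (L2_inner f (x \<sigma>)))\<^sup>2) \<and>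
       (\<Sum>\<^sub>\<infinity>\<sigma>\<in>I. (cmod (L2_inner f (x \<sigma>)))\<^sup>2) \<le> B * L2_normsq f))"

definition gabor_lattice :: "real \<Rightarrow> real \<Rightarrow> ((real^'n::finite) \<times> (real^'n)) set" where
  "gabor_lattice a b = {(a *\<^sub>R k, b *\<^sub>R l) | k l. (\<forall>i. k $ i \<in> \<int>) \<and> (\<forall>i. l $ i \<in> \<int>)}"

definition open_conic :: "('a::real_normed_vector) set \<Rightarrow> bool" where
  "open_conic G \<longleftrightarrow> open G \<and> 0 \<notin> G \<and> (\<forall>z\<in>G. \<forall>t>0. t *\<^sub>R z \<in> G)"

definition WF_coeff :: "(real \<Rightarrow> real) \<Rightarrow> ('a::real_normed_vector) set \<Rightarrow> ('a \<Rightarrow> complex) \<Rightarrow> 'a set" where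
  "WF_coeff w L c = {z0. z0 \<noteq> 0 \<and> \<not> (\<exists>G. open_conic G \<and> z0 \<in> G \<and>
      (\<forall>lam>0. \<exists>C. \<forall>\<sigma>\<in>L \<inter> G. exp (lam * w (norm \<sigma>)) * cmod (c \<sigma>) \<le> C))}"

definition WF_gabor :: "(real \<Rightarrow> real) \<Rightarrow> (real^'n::finite \<Rightarrow> complex) \<Rightarrow> ((real^'n) \<times> (real^'n)) set
     \<Rightarrow> 'n udistr \<Rightarrow> ((real^'n) \<times> (real^'n)) set" where
  "WF_gabor w \<phi> L u = WF_coeff w L (\<lambda>\<sigma>. u (tf_shift \<sigma> \<phi>))"

end

theory Submission
  imports Defs "HOL-Probability.Characteristic_Functions" "HOL-Probability.Sinc_Integral"
begin

text \<open>
  Everything rests on the inversion formula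
  \<open>c \<cdot> u f = \<integral> V u z \<cdot> cnj (V f z) dz\<close> with \<open>V\<close> the short-time Fourier transform with window \<open>\<psi>\<close> and
  \<open>c = (2\<pi>)\<^sup>n \<parallel>\<psi>\<parallel>\<^sup>2\<close>, valid for all \<open>f\<close> in \<open>S_omega w\<close> and all \<open>u\<close> in its dual. It identifies
  \<open>u (x\<^sub>\<sigma>) - \<langle>u, y\<^sub>\<sigma>\<rangle>\<close> with the \<open>M2\<close>-pairing of \<open>u\<close> and \<open>x\<^sub>\<sigma> - y\<^sub>\<sigma>\<close>, and the smallness of
  \<open>x\<^sub>\<sigma> - y\<^sub>\<sigma>\<close> makes that pairing decay faster than every \<open>exp (- \<lambda> \<omega>(\<sigma>))\<close> on the whole lattice; such a
  perturbation of the coefficients cannot change a wave front set.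

  For the inversion formula, Fourier inversion gives \<open>c \<cdot> f = \<integral> V f z \<cdot> \<Pi>(z)\<psi> dz\<close> pointwise, together with
  all derivatives and their Fourier transforms. Replacing \<open>\<Pi>(z)\<psi>\<close> by \<open>\<Pi>(s\<^sub>k z)\<psi>\<close> for simple functions
  \<open>s\<^sub>k \<rightarrow> id\<close> turns the integral into finite linear combinations, which converge to \<open>c \<cdot> f\<close> in every
  seminorm because \<open>z \<mapsto> \<Pi>(z)\<psi>\<close> is continuous of moderate growth and \<open>V f\<close> decays rapidly. Hence \<open>u\<close>
  may be applied under the integral sign.
\<close>

section \<open>Fourier inversion on \<open>\<real>\<^sup>n\<close>\<close>

text \<open>\<open>M2_pair\<close> is defined through short-time Fourier transforms, whereas the
  Gabor wave front set evaluates \<open>u\<close> directly, so the two notions first have to be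
  reconciled. The obstacle is that \<open>u\<close> is an abstract conjugate-linear functional known
  only through a bound by finitely many seminorms: it commutes with finite sums, but there is no
  Fubini theorem for it. Hence the approximating sums must converge uniformly in all weighted
  derivatives, on the time side and on the Fourier side. Both sides are handled by the same lemmas,
  because the Fourier transform carries a time-frequency shift to the shift by the rotated point
  \<open>(snd z, - fst z)\<close>, up to a factor of modulus one. The smallness hypothesis is used
  one lattice point at a time: each term of a convergent sum of nonnegative terms is at most the
  sum. In (ii) every \<open>u\<close> lies in some \<open>M2 w \<psi> (- \<mu>)\<close>, but \<mu>
  depends on \<open>u\<close>; this is where smallness for all \<mu> enters.\<close>

lemma lborel_integrable_affine:
  fixes f :: "'a::euclidean_space \<Rightarrow> 'b::{banach, second_countable_topology}"
  assumes f: "integrable lborel f" and c: "c \<noteq> 0"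
  shows "integrable lborel (\<lambda>x. f (t + c *\<^sub>R x))"
proof -
  have [measurable]: "f \<in> borel_measurable borel"
    using f by auto
  have "integrable (density (distr lborel borel (\<lambda>x. t + c *\<^sub>R x)) (\<lambda>_. ennreal (\<bar>c\<bar> ^ DIM('a)))) f"
    using f lborel_affine[OF c, of t] by simp
  then have "integrable (distr lborel borel (\<lambda>x. t + c *\<^sub>R x)) (\<lambda>x. \<bar>c\<bar> ^ DIM('a) *\<^sub>R f x)"
    by (subst (asm) integrable_density) auto
  then show ?thesis
    using c integrable_scaleR_right[of "inverse (\<bar>c\<bar> ^ DIM('a))" lborel "\<lambda>x. \<bar>c\<bar> ^ DIM('a) *\<^sub>R f (t + c *\<^sub>R x)"]
    by (subst (asm) integrable_distr_eq) auto
qed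

lemma lborel_integral_affine:
  fixes f :: "'a::euclidean_space \<Rightarrow> 'b::{banach, second_countable_topology}"
  assumes f[measurable]: "f \<in> borel_measurable borel" and c: "c \<noteq> 0"
  shows "(LINT x|lborel. f x) = \<bar>c\<bar> ^ DIM('a) *\<^sub>R (LINT x|lborel. f (t + c *\<^sub>R x))"
  by (subst lborel_affine[OF c, of t]) (simp add: integral_density integral_distr)

lemma lborel_integral_shift:
  fixes f :: "'a::euclidean_space \<Rightarrow> 'b::{banach, second_countable_topology}"
  assumes "f \<in> borel_measurable borel"
  shows "(LINT t|lborel. f (t - x)) = (LINT t|lborel. f t)"
  using lborel_integral_affine[OF assms, of 1 "- x"] by simp

lemma lborel_integral_reflect:
  fixes f :: "'a::euclidean_space \<Rightarrow> 'b::{banach, second_countable_topology}"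
  assumes "f \<in> borel_measurable borel"
  shows "(LINT x|lborel. f (t - x)) = (LINT x|lborel. f x)"
  using lborel_integral_affine[OF assms, of "-1" t] by simp

lemma
  fixes f :: "'a::euclidean_space \<Rightarrow> real \<Rightarrow> 'b::{real_normed_field, banach, second_countable_topology}"
  assumes f: "\<And>b. b \<in> Basis \<Longrightarrow> integrable lborel (f b)"
  shows lborel_integrable_prod_Basis: "integrable lborel (\<lambda>x::'a. \<Prod>b\<in>Basis. f b (x \<bullet> b))"
    and lborel_integral_prod_Basis:
      "(LINT x|lborel. (\<Prod>b\<in>Basis. f b ((x::'a) \<bullet> b))) = (\<Prod>b\<in>Basis. LINT x|lborel. f b x)"
proof -
  interpret product_sigma_finite "\<lambda>_::'a. lborel :: real measure"
    by unfold_locales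
  have [measurable]: "\<And>b. b \<in> Basis \<Longrightarrow> f b \<in> borel_measurable borel"
    using f by auto
  have *: "(\<lambda>x. \<Prod>b\<in>Basis. f b ((\<Sum>c\<in>Basis. x c *\<^sub>R c) \<bullet> b)) = (\<lambda>x. \<Prod>b\<in>Basis. f b (x b))"
    by (intro ext prod.cong) (auto simp: inner_sum_left inner_Basis if_distrib cong: if_cong)
  show "integrable lborel (\<lambda>x::'a. \<Prod>b\<in>Basis. f b (x \<bullet> b))"
    by (subst lborel_eq, subst integrable_distr_eq) (auto simp: * f intro!: product_integrable_prod)
  show "(LINT x|lborel. (\<Prod>b\<in>Basis. f b ((x::'a) \<bullet> b))) = (\<Prod>b\<in>Basis. LINT x|lborel. f b x)"
    by (subst lborel_eq, subst integral_distr) (auto simp: * f intro!: product_integral_prod)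
qed

text \<open>The exponent comes from comparison with the product of the functions 1/(1 + t^2) over
  the coordinates: each of the \<open>DIM('a)\<close> factors 1 + t^2 is at most
  \<open>(1 + norm z)\<^sup>2\<close>.\<close>

lemma integrable_inverse_one_plus_norm_power:
  "integrable lborel (\<lambda>z::'a::euclidean_space. inverse ((1 + norm z) ^ (2 * DIM('a))))"
proof (rule Bochner_Integration.integrable_bound)
  have 1: "integrable lborel (\<lambda>x::real. inverse (1 + x^2))"
    using integrable_inverse_1_plus_square by (simp add: set_integrable_def)
  show "integrable lborel (\<lambda>z::'a. \<Prod>b\<in>Basis. inverse (1 + (z \<bullet> b)\<^sup>2))"
    by (rule lborel_integrable_prod_Basis[where f="\<lambda>_ x. inverse (1 + x\<^sup>2)", OF 1])
  show "AE z in lborel. norm (inverse ((1 + norm z) ^ (2 * DIM('a)))) \<le> norm (\<Prod>b\<in>Basis. inverse (1 + ((z::'a) \<bullet> b)\<^sup>2))"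
  proof (rule AE_I2)
    fix z :: 'a
    have "(\<Prod>b\<in>Basis. 1 + ((z::'a) \<bullet> b)\<^sup>2) \<le> (\<Prod>b\<in>(Basis::'a set). (1 + norm z)\<^sup>2)"
    proof (intro prod_mono conjI)
      fix b :: 'a assume "b \<in> Basis"
      then have "(z \<bullet> b)\<^sup>2 \<le> (norm z)\<^sup>2"
        using Basis_le_norm[of b z] by (simp add: abs_le_square_iff[symmetric])
      then show "1 + (z \<bullet> b)\<^sup>2 \<le> (1 + norm z)\<^sup>2"
        using norm_ge_zero[of z] by (simp add: power2_sum del: norm_ge_zero)
    qed auto
    also have "\<dots> = (1 + norm z) ^ (2 * DIM('a))"
      by (simp add: power_mult)
    finally have "(\<Prod>b\<in>Basis. 1 + ((z::'a) \<bullet> b)\<^sup>2) \<le> (1 + norm z) ^ (2 * DIM('a))" .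
    moreover have "0 < (\<Prod>b\<in>Basis. 1 + ((z::'a) \<bullet> b)\<^sup>2)"
      by (intro prod_pos) (auto intro: add_pos_nonneg)
    ultimately show "norm (inverse ((1 + norm z) ^ (2 * DIM('a)))) \<le> norm (\<Prod>b\<in>Basis. inverse (1 + ((z::'a) \<bullet> b)\<^sup>2))"
      by (simp add: prod_nonneg le_imp_inverse_le prod_inversef[unfolded comp_def] del: inverse_le_iff_le)
  qed
qed measurable

section \<open>Gaussians and their Fourier transforms\<close>

definition gaussian :: "'a::euclidean_space \<Rightarrow> real" where
  "gaussian v = exp (- (norm v)\<^sup>2 / 2)"

lemma continuous_on_gaussian [continuous_intros]:
  "continuous_on A f \<Longrightarrow> continuous_on A (\<lambda>x. gaussian (f x))"
  unfolding gaussian_def by (intro continuous_intros) auto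

lemma gaussian_measurable [measurable]: "gaussian \<in> borel_measurable borel"
  by (intro borel_measurable_continuous_onI continuous_intros)

text \<open>Up to the factor \<open>sqrt (2 * pi)\<close> this is the characteristic function of the
  standard normal distribution.\<close>

lemma gaussian_fourier_1d:
  "integrable lborel (\<lambda>v::real. cis (v * x) * exp (- v\<^sup>2 / 2))"
  "(LINT v|lborel. cis (v * x) * exp (- v\<^sup>2 / 2)) = sqrt (2 * pi) * exp (- x\<^sup>2 / 2)"
proof -
  have e: "cis (v * x) * exp (- v\<^sup>2 / 2) = sqrt (2 * pi) * (std_normal_density v *\<^sub>R cis (v * x))" for v :: real
    by (simp add: std_normal_density_def scaleR_conv_of_real)
  have 1: "integrable lborel (\<lambda>v. std_normal_density v *\<^sub>R cis (v * x))"
    by (rule Bochner_Integration.integrable_bound[OF integrable_normal_density[of 1 0]])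
      (auto simp: std_normal_density_def[abs_def] intro!: AE_I2 borel_measurable_continuous_onI continuous_intros)
  show "integrable lborel (\<lambda>v::real. cis (v * x) * exp (- v\<^sup>2 / 2))"
    unfolding e using 1 by (rule integrable_mult_right)
  have "char std_normal_distribution x = (LINT v|lborel. std_normal_density v *\<^sub>R cis (v * x))"
    unfolding char_def by (subst integral_density) (auto simp: cis_conv_exp mult.commute)
  then have "(LINT v|lborel. std_normal_density v *\<^sub>R cis (v * x)) = exp (- x\<^sup>2 / 2)"
    by (simp add: char_std_normal_distribution)
  then show "(LINT v|lborel. cis (v * x) * exp (- v\<^sup>2 / 2)) = sqrt (2 * pi) * exp (- x\<^sup>2 / 2)"
    unfolding e by (simp only: integral_mult_right_zero of_real_mult)
qed

lemma cis_sum: "finite A \<Longrightarrow> cis (\<Sum>x\<in>A. f x) = (\<Prod>x\<in>A. cis (f x))"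
  by (induction rule: finite_induct) (auto simp flip: cis_mult)

lemma gaussian_prod: "gaussian (v::'a::euclidean_space) = (\<Prod>b\<in>Basis. exp (- (v \<bullet> b)\<^sup>2 / 2))"
proof -
  have "(norm v)\<^sup>2 = (\<Sum>b\<in>Basis. (v \<bullet> b)\<^sup>2)"
    unfolding power2_norm_eq_inner by (subst euclidean_inner) (simp add: power2_eq_square)
  then show ?thesis
    by (simp only: gaussian_def exp_sum[symmetric] finite_Basis sum_negf sum_divide_distrib[symmetric])
qed

text \<open>Character and Gaussian both factor over \<open>Basis\<close>, which reduces the claim to
  dimension one.\<close>

lemma gaussian_fourier:
  fixes x :: "'a::euclidean_space"
  shows "integrable lborel (\<lambda>v::'a. cis (v \<bullet> x) * gaussian v)"
    and "(LINT v|lborel. cis ((v::'a) \<bullet> x) * gaussian v) = sqrt (2 * pi) ^ DIM('a) * gaussian x"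
proof -
  have e: "cis (v \<bullet> x) * gaussian v = (\<Prod>b\<in>Basis. cis ((v \<bullet> b) * (x \<bullet> b)) * exp (- (v \<bullet> b)\<^sup>2 / 2))" for v :: 'a
    by (simp add: euclidean_inner[of v x] cis_sum gaussian_prod prod.distrib)
  show "integrable lborel (\<lambda>v::'a. cis (v \<bullet> x) * gaussian v)"
    unfolding e by (rule lborel_integrable_prod_Basis[where f="\<lambda>b t. cis (t * (x \<bullet> b)) * exp (- t\<^sup>2 / 2)"])
      (rule gaussian_fourier_1d)
  show "(LINT v|lborel. cis ((v::'a) \<bullet> x) * gaussian v) = sqrt (2 * pi) ^ DIM('a) * gaussian x"
    unfolding e
    by (subst lborel_integral_prod_Basis[where f="\<lambda>b t. cis (t * (x \<bullet> b)) * exp (- t\<^sup>2 / 2)"])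
       (simp_all only: gaussian_fourier_1d gaussian_prod, simp_all add: gaussian_fourier_1d(1)[simplified] prod.distrib)
qed

lemma gaussian_integrable: "integrable lborel (gaussian :: 'a::euclidean_space \<Rightarrow> real)"
  and gaussian_integral: "(LINT v|lborel. gaussian (v::'a)) = sqrt (2 * pi) ^ DIM('a)"
proof -
  have "integrable lborel (\<lambda>v::'a. complex_of_real (gaussian v))"
    using gaussian_fourier(1)[of "0::'a"] by simp
  then show "integrable lborel (gaussian :: 'a \<Rightarrow> real)"
    by (subst (asm) complex_of_real_integrable_eq)
  have "complex_of_real (LINT v|lborel. gaussian (v::'a)) = complex_of_real (sqrt (2 * pi) ^ DIM('a))"
    using gaussian_fourier(2)[of "0::'a"] by (simp add: gaussian_def)
  then show "(LINT v|lborel. gaussian (v::'a)) = sqrt (2 * pi) ^ DIM('a)"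
    by (simp only: of_real_eq_iff)
qed

lemma integrable_lborel_pairI:
  fixes h :: "'a::euclidean_space \<times> 'b::euclidean_space \<Rightarrow> complex"
  assumes h[measurable]: "h \<in> borel_measurable borel"
    and F: "integrable lborel F" and G: "integrable lborel G"
    and le: "\<And>x y. norm (h (x, y)) \<le> F x * G y"
  shows "integrable lborel h"
proof -
  have [measurable]: "F \<in> borel_measurable borel" "G \<in> borel_measurable borel"
    using F G by auto
  have "integrable (lborel \<Otimes>\<^sub>M lborel) (\<lambda>p. F (fst p) * G (snd p))"
  proof (rule lborel_pair.Fubini_integrable)
    show "(\<lambda>p. F (fst p) * G (snd p)) \<in> borel_measurable (lborel \<Otimes>\<^sub>M lborel)"
      by measurable
    have "integrable lborel (\<lambda>x. (LINT y|lborel. \<bar>G y\<bar>) * \<bar>F x\<bar>)"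
      using F by (intro integrable_mult_right integrable_abs)
    then show "integrable lborel (\<lambda>x. LINT y|lborel. norm (F (fst (x, y)) * G (snd (x, y))))"
      by (simp add: abs_mult mult.commute)
    show "AE x in lborel. integrable lborel (\<lambda>y. F (fst (x, y)) * G (snd (x, y)))"
      using G by (intro AE_I2) auto
  qed
  then have "integrable lborel (\<lambda>p. F (fst p) * G (snd p))"
    by (simp add: lborel_prod)
  then show ?thesis
  proof (rule Bochner_Integration.integrable_bound)
    show "AE p in lborel. norm (h p) \<le> norm (F (fst p) * G (snd p))"
      using le by (intro AE_I2) (metis abs_ge_self order_trans prod.collapse real_norm_def)
  qed simp
qed

lemma lborel_Fubini:
  fixes f :: "'a::euclidean_space \<Rightarrow> 'b::euclidean_space \<Rightarrow> complex"
  assumes "integrable lborel (case_prod f)"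
  shows "(LINT y|lborel. LINT x|lborel. f x y) = (LINT x|lborel. LINT y|lborel. f x y)"
    and "(LINT x|lborel. LINT y|lborel. f x y) = (LINT p|lborel. case_prod f p)"
  using lborel_pair.Fubini_integral[of f] lborel_pair.integral_fst[of f] assms by (simp_all add: lborel_prod)

text \<open>As \<open>e\<close> tends to 0 the right-hand side, as a function of \<open>x\<close>,
  concentrates at 0 with constant total mass \<open>(2 * pi) ^ DIM('a)\<close>. It is the
  approximate identity of the inversion proof.\<close>

lemma gaussian_scaled_fourier:
  fixes x :: "'a::euclidean_space"
  assumes e: "e > 0"
  shows "(LINT v|lborel. cis ((v::'a) \<bullet> x) * gaussian (e *\<^sub>R v))
    = (sqrt (2 * pi) / e) ^ DIM('a) * gaussian (x /\<^sub>R e)"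
proof -
  have "(LINT v|lborel. cis ((v::'a) \<bullet> (x /\<^sub>R e)) * gaussian v)
    = e ^ DIM('a) *\<^sub>R (LINT v|lborel. cis ((v::'a) \<bullet> x) * gaussian (e *\<^sub>R v))"
    using e by (subst lborel_integral_affine[where c=e and t=0])
      (auto simp flip: mult.assoc intro!: borel_measurable_continuous_onI continuous_intros)
  then show ?thesis
    using e unfolding gaussian_fourier by (simp add: scaleR_conv_of_real field_simps power_divide)
qed

text \<open>Gauss summation. The factor \<open>gaussian (e k *\<^sub>R \<xi>)\<close> makes the
  double integral absolutely convergent; after exchanging the integrals the expression is an average
  of \<open>g\<close> near \<open>t\<close>. Both forms pass to the limit by dominated convergence,
  under \<open>norm (fourier g \<xi>)\<close> and under \<open>K * gaussian v\<close>. Continuity of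
  \<open>g\<close> makes the result hold at every point.\<close>

lemma fourier_inversion:
  fixes g :: "real^'n::finite \<Rightarrow> complex"
  assumes cont: "continuous_on UNIV g" and bdd: "\<And>x. norm (g x) \<le> K"
    and int: "integrable lborel g" and intF: "integrable lborel (fourier g)"
  shows "(LINT \<xi>|lborel. fourier g \<xi> * cis (t \<bullet> \<xi>)) = (2 * pi) ^ CARD('n) * g t"
proof -
  define e where "e k = 1 / (real k + 1)" for k :: nat
  have e_pos: "e k > 0" for k by (simp add: e_def)
  have e_lim: "e \<longlonglongrightarrow> 0"
    unfolding e_def using LIMSEQ_inverse_real_of_nat by (simp add: inverse_eq_divide add.commute)
  define L where "L k = (LINT \<xi>|lborel. fourier g \<xi> * cis (t \<bullet> \<xi>) * gaussian (e k *\<^sub>R \<xi>))" for k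
  have [measurable]: "g \<in> borel_measurable borel" "fourier g \<in> borel_measurable borel"
    using int intF by auto
  have [measurable]: "(\<lambda>\<xi>. cis (t \<bullet> \<xi>)) \<in> borel_measurable borel"
    by (intro borel_measurable_continuous_onI continuous_intros)
  have 1: "L \<longlonglongrightarrow> (LINT \<xi>|lborel. fourier g \<xi> * cis (t \<bullet> \<xi>))"
    unfolding L_def
  proof (rule integral_dominated_convergence[where w="\<lambda>\<xi>. norm (fourier g \<xi>)"])
    show "AE \<xi> in lborel. (\<lambda>k. fourier g \<xi> * cis (t \<bullet> \<xi>) * gaussian (e k *\<^sub>R \<xi>)) \<longlonglongrightarrow> fourier g \<xi> * cis (t \<bullet> \<xi>)"
    proof (rule AE_I2)
      fix \<xi> :: "real^'n"
      have "(\<lambda>k. fourier g \<xi> * cis (t \<bullet> \<xi>) * complex_of_real (exp (- (norm (e k *\<^sub>R \<xi>))\<^sup>2 / 2)))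
         \<longlonglongrightarrow> fourier g \<xi> * cis (t \<bullet> \<xi>) * complex_of_real (exp (- (norm (0 *\<^sub>R \<xi>))\<^sup>2 / 2))"
        by (intro tendsto_intros e_lim) auto
      then show "(\<lambda>k. fourier g \<xi> * cis (t \<bullet> \<xi>) * gaussian (e k *\<^sub>R \<xi>)) \<longlonglongrightarrow> fourier g \<xi> * cis (t \<bullet> \<xi>)"
        by (simp add: gaussian_def)
    qed
    show "AE \<xi> in lborel. norm (fourier g \<xi> * cis (t \<bullet> \<xi>) * gaussian (e k *\<^sub>R \<xi>)) \<le> norm (fourier g \<xi>)" for k
      by (intro AE_I2) (auto simp: norm_mult gaussian_def intro!: mult_left_le)
  qed (use intF in auto)
  have L: "L k = sqrt (2 * pi) ^ CARD('n) * (LINT v|lborel. g (t - e k *\<^sub>R v) * gaussian v)" for k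
  proof -
    have "L k = (LINT \<xi>|lborel. LINT s|lborel. g s * cis (\<xi> \<bullet> (t - s)) * gaussian (e k *\<^sub>R \<xi>))"
      unfolding L_def fourier_def integral_mult_left_zero[symmetric]
      by (intro Bochner_Integration.integral_cong refl)
        (auto simp: algebra_simps cis_mult inner_diff_right inner_commute)
    also have "\<dots> = (LINT s|lborel. LINT \<xi>|lborel. g s * cis (\<xi> \<bullet> (t - s)) * gaussian (e k *\<^sub>R \<xi>))"
    proof (rule lborel_Fubini(1), rule integrable_lborel_pairI)
      show "integrable lborel (\<lambda>s. norm (g s))" using int by auto
      show "integrable lborel (\<lambda>\<xi>. gaussian (e k *\<^sub>R \<xi>))"
        using lborel_integrable_affine[OF gaussian_integrable, of "e k" 0] e_pos[of k] by simp
      show "(\<lambda>(s, \<xi>). g s * cis (\<xi> \<bullet> (t - s)) * gaussian (e k *\<^sub>R \<xi>)) \<in> borel_measurable borel"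
        unfolding split_beta
        by (intro borel_measurable_continuous_onI continuous_intros continuous_on_compose2[OF cont]) auto
    qed (auto simp: norm_mult gaussian_def)
    also have "\<dots> = (LINT s|lborel. g s * ((sqrt (2 * pi) / e k) ^ CARD('n) * gaussian ((t - s) /\<^sub>R e k)))"
      by (simp add: mult.assoc gaussian_scaled_fourier[OF e_pos])
    \<comment> \<open>Substitute s = t - e v; the Jacobian cancels the power of
      \<open>1 / e k\<close> from the scaled Gaussian.\<close>
    also have "\<dots> = e k ^ CARD('n) *\<^sub>R (LINT v|lborel. g (t - e k *\<^sub>R v) *
         ((sqrt (2 * pi) / e k) ^ CARD('n) * gaussian v))"
      using e_pos[of k]
      by (subst lborel_integral_affine[where c="- e k" and t=t])
        (auto simp: DIM_cart intro!: borel_measurable_continuous_onI continuous_intros cont)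
    also have "\<dots> = sqrt (2 * pi) ^ CARD('n) * (LINT v|lborel. g (t - e k *\<^sub>R v) * gaussian v)"
      using e_pos[of k] 
      by (simp add: scaleR_scaleR power_divide mult.left_commute[of "g _"] scaleR_conv_of_real[where 'a=complex] del: scaleR_conv_of_real)
    finally show ?thesis .
  qed
  have 2: "(\<lambda>k. LINT v|lborel. g (t - e k *\<^sub>R v) * gaussian v) \<longlonglongrightarrow> (LINT v|lborel. g t * gaussian (v::real^'n))"
  proof (rule integral_dominated_convergence[where w="\<lambda>v. K * gaussian v"])
    show "AE v in lborel. (\<lambda>k. g (t - e k *\<^sub>R v) * gaussian v) \<longlonglongrightarrow> g t * gaussian v"
    proof (rule AE_I2)
      fix v :: "real^'n"
      have "(\<lambda>k. t - e k *\<^sub>R v) \<longlonglongrightarrow> t - 0 *\<^sub>R v"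
        by (intro tendsto_intros e_lim)
      then have "(\<lambda>k. g (t - e k *\<^sub>R v)) \<longlonglongrightarrow> g t"
        using cont by (intro isCont_tendsto_compose[of t g]) (auto simp: continuous_on_eq_continuous_at)
      then show "(\<lambda>k. g (t - e k *\<^sub>R v) * gaussian v) \<longlonglongrightarrow> g t * gaussian v"
        by (intro tendsto_intros)
    qed
    show "AE v in lborel. norm (g (t - e k *\<^sub>R v) * gaussian v) \<le> K * gaussian v" for k
      using bdd by (intro AE_I2) (auto simp: norm_mult gaussian_def)
  qed (auto intro!: integrable_mult_right gaussian_integrable)
  have "L \<longlonglongrightarrow> sqrt (2 * pi) ^ CARD('n) * (LINT v|lborel. g t * gaussian (v::real^'n))"
    unfolding L by (intro tendsto_intros 2)
  also have "(LINT v|lborel. g t * gaussian (v::real^'n)) = g t * sqrt (2 * pi) ^ CARD('n)"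
    by (simp add: gaussian_integral)
  finally have "L \<longlonglongrightarrow> complex_of_real (sqrt (2 * pi)) ^ CARD('n) * (g t * complex_of_real (sqrt (2 * pi)) ^ CARD('n))"
    by simp
  \<comment> \<open>One factor \<open>sqrt (2 * pi) ^ CARD('n)\<close> comes from the transform of
    the Gaussian, the other from its mass.\<close>
  from LIMSEQ_unique[OF 1 this]
  have "(LINT \<xi>|lborel. fourier g \<xi> * cis (t \<bullet> \<xi>)) = (complex_of_real (sqrt (2 * pi)) * complex_of_real (sqrt (2 * pi))) ^ CARD('n) * g t"
    by (simp add: power_mult_distrib)
  then show ?thesis
    by (simp flip: of_real_mult of_real_power add: power_mult_distrib)
qed

text \<open>Write out the transform of \<open>f\<close>, exchange the integrals and invert the
  transform of \<open>g\<close>. The double integral is dominated by the product of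
  \<open>norm (f t)\<close> and \<open>norm (fourier g \<xi>)\<close>.\<close>

lemma fourier_parseval:
  fixes f g :: "real^'n::finite \<Rightarrow> complex"
  assumes cont: "continuous_on UNIV g" and bdd: "\<And>x. norm (g x) \<le> K"
    and int: "integrable lborel g" and intF: "integrable lborel (fourier g)" "continuous_on UNIV (fourier g)"
    and f: "integrable lborel f" "continuous_on UNIV f"
  shows "(LINT \<xi>|lborel. fourier f \<xi> * cnj (fourier g \<xi>)) = (2 * pi) ^ CARD('n) * (LINT t|lborel. f t * cnj (g t))"
proof -
  have "(LINT \<xi>|lborel. fourier f \<xi> * cnj (fourier g \<xi>))
     = (LINT \<xi>|lborel. LINT t|lborel. f t * cis (- (t \<bullet> \<xi>)) * cnj (fourier g \<xi>))"
    by (simp add: fourier_def[of f])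
  also have "\<dots> = (LINT t|lborel. LINT \<xi>|lborel. f t * cis (- (t \<bullet> \<xi>)) * cnj (fourier g \<xi>))"
  proof (rule lborel_Fubini(1), rule integrable_lborel_pairI)
    show "integrable lborel (\<lambda>s. norm (f s))" "integrable lborel (\<lambda>s. norm (fourier g s))"
      using f intF by auto
    show "(\<lambda>(t, \<xi>). f t * cis (- (t \<bullet> \<xi>)) * cnj (fourier g \<xi>)) \<in> borel_measurable borel"
      unfolding split_beta
      by (intro borel_measurable_continuous_onI continuous_intros continuous_on_compose2[OF f(2)]
          continuous_on_compose2[OF intF(2)]) auto
  qed (auto simp: norm_mult)
  also have "\<dots> = (LINT t|lborel. f t * cnj (LINT \<xi>|lborel. fourier g \<xi> * cis (t \<bullet> \<xi>)))"
    by (subst Bochner_Integration.integral_cnj[symmetric])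
       (simp add: cis_cnj mult.assoc mult.commute[of "cnj (fourier g _)"])
  also have "\<dots> = (2 * pi) ^ CARD('n) * (LINT t|lborel. f t * cnj (g t))"
    by (simp add: fourier_inversion[OF cont bdd int intF(1)] mult.left_commute[of "f _"] mult.assoc del: of_real_power of_real_mult)
  finally show ?thesis .
qed

section \<open>Weights and iterated partial derivatives\<close>

locale weight =
  fixes w :: "real \<Rightarrow> real"
  assumes w: "weight_function w"
begin

lemma w_nonneg: "t \<ge> 0 \<Longrightarrow> w t \<ge> 0"
  and w_mono: "0 \<le> s \<Longrightarrow> s \<le> t \<Longrightarrow> w s \<le> w t"
  and w_add: "s \<ge> 0 \<Longrightarrow> t \<ge> 0 \<Longrightarrow> w (s + t) \<le> w s + w t"
  and w_cont: "continuous_on {0..} w"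
  using w unfolding weight_function_def by (auto simp: monotone_on_def)

lemma w_triangle: "w (norm (x + y)) \<le> w (norm x) + w (norm y)"
  using w_mono[of "norm (x + y)" "norm x + norm y"] w_add[of "norm x" "norm y"] norm_triangle_ineq[of x y]
  by simp

lemma w_triangle_diff: "w (norm (x - y)) \<le> w (norm x) + w (norm y)"
  using w_triangle[of x "- y"] by simp

lemma w_double: "norm y \<le> 2 * norm x \<Longrightarrow> w (norm y) \<le> 2 * w (norm x)"
  using w_mono[of "norm y" "norm x + norm x"] w_add[of "norm x" "norm x"] by simp

lemma continuous_on_w_norm [continuous_intros]:
  "continuous_on A f \<Longrightarrow> continuous_on A (\<lambda>x. w (norm (f x)))"
  by (intro continuous_on_compose2[OF w_cont] continuous_intros) auto

lemma w_norm_measurable [measurable]: "(\<lambda>x::'a::euclidean_space. w (norm x)) \<in> borel_measurable borel"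
  by (intro borel_measurable_continuous_onI continuous_intros)

text \<open>Condition (gamma) exponentiated. It lets the weight absorb polynomial factors, such as
  the frequency coordinates that differentiation of a modulation produces.\<close>

lemma one_plus_le_exp_w:
  obtains C M where "C > 0" "M > 0" "\<And>t. t \<ge> 0 \<Longrightarrow> 1 + t \<le> C * exp (M * w t)"
proof -
  obtain a b where b: "b > 0" and ab: "\<And>t. t \<ge> 0 \<Longrightarrow> w t \<ge> a + b * ln (1 + t)"
    using w unfolding weight_function_def by blast
  have "1 + t \<le> exp (- a / b) * exp (1 / b * w t)" if "t \<ge> 0" for t
  proof -
    have "ln (1 + t) \<le> - a / b + 1 / b * w t"
      using ab[OF that] b by (simp add: field_simps)
    then have "exp (ln (1 + t)) \<le> exp (- a / b + 1 / b * w t)"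
      by (simp only: exp_le_cancel_iff)
    then show ?thesis
      using that by (simp only: exp_add) simp
  qed
  with b show thesis by (intro that[of "exp (- a / b)" "1 / b"]) auto
qed

lemma integrable_exp_w:
  obtains L where "L > 0" "\<And>lam. lam \<ge> L \<Longrightarrow> integrable lborel (\<lambda>z::'a::euclidean_space. exp (- lam * w (norm z)))"
proof -
  obtain C M where C: "C > 0" and M: "M > 0" and CM: "\<And>t. t \<ge> 0 \<Longrightarrow> 1 + t \<le> C * exp (M * w t)"
    using one_plus_le_exp_w by metis
  define k where "k = 2 * DIM('a)"
  define L where "L = real k * M"
  have "L > 0" unfolding L_def k_def using M by simp
  moreover have "integrable lborel (\<lambda>z::'a. exp (- lam * w (norm z)))" if "lam \<ge> L" for lam
  proof (rule Bochner_Integration.integrable_bound)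
    show "integrable lborel (\<lambda>z::'a. C ^ k * inverse ((1 + norm z) ^ k))"
      unfolding k_def by (intro integrable_mult_right integrable_inverse_one_plus_norm_power)
    show "AE z in lborel. norm (exp (- lam * w (norm z))) \<le> norm (C ^ k * inverse ((1 + norm (z::'a)) ^ k))"
    proof (rule AE_I2)
      fix z :: 'a
      have "(1 + norm z) ^ k \<le> (C * exp (M * w (norm z))) ^ k"
        by (intro power_mono CM) auto
      also have "\<dots> = C ^ k * exp (L * w (norm z))"
        by (simp add: power_mult_distrib L_def exp_of_nat_mult[symmetric] mult.assoc)
      also have "\<dots> \<le> C ^ k * exp (lam * w (norm z))"
        using C that w_nonneg[of "norm z"] by (intro mult_left_mono) (auto intro: mult_right_mono)
      finally have "(1 + norm z) ^ k \<le> C ^ k * exp (lam * w (norm z))" .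
      moreover have "0 < (1 + norm z) ^ k" by (intro zero_less_power) (simp add: add_pos_nonneg)
      ultimately show "norm (exp (- lam * w (norm z))) \<le> norm (C ^ k * inverse ((1 + norm z) ^ k))"
        using C by (simp add: exp_minus field_simps)
    qed
  qed measurable
  ultimately show thesis by (rule that)
qed

text \<open>In other words, \<open>w\<close> tends to infinity; this too comes from the logarithmic
  lower bound.\<close>

lemma exp_w_small:
  assumes "e > 0"
  obtains R where "\<And>t. t \<ge> 0 \<Longrightarrow> t > R \<Longrightarrow> exp (- w t) < e"
proof -
  obtain C M where C: "C > 0" and M: "M > 0" and CM: "\<And>t. t \<ge> 0 \<Longrightarrow> 1 + t \<le> C * exp (M * w t)"
    using one_plus_le_exp_w by metis
  have "exp (- w t) < e" if "t \<ge> 0" "t > C * exp (M * - ln e)" for t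
  proof (rule ccontr)
    assume "\<not> exp (- w t) < e"
    then have "ln e \<le> - w t"
      using assms by (metis exp_le_cancel_iff exp_ln not_less)
    then have "C * exp (M * w t) \<le> C * exp (M * - ln e)"
      using C M mult_left_mono[of "w t" "- ln e" M] by auto
    with CM[of t] that show False by linarith
  qed
  then show thesis by (rule that)
qed

end

section \<open>Smoothness and iterated partial derivatives\<close>

text \<open>Smoothness from an invariant: in a class \<open>A\<close> of continuous functions closed
  under partial derivatives, no iterated derivative ever leaves \<open>A\<close>, so no formula for
  it is required.\<close>

lemma smooth_fun_coinduct:
  fixes f :: "real^'n::finite \<Rightarrow> complex"
  assumes "f \<in> A"
    and cont: "\<And>f. f \<in> A \<Longrightarrow> continuous_on UNIV f"
    and der: "\<And>f i. f \<in> A \<Longrightarrow> \<exists>f'\<in>A. \<forall>x. ((\<lambda>t. f (x + t *\<^sub>R axis i 1)) has_vector_derivative f' x) (at 0)"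
  shows "smooth_fun f"
proof -
  have in_A: "dpart is f \<in> A" for "is"
  proof (induction "is")
    case (Cons i "is")
    from der[OF Cons, of i] obtain f' where f': "f' \<in> A"
      "\<And>x. ((\<lambda>t. dpart is f (x + t *\<^sub>R axis i 1)) has_vector_derivative f' x) (at 0)"
      by blast
    have "dpart (i # is) f = f'"
      using vector_derivative_at[OF f'(2)] by auto
    with f' show ?case by simp
  qed (simp add: assms)
  show ?thesis
    unfolding smooth_fun_def
  proof (intro conjI allI)
    fix "is" i and x :: "real^'n"
    from der[OF in_A, of "is" i] obtain f' where
      f': "((\<lambda>t. dpart is f (x + t *\<^sub>R axis i 1)) has_vector_derivative f' x) (at 0)"
      by blast
    with vector_derivative_at[OF f']
    show "((\<lambda>t. dpart is f (x + t *\<^sub>R axis i 1)) has_vector_derivative dpart (i # is) f x) (at 0)"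
      by simp
  qed (use in_A cont in blast)
qed

lemma smooth_funD:
  assumes "smooth_fun f"
  shows "((\<lambda>t. dpart is f (x + t *\<^sub>R axis i 1)) has_vector_derivative dpart (i # is) f x) (at 0)"
    and "continuous_on UNIV (dpart is f)" and "continuous_on UNIV f"
proof -
  show 1: "continuous_on UNIV (dpart is f)" for "is"
    using assms unfolding smooth_fun_def by blast
  show "continuous_on UNIV f" using 1[of "[]"] by simp
  show "((\<lambda>t. dpart is f (x + t *\<^sub>R axis i 1)) has_vector_derivative dpart (i # is) f x) (at 0)"
    using assms unfolding smooth_fun_def by blast
qed

lemma dpart_append: "dpart (is @ js) f = dpart is (dpart js f)"
  by (induction "is") auto

lemma dpart_snoc: "dpart (is @ [i]) f = dpart is (dpart [i] f)"
  by (rule dpart_append)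

lemma smooth_fun_dpart: "smooth_fun f \<Longrightarrow> smooth_fun (dpart js f)"
  unfolding smooth_fun_def dpart_append[symmetric] by (metis append_Cons)

lemma dpart_lincomb:
  assumes f: "smooth_fun f" and g: "smooth_fun g"
  shows "dpart is (\<lambda>x. c * f x + d * g x) = (\<lambda>x. c * dpart is f x + d * dpart is g x)"
proof (induction "is")
  case (Cons i "is")
  have "((\<lambda>t. dpart is (\<lambda>x. c * f x + d * g x) (x + t *\<^sub>R axis i 1)) has_vector_derivative
     c * dpart (i # is) f x + d * dpart (i # is) g x) (at 0)" for x
    unfolding Cons by (intro derivative_intros smooth_funD(1)[OF f] smooth_funD(1)[OF g])
  from vector_derivative_at[OF this] show ?case by auto
qed simp

lemma smooth_fun_lincomb:
  assumes f: "smooth_fun f" and g: "smooth_fun g"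
  shows "smooth_fun (\<lambda>x. c * f x + d * g x)"
  unfolding smooth_fun_def dpart_lincomb[OF f g]
  by (intro conjI allI derivative_intros continuous_intros smooth_funD(1)[OF f] smooth_funD(1)[OF g]
      smooth_funD(2)[OF f] smooth_funD(2)[OF g])

lemma tf_shift_has_partial:
  assumes g: "smooth_fun (g :: real^'n::finite \<Rightarrow> complex)"
  shows "((\<lambda>t. tf_shift z g (x + t *\<^sub>R axis i 1)) has_vector_derivative
    \<i> * (snd z $ i) * tf_shift z g x + tf_shift z (dpart [i] g) x) (at 0)"
proof -
  have 1: "((\<lambda>t. cis ((x + t *\<^sub>R axis i 1) \<bullet> snd z)) has_vector_derivative \<i> * (snd z $ i) * cis (x \<bullet> snd z)) (at 0)"
  proof -
    have "((\<lambda>s. exp (\<i> * (complex_of_real (x \<bullet> snd z) + s * complex_of_real (snd z $ i)))) has_field_derivative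
       \<i> * (snd z $ i) * exp (\<i> * complex_of_real (x \<bullet> snd z))) (at (of_real 0))"
      by (auto intro!: derivative_eq_intros)
    from has_vector_derivative_real_field[OF this, of UNIV]
    show ?thesis
      by (simp add: cis_conv_exp inner_add_left inner_axis' mult_ac)
  qed
  have 2: "((\<lambda>t. g (x + t *\<^sub>R axis i 1 - fst z)) has_vector_derivative dpart [i] g (x - fst z)) (at 0)"
    using smooth_funD(1)[OF g, of "[]" "x - fst z" i] by (simp add: algebra_simps)
  show ?thesis
    unfolding tf_shift_def
    by (rule has_vector_derivative_eq_rhs[OF has_vector_derivative_mult[OF 1 2]]) simp
qed

text \<open>The invariant class for \<open>smooth_fun_coinduct\<close>. A partial derivative of
  \<open>tf_shift z g\<close> is a combination of \<open>tf_shift z g\<close> and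
  \<open>tf_shift z (dpart [i] g)\<close>, so the span is closed under differentiation.\<close>

inductive_set tf_span :: "(real^'n::finite) \<times> (real^'n) \<Rightarrow> (real^'n \<Rightarrow> complex) set" for z where
  base: "smooth_fun g \<Longrightarrow> tf_shift z g \<in> tf_span z"
| lincomb: "f \<in> tf_span z \<Longrightarrow> g \<in> tf_span z \<Longrightarrow> (\<lambda>x. c * f x + d * g x) \<in> tf_span z"

lemma smooth_fun_tf_shift:
  assumes "smooth_fun g"
  shows "smooth_fun (tf_shift z g)"
proof (rule smooth_fun_coinduct[where A="tf_span z"])
  show "tf_shift z g \<in> tf_span z" by (rule tf_span.base[OF assms])
next
  fix f assume "f \<in> tf_span z"
  then show "continuous_on UNIV f"
  proof induction
    case (base g)
    show ?case unfolding tf_shift_def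
      by (intro continuous_intros continuous_on_compose2[OF smooth_funD(3)[OF base]]) auto
  qed (intro continuous_intros)
next
  fix f i assume "f \<in> tf_span z"
  then show "\<exists>f'\<in>tf_span z. \<forall>x. ((\<lambda>t. f (x + t *\<^sub>R axis i 1)) has_vector_derivative f' x) (at 0)"
  proof induction
    case (base g)
    have "(\<lambda>x. \<i> * (snd z $ i) * tf_shift z g x + 1 * tf_shift z (dpart [i] g) x) \<in> tf_span z"
      by (intro tf_span.intros base smooth_fun_dpart)
    with tf_shift_has_partial[OF base] show ?case by fastforce
  next
    case (lincomb f g c d)
    then obtain f' g' where f': "f' \<in> tf_span z" "\<And>x. ((\<lambda>t. f (x + t *\<^sub>R axis i 1)) has_vector_derivative f' x) (at 0)"
      and g': "g' \<in> tf_span z" "\<And>x. ((\<lambda>t. g (x + t *\<^sub>R axis i 1)) has_vector_derivative g' x) (at 0)"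
      by blast
    show ?case
      by (rule bexI[where x="\<lambda>x. c * f' x + d * g' x"])
         (intro allI derivative_intros f' g' tf_span.intros)+
  qed
qed

text \<open>The last index is the derivative taken first, so peeling it off replaces
  \<open>g\<close> by \<open>dpart [i] g\<close>. Hence the later inductions run from the end of the
  list and generalise over \<open>g\<close>. The coefficient \<open>1 *\<close> gives the shape of
  \<open>dpart_lincomb\<close>.\<close>

lemma dpart_tf_shift_snoc:
  assumes g: "smooth_fun g"
  shows "dpart (is @ [i]) (tf_shift z g) =
    (\<lambda>x. \<i> * (snd z $ i) * dpart is (tf_shift z g) x + 1 * dpart is (tf_shift z (dpart [i] g)) x)"
proof -
  have "dpart [i] (tf_shift z g) = (\<lambda>x. \<i> * (snd z $ i) * tf_shift z g x + 1 * tf_shift z (dpart [i] g) x)"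
    using vector_derivative_at[OF tf_shift_has_partial[OF g]] by auto
  then show ?thesis
    unfolding dpart_snoc
    by (simp only: dpart_lincomb[OF smooth_fun_tf_shift[OF g] smooth_fun_tf_shift[OF smooth_fun_dpart[OF g]]])
qed

section \<open>Time-frequency shifts of rapidly decaying functions\<close>

context weight
begin

text \<open>The conditions that \<open>S_omega\<close> imposes on one side only. Facts about this
  class are applied both to \<open>f\<close> and to \<open>fourier f\<close>.\<close>

definition decaying :: "(real^'n::finite \<Rightarrow> complex) set" where
  "decaying = {g. smooth_fun g \<and> (\<forall>lam>0. \<forall>is. wbounded w lam (dpart is g))}"

lemma S_omega_iff: "f \<in> S_omega w \<longleftrightarrow> f \<in> decaying \<and> fourier f \<in> decaying"
  unfolding S_omega_def decaying_def by auto

lemma decaying_smooth: "g \<in> decaying \<Longrightarrow> smooth_fun g"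
  unfolding decaying_def by simp

lemma decaying_bound:
  assumes "g \<in> decaying"
  obtains C where "C \<ge> 0" "\<And>x. cmod (dpart is g x) * exp (lam * w (norm x)) \<le> C"
proof -
  \<comment> \<open>The definition speaks of positive exponents only; since \<open>w\<close> is
    nonnegative, a bound for a larger exponent covers every real \<open>lam\<close>.\<close>
  have "max lam 1 > 0" by simp
  then obtain C where C: "\<And>x. cmod (dpart is g x) * exp (max lam 1 * w (norm x)) \<le> C"
    using assms unfolding decaying_def wbounded_def by blast
  have *: "cmod (dpart is g x) * exp (lam * w (norm x)) \<le> C" for x
    by (rule order_trans[OF _ C[of x]]) (auto intro!: mult_left_mono mult_right_mono w_nonneg)
  show thesis
    by (rule that[OF _ *]) (rule order_trans[OF _ *], simp)
qed

lemma decayingI: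
  assumes "smooth_fun g" "\<And>lam is. lam > 0 \<Longrightarrow> \<exists>C. \<forall>x. cmod (dpart is g x) * exp (lam * w (norm x)) \<le> C"
  shows "g \<in> decaying"
  using assms unfolding decaying_def wbounded_def by auto

lemma decaying_dpart: "g \<in> decaying \<Longrightarrow> dpart js g \<in> decaying"
  unfolding decaying_def using smooth_fun_dpart by (auto simp flip: dpart_append)

lemma decaying_lincomb:
  assumes f: "f \<in> decaying" and g: "g \<in> decaying"
  shows "(\<lambda>x. c * f x + d * g x) \<in> decaying"
proof (rule decayingI)
  show "smooth_fun (\<lambda>x. c * f x + d * g x)"
    by (intro smooth_fun_lincomb decaying_smooth f g)
  fix lam :: real and "is" assume "lam > 0"
  obtain C where C: "\<And>x. cmod (dpart is f x) * exp (lam * w (norm x)) \<le> C"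
    using decaying_bound[OF f] by metis
  obtain D where D: "\<And>x. cmod (dpart is g x) * exp (lam * w (norm x)) \<le> D"
    using decaying_bound[OF g] by metis
  have "cmod (dpart is (\<lambda>x. c * f x + d * g x) x) * exp (lam * w (norm x)) \<le> cmod c * C + cmod d * D" for x
  proof -
    have "cmod (c * dpart is f x + d * dpart is g x) * exp (lam * w (norm x))
      \<le> (cmod c * cmod (dpart is f x) + cmod d * cmod (dpart is g x)) * exp (lam * w (norm x))"
      by (intro mult_right_mono order_trans[OF norm_triangle_ineq]) (auto simp: norm_mult)
    also have "\<dots> = cmod c * (cmod (dpart is f x) * exp (lam * w (norm x))) + cmod d * (cmod (dpart is g x) * exp (lam * w (norm x)))"
      by (simp add: algebra_simps)
    also have "\<dots> \<le> cmod c * C + cmod d * D"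
      by (intro add_mono mult_left_mono C D) auto
    finally show ?thesis
      by (simp add: dpart_lincomb[OF decaying_smooth[OF f] decaying_smooth[OF g]])
  qed
  then show "\<exists>C. \<forall>x. cmod (dpart is (\<lambda>x. c * f x + d * g x) x) * exp (lam * w (norm x)) \<le> C"
    by blast
qed

lemma decaying_integrable:
  assumes "g \<in> decaying"
  shows "integrable lborel g"
proof -
  obtain L where L: "integrable lborel (\<lambda>z::real^'a. exp (- L * w (norm z)))"
    using integrable_exp_w[where 'a="real^'a"] by (metis order_refl)
  obtain C where C: "\<And>x. cmod (dpart [] g x) * exp (L * w (norm x)) \<le> C"
    using decaying_bound[OF assms] by metis
  show ?thesis
  proof (rule Bochner_Integration.integrable_bound)
    show "integrable lborel (\<lambda>z::real^'a. C * exp (- L * w (norm z)))"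
      by (intro integrable_mult_right L)
    show "g \<in> borel_measurable lborel"
      using smooth_funD(3)[OF decaying_smooth[OF assms]] by (simp add: borel_measurable_continuous_onI)
    show "AE x in lborel. norm (g x) \<le> norm (C * exp (- L * w (norm x)))"
    proof (rule AE_I2)
      fix x
      have "norm (g x) \<le> C * exp (- L * w (norm x))"
        using C[of x] by (simp add: exp_minus field_simps)
      then show "norm (g x) \<le> norm (C * exp (- L * w (norm x)))" by simp
    qed
  qed
qed

lemma decaying_continuous: "g \<in> decaying \<Longrightarrow> continuous_on UNIV g"
  by (rule smooth_funD(3)[OF decaying_smooth])

lemma decaying_bounded:
  assumes "g \<in> decaying" obtains K where "\<And>x. norm (g x) \<le> K"
proof -
  obtain C where "\<And>x. cmod (dpart [] g x) * exp (0 * w (norm x)) \<le> C"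
    using decaying_bound[OF assms] by metis
  then show thesis by (intro that[of C]) simp
qed

text \<open>Subadditivity splits the weight at \<open>t\<close> into the weight at
  \<open>t - fst z\<close>, absorbed by the decay of \<open>g\<close>, and the weight at
  \<open>fst z\<close>, which is the price in \<open>z\<close>. Each derivative either falls on
  \<open>g\<close> or brings down a coordinate of \<open>snd z\<close>, which
  \<open>one_plus_le_exp_w\<close> bounds.\<close>

lemma dpart_tf_shift_bound:
  assumes "g \<in> decaying" and lam: "lam \<ge> 0"
  shows "\<exists>C M. C \<ge> 0 \<and> M \<ge> 0 \<and> (\<forall>z t. cmod (dpart is (tf_shift z g) t) * exp (lam * w (norm t)) \<le> C * exp (M * w (norm z)))"
  using assms(1)
proof (induction "is" arbitrary: g rule: rev_induct)
  case Nil
  obtain C where C: "C \<ge> 0" "\<And>x. cmod (dpart [] g x) * exp (lam * w (norm x)) \<le> C"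
    using decaying_bound[OF Nil] by metis
  have "cmod (tf_shift z g t) * exp (lam * w (norm t)) \<le> C * exp (lam * w (norm z))" for z t
  proof -
    have "w (norm t) \<le> w (norm (t - fst z)) + w (norm (fst z))"
      using w_triangle[of "t - fst z" "fst z"] by simp
    also have "w (norm (fst z)) \<le> w (norm z)"
      using norm_fst_le[of "fst z" "snd z"] by (intro w_mono) auto
    finally have "lam * w (norm t) \<le> lam * w (norm (t - fst z)) + lam * w (norm z)"
      using lam by (simp add: mult_left_mono flip: distrib_left)
    then have "cmod (tf_shift z g t) * exp (lam * w (norm t)) \<le> cmod (g (t - fst z)) * exp (lam * w (norm (t - fst z)) + lam * w (norm z))"
      by (auto simp: tf_shift_def norm_mult intro!: mult_left_mono)
    also have "\<dots> = (cmod (g (t - fst z)) * exp (lam * w (norm (t - fst z)))) * exp (lam * w (norm z))"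
      by (simp add: exp_add)
    also have "\<dots> \<le> C * exp (lam * w (norm z))"
      using C(2)[of "t - fst z"] by (intro mult_right_mono) auto
    finally show ?thesis .
  qed
  with C(1) lam show ?case by auto
next
  case (snoc i "is")
  obtain C M where CM: "C \<ge> 0" "M \<ge> 0" "\<And>z t. cmod (dpart is (tf_shift z g) t) * exp (lam * w (norm t)) \<le> C * exp (M * w (norm z))"
    using snoc.IH[OF snoc.prems] by blast
  obtain C' M' where CM': "C' \<ge> 0" "M' \<ge> 0" "\<And>z t. cmod (dpart is (tf_shift z (dpart [i] g)) t) * exp (lam * w (norm t)) \<le> C' * exp (M' * w (norm z))"
    using snoc.IH[OF decaying_dpart[OF snoc.prems]] by blast
  obtain D P where DP: "D > 0" "P > 0" "\<And>t. t \<ge> 0 \<Longrightarrow> 1 + t \<le> D * exp (P * w t)"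
    using one_plus_le_exp_w by metis
  have "cmod (dpart (is @ [i]) (tf_shift z g) t) * exp (lam * w (norm t)) \<le> (D * C + C') * exp ((P + M + M') * w (norm z))" for z t
  proof -
    have z: "\<bar>snd z $ i\<bar> \<le> D * exp (P * w (norm z))"
    proof -
      have "\<bar>snd z $ i\<bar> \<le> norm z"
        using component_le_norm_cart[of "snd z" i] norm_snd_le[of "snd z" "fst z"] by simp
      with DP(3)[of "norm z"] show ?thesis by simp
    qed
    have "cmod (dpart (is @ [i]) (tf_shift z g) t) * exp (lam * w (norm t))
      \<le> (\<bar>snd z $ i\<bar> * cmod (dpart is (tf_shift z g) t) + cmod (dpart is (tf_shift z (dpart [i] g)) t)) * exp (lam * w (norm t))"
      unfolding dpart_tf_shift_snoc[OF decaying_smooth[OF snoc.prems]]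
      by (intro mult_right_mono order_trans[OF norm_triangle_ineq]) (auto simp: norm_mult)
    also have "\<dots> = \<bar>snd z $ i\<bar> * (cmod (dpart is (tf_shift z g) t) * exp (lam * w (norm t))) + cmod (dpart is (tf_shift z (dpart [i] g)) t) * exp (lam * w (norm t))"
      by (simp add: algebra_simps)
    also have "\<dots> \<le> (D * exp (P * w (norm z))) * (C * exp (M * w (norm z))) + C' * exp (M' * w (norm z))"
      by (intro add_mono mult_mono[OF z CM(3)] CM'(3)) (use DP(1) in auto)
    also have "\<dots> = (D * C) * exp ((P + M) * w (norm z)) + C' * exp (M' * w (norm z))"
      by (simp add: exp_add algebra_simps)
    also have "\<dots> \<le> (D * C) * exp ((P + M + M') * w (norm z)) + C' * exp ((P + M + M') * w (norm z))"
      using CM CM' DP w_nonneg[of "norm z"] by (intro add_mono mult_left_mono) (auto intro!: mult_right_mono)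
    finally show ?thesis by (simp add: algebra_simps)
  qed
  moreover have "D * C + C' \<ge> 0" "P + M + M' \<ge> 0" using CM CM' DP by auto
  ultimately show ?case by blast
qed

lemma decaying_tf_shift: "g \<in> decaying \<Longrightarrow> tf_shift z g \<in> decaying"
proof (rule decayingI)
  fix lam :: real and "is" :: "'a list" assume g: "g \<in> decaying" and lam: "lam > 0"
  show "\<exists>C. \<forall>x. cmod (dpart is (tf_shift z g) x) * exp (lam * w (norm x)) \<le> C"
    using dpart_tf_shift_bound[OF g less_imp_le[OF lam], of "is"] by blast
qed (intro smooth_fun_tf_shift decaying_smooth)

lemma continuous_on_dpart_tf_shift:
  assumes "smooth_fun g"
  shows "continuous_on UNIV (\<lambda>(z, t). dpart is (tf_shift z g) t)"
  using assms
proof (induction "is" arbitrary: g rule: rev_induct)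
  case Nil
  show ?case
    unfolding split_beta tf_shift_def dpart.simps
    by (intro continuous_intros continuous_on_compose2[OF smooth_funD(3)[OF Nil]]) auto
next
  case (snoc i "is")
  show ?case
    using snoc.IH[OF snoc.prems] snoc.IH[OF smooth_fun_dpart[OF snoc.prems, of "[i]"]]
    unfolding dpart_tf_shift_snoc[OF snoc.prems] split_beta
    by (intro continuous_intros) auto
qed

section \<open>Kernels as continuous families of bounded functions\<close>

text \<open>Moderate growth in \<open>z\<close> allows integration against rapidly decaying
  functions. Decay in \<open>t\<close> upgrades joint continuity to continuity of
  \<open>z \<mapsto> F z\<close> in the supremum norm.\<close>

definition kernel :: "('z::euclidean_space \<Rightarrow> 't::euclidean_space \<Rightarrow> complex) \<Rightarrow> bool" where
  "kernel F \<longleftrightarrow> continuous_on UNIV (\<lambda>(z, t). F z t) \<and>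
    (\<exists>C M. C \<ge> 0 \<and> M \<ge> 0 \<and> (\<forall>z t. cmod (F z t) \<le> C * exp (M * w (norm z)) * exp (- w (norm t))))"

text \<open>\<open>A\<close> and \<open>P\<close> allow one statement for both sides: the identity
  and 1 for shifts of \<open>g\<close>, a rotation of phase space and a phase factor for their
  Fourier transforms.\<close>

lemma kernel_tf_shift:
  assumes g: "g \<in> decaying" and A: "continuous_on UNIV A" "\<And>z. norm (A z) = norm z"
    and P: "continuous_on UNIV P" "\<And>z. cmod (P z) = 1"
  shows "kernel (\<lambda>z t. P z * dpart is (tf_shift (A z) g) t * exp (real N * w (norm t)))"
  unfolding kernel_def
proof (intro conjI)
  have "continuous_on UNIV (\<lambda>p. case (A (fst p), snd p) of (z, t) \<Rightarrow> dpart is (tf_shift z g) t)"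
    by (rule continuous_on_compose2[OF continuous_on_dpart_tf_shift[OF decaying_smooth[OF g], of "is"]])
      (auto intro!: continuous_intros continuous_on_compose2[OF A(1)])
  then show "continuous_on UNIV (\<lambda>(z, t). P z * dpart is (tf_shift (A z) g) t * complex_of_real (exp (real N * w (norm t))))"
    unfolding split_beta by (intro continuous_intros continuous_on_compose2[OF P(1)]) auto
  \<comment> \<open>Estimating with \<open>real N + 1\<close> leaves one spare unit of weight, which
    becomes the factor \<open>exp (- w (norm t))\<close>.\<close>
  obtain C M where CM: "C \<ge> 0" "M \<ge> 0"
    "\<And>z t. cmod (dpart is (tf_shift z g) t) * exp ((real N + 1) * w (norm t)) \<le> C * exp (M * w (norm z))"
    using dpart_tf_shift_bound[OF g, of "real N + 1" "is"] by auto
  have "cmod (P z * dpart is (tf_shift (A z) g) t * exp (real N * w (norm t))) \<le> C * exp (M * w (norm z)) * exp (- w (norm t))" for z t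
  proof -
    have "cmod (P z * dpart is (tf_shift (A z) g) t * exp (real N * w (norm t)))
      = (cmod (dpart is (tf_shift (A z) g) t) * exp ((real N + 1) * w (norm t))) * exp (- w (norm t))"
      by (simp add: norm_mult P exp_minus distrib_right exp_add)
    also have "\<dots> \<le> (C * exp (M * w (norm (A z)))) * exp (- w (norm t))"
      by (intro mult_right_mono CM) auto
    finally show ?thesis by (simp add: A)
  qed
  with CM show "\<exists>C M. C \<ge> 0 \<and> M \<ge> 0 \<and> (\<forall>z t. cmod (P z * dpart is (tf_shift (A z) g) t * complex_of_real (exp (real N * w (norm t))))
     \<le> C * exp (M * w (norm z)) * exp (- w (norm t)))"
    by blast
qed

lemma kernel_bound:
  assumes "kernel F"
  shows "\<exists>C M. C \<ge> 0 \<and> M \<ge> 0 \<and> (\<forall>z t. cmod (F z t) \<le> C * exp (M * w (norm z)))"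
proof -
  obtain C M where CM: "C \<ge> 0" "M \<ge> 0" "\<And>z t. cmod (F z t) \<le> C * exp (M * w (norm z)) * exp (- w (norm t))"
    using assms unfolding kernel_def by blast
  have "cmod (F z t) \<le> C * exp (M * w (norm z))" for z t
    using CM w_nonneg[of "norm t"] by (intro order_trans[OF CM(3)] mult_left_le) auto
  with CM show ?thesis by blast
qed

lemma kernel_bcontfun:
  assumes F: "kernel F"
  shows "F z \<in> bcontfun"
proof -
  obtain C M where "\<And>z t. cmod (F z t) \<le> C * exp (M * w (norm z))"
    using kernel_bound[OF F] by blast
  moreover have "continuous_on UNIV ((\<lambda>(z, t). F z t) \<circ> Pair z)"
    using F unfolding kernel_def
    by (intro continuous_on_compose continuous_on_Pair continuous_on_const continuous_on_id)
      (auto intro: continuous_on_subset)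
  then have "continuous_on UNIV (F z)"
    by (simp add: o_def)
  ultimately show ?thesis
    by (intro bcontfun_normI) auto
qed

lemma kernel_apply: "kernel F \<Longrightarrow> apply_bcontfun (Bcontfun (F z)) t = F z t"
  by (simp add: Bcontfun_inverse kernel_bcontfun)

text \<open>For \<open>norm t\<close> at most \<open>R\<close> uniform continuity on a compact set
  gives closeness; for larger \<open>t\<close> both values are small by the decay in
  \<open>t\<close>, locally uniformly in \<open>z\<close>.\<close>

lemma kernel_continuous:
  fixes F :: "'z::euclidean_space \<Rightarrow> 't::euclidean_space \<Rightarrow> complex"
  assumes F: "kernel F"
  shows "continuous_on UNIV (\<lambda>z. Bcontfun (F z))"
  unfolding continuous_on_iff
proof (intro ballI allI impI)
  fix z :: 'z and e :: real assume e: "e > 0"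
  obtain C M where CM: "C \<ge> 0" "M \<ge> 0" "\<And>z t. cmod (F z t) \<le> C * exp (M * w (norm z)) * exp (- w (norm t))"
    using F unfolding kernel_def by blast
  define B where "B = C * exp (M * w (norm z + 1))"
  have B: "B \<ge> 0" unfolding B_def using CM by simp
  have bound: "cmod (F y t) \<le> B * exp (- w (norm t))" if "dist y z \<le> 1" for y t
  proof -
    have "norm y \<le> norm z + 1"
      using that norm_triangle_ineq2[of y z] by (simp add: dist_norm)
    then have "C * exp (M * w (norm y)) \<le> B"
      unfolding B_def using CM by (auto intro!: mult_left_mono w_mono)
    then show ?thesis
      by (intro order_trans[OF CM(3)] mult_right_mono) auto
  qed
  \<comment> \<open>Two tails of size \<open>B\<close> times this quantity add up to at most
    \<open>e / 2\<close>; the summand 1 guards against \<open>B = 0\<close>.\<close>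
  have "e / (4 * (B + 1)) > 0" using e B by simp
  then obtain R where R: "\<And>t. t \<ge> 0 \<Longrightarrow> t > R \<Longrightarrow> exp (- w t) < e / (4 * (B + 1))"
    using exp_w_small by metis
  have "uniformly_continuous_on (cball z 1 \<times> cball 0 R) (\<lambda>(z, t). F z t)"
    using F unfolding kernel_def
    by (intro compact_uniformly_continuous compact_Times compact_cball) (auto intro: continuous_on_subset)
  then obtain d where d: "d > 0" "\<And>p q. p \<in> cball z 1 \<times> cball 0 R \<Longrightarrow> q \<in> cball z 1 \<times> cball 0 R \<Longrightarrow>
      dist q p < d \<Longrightarrow> dist (case q of (z, t) \<Rightarrow> F z t) (case p of (z, t) \<Rightarrow> F z t) < e / 2"
    unfolding uniformly_continuous_on_def using half_gt_zero[OF e] by blast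
  show "\<exists>d>0. \<forall>y\<in>UNIV. dist y z < d \<longrightarrow> dist (Bcontfun (F y)) (Bcontfun (F z)) < e"
  proof (intro exI[of _ "min d 1"] conjI ballI impI)
    fix y assume y: "dist y z < min d 1"
    have "dist (F y t) (F z t) \<le> e / 2" for t
    proof (cases "norm t \<le> R")
      case True
      have "dist (case (y, t) of (z, t) \<Rightarrow> F z t) (case (z, t) of (z, t) \<Rightarrow> F z t) < e / 2"
        using True y by (intro d) (auto simp: dist_Pair_Pair dist_commute)
      then show ?thesis by simp
    next
      case False
      have "dist (F y t) (F z t) \<le> cmod (F y t) + cmod (F z t)"
        by (simp add: dist_norm norm_triangle_ineq4)
      also have "\<dots> \<le> B * exp (- w (norm t)) + B * exp (- w (norm t))"
        using y by (intro add_mono bound) auto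
      also have "\<dots> \<le> 2 * (B * (e / (4 * (B + 1))))"
        using mult_left_mono[OF less_imp_le[OF R[of "norm t"]] B] False by simp
      also have "\<dots> = B / (B + 1) * (e / 2)"
        using B by (simp add: field_simps)
      also have "\<dots> \<le> e / 2"
        using B e by (intro mult_left_le_one_le) auto
      finally show ?thesis .
    qed
    then have "dist (Bcontfun (F y)) (Bcontfun (F z)) \<le> e / 2"
      by (intro dist_bound) (simp add: kernel_apply[OF F])
    then show "dist (Bcontfun (F y)) (Bcontfun (F z)) < e" using e by simp
  qed (use d in auto)
qed

section \<open>Integrals of kernels against rapidly decaying functions\<close>

definition rapid :: "('z::euclidean_space \<Rightarrow> complex) \<Rightarrow> bool" where
  "rapid V \<longleftrightarrow> V \<in> borel_measurable borel \<and> (\<forall>lam. \<exists>C. \<forall>z. cmod (V z) * exp (lam * w (norm z)) \<le> C)"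

lemma rapid_measurable: "rapid V \<Longrightarrow> V \<in> borel_measurable borel"
  unfolding rapid_def by simp

lemma rapid_integrable:
  fixes V :: "'z::euclidean_space \<Rightarrow> complex"
  assumes "rapid V"
  shows "integrable lborel (\<lambda>z. cmod (V z) * exp (M * w (norm z)))"
proof -
  have [measurable]: "V \<in> borel_measurable borel" using assms unfolding rapid_def by simp
  obtain L where L: "integrable lborel (\<lambda>z::'z. exp (- L * w (norm z)))"
    using integrable_exp_w[where 'a='z] by (metis order_refl)
  obtain C where C: "\<And>z. cmod (V z) * exp ((M + L) * w (norm z)) \<le> C"
    using assms unfolding rapid_def by blast
  show ?thesis
  proof (rule Bochner_Integration.integrable_bound)
    show "integrable lborel (\<lambda>z::'z. C * exp (- L * w (norm z)))"
      by (intro integrable_mult_right L)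
    show "AE z in lborel. norm (cmod (V z) * exp (M * w (norm z))) \<le> norm (C * exp (- L * w (norm z)))"
    proof (rule AE_I2)
      fix z
      have "cmod (V z) * exp (M * w (norm z)) = (cmod (V z) * exp ((M + L) * w (norm z))) * exp (- L * w (norm z))"
        by (simp add: exp_minus distrib_right exp_add)
      also have "\<dots> \<le> C * exp (- L * w (norm z))"
        by (intro mult_right_mono C) auto
      finally show "norm (cmod (V z) * exp (M * w (norm z))) \<le> norm (C * exp (- L * w (norm z)))" by simp
    qed
  qed measurable
qed

lemma rapid_bounded_mult:
  assumes "rapid V" and "H \<in> borel_measurable borel" and H: "\<And>z. cmod (H z) \<le> C * exp (M * w (norm z))"
  shows "integrable lborel (\<lambda>z. V z * H z)"
proof (rule Bochner_Integration.integrable_bound)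
  show "integrable lborel (\<lambda>z. C * (cmod (V z) * exp (M * w (norm z))))"
    by (intro integrable_mult_right rapid_integrable assms)
  have "V \<in> borel_measurable borel" using assms unfolding rapid_def by simp
  with assms(2) show "(\<lambda>z. V z * H z) \<in> borel_measurable lborel" by simp
  show "AE z in lborel. norm (V z * H z) \<le> norm (C * (cmod (V z) * exp (M * w (norm z))))"
  proof (rule AE_I2)
    fix z
    have "norm (V z * H z) \<le> cmod (V z) * (C * exp (M * w (norm z)))"
      by (simp add: norm_mult H mult_left_mono)
    then show "norm (V z * H z) \<le> norm (C * (cmod (V z) * exp (M * w (norm z))))"
      by (simp add: mult.left_commute)
  qed
qed

lemma kernel_measurable:
  assumes F: "kernel F"
  shows "(\<lambda>z. F z t) \<in> borel_measurable borel"
proof -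
  have "continuous_on UNIV ((\<lambda>(z, t). F z t) \<circ> (\<lambda>z. (z, t)))"
    using F unfolding kernel_def
    by (intro continuous_on_compose continuous_on_Pair continuous_on_const continuous_on_id)
      (auto intro: continuous_on_subset)
  then show ?thesis
    by (intro borel_measurable_continuous_onI) (simp add: o_def)
qed

text \<open>The point is that \<open>E k\<close> does not depend on \<open>t\<close>. The error is
  at most the integral of \<open>cmod (V z)\<close> times the supremum distance between
  \<open>F z\<close> and \<open>F (s k z)\<close>; that distance tends to 0 for each
  \<open>z\<close>, and \<open>le\<close> only doubles the growth exponent, so dominated convergence
  applies.\<close>

lemma kernel_approx:
  fixes F :: "'z::euclidean_space \<Rightarrow> 't::euclidean_space \<Rightarrow> complex"
  assumes F: "kernel F" and V: "rapid V"
    and s[measurable]: "\<And>k. s k \<in> borel_measurable borel" and lim: "\<And>z. (\<lambda>k. s k z) \<longlonglongrightarrow> z"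
    and le: "\<And>k z. norm (s k z) \<le> 2 * norm z"
  obtains E where "E \<longlonglongrightarrow> 0"
    "\<And>k t. cmod ((LINT z|lborel. V z * F z t) - (LINT z|lborel. V z * F (s k z) t)) \<le> E k"
proof -
  \<comment> \<open>Measuring the supremum as a distance in the space of bounded continuous
    functions makes it continuous in both arguments, hence measurable.\<close>
  define D where "D z y = dist (Bcontfun (F z)) (Bcontfun (F y))" for z y
  define E where "E k = (LINT z|lborel. cmod (V z) * D z (s k z))" for k
  obtain C M where CM: "C \<ge> 0" "M \<ge> 0" "\<And>z t. cmod (F z t) \<le> C * exp (M * w (norm z))"
    using kernel_bound[OF F] by blast
  have [measurable]: "V \<in> borel_measurable borel" using V unfolding rapid_def by simp
  have Dcont: "continuous_on UNIV (\<lambda>p. D (fst p) (snd p))"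
    unfolding D_def
    by (intro continuous_intros continuous_on_compose2[OF kernel_continuous[OF F]]) auto
  have [measurable]: "(\<lambda>p. D (fst p) (snd p)) \<in> borel_measurable borel"
    by (rule borel_measurable_continuous_onI[OF Dcont])
  have "(\<lambda>z. (z, s k z)) \<in> borel_measurable borel" for k
    by measurable
  from measurable_compose[OF this, of "\<lambda>p. D (fst p) (snd p)"]
  have Dm [measurable]: "(\<lambda>z. D z (s k z)) \<in> borel_measurable borel" for k
    by simp
  have sC: "C * exp (M * w (norm (s k z))) \<le> C * exp (2 * M * w (norm z))" for k z
    using CM w_double[OF le[of k z]] mult_left_mono[of "w (norm (s k z))" "2 * w (norm z)" M]
    by (intro mult_left_mono) auto
  have zC: "C * exp (M * w (norm z)) \<le> C * exp (2 * M * w (norm z))" for z :: 'z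
    using CM w_nonneg[of "norm z"] by (intro mult_left_mono) (auto intro!: mult_right_mono)
  have Dle: "D z (s k z) \<le> 2 * C * exp (2 * M * w (norm z))" for k z
    unfolding D_def
  proof (rule dist_bound)
    fix t
    have "dist (F z t) (F (s k z) t) \<le> cmod (F z t) + cmod (F (s k z) t)"
      by (simp add: dist_norm norm_triangle_ineq4)
    also have "\<dots> \<le> C * exp (2 * M * w (norm z)) + C * exp (2 * M * w (norm z))"
      by (intro add_mono order_trans[OF CM(3) sC] order_trans[OF CM(3) zC])
    finally show "dist (apply_bcontfun (Bcontfun (F z)) t) (apply_bcontfun (Bcontfun (F (s k z))) t) \<le> 2 * C * exp (2 * M * w (norm z))"
      by (simp add: kernel_apply[OF F])
  qed
  have intB: "integrable lborel (\<lambda>z. 2 * C * (cmod (V z) * exp (2 * M * w (norm z))))"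
    by (intro integrable_mult_right rapid_integrable V)
  have VD: "norm (cmod (V z) * D z (s k z)) \<le> 2 * C * (cmod (V z) * exp (2 * M * w (norm z)))" for k z
    using mult_left_mono[OF Dle, of "cmod (V z)" z k] by (simp add: D_def mult_ac)
  have intVD: "integrable lborel (\<lambda>z. cmod (V z) * D z (s k z))" for k
    by (rule Bochner_Integration.integrable_bound[OF intB]) 
      (auto intro!: order_trans[OF VD[unfolded real_norm_def] abs_ge_self])
  have "E \<longlonglongrightarrow> (LINT z|(lborel :: 'z measure). 0 :: real)"
    unfolding E_def
  proof (rule integral_dominated_convergence[where w="\<lambda>z. 2 * C * (cmod (V z) * exp (2 * M * w (norm z)))"])
    show "AE z in lborel. (\<lambda>k. cmod (V z) * D z (s k z)) \<longlonglongrightarrow> 0"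
    proof (rule AE_I2)
      fix z
      have "(\<lambda>k. Bcontfun (F (s k z))) \<longlonglongrightarrow> Bcontfun (F z)"
        using kernel_continuous[OF F] lim[of z]
        by (intro isCont_tendsto_compose[of z "\<lambda>z. Bcontfun (F z)"]) (auto simp: continuous_on_eq_continuous_at)
      then have "(\<lambda>k. cmod (V z) * dist (Bcontfun (F z)) (Bcontfun (F (s k z)))) \<longlonglongrightarrow> cmod (V z) * dist (Bcontfun (F z)) (Bcontfun (F z))"
        by (intro tendsto_intros)
      then show "(\<lambda>k. cmod (V z) * D z (s k z)) \<longlonglongrightarrow> 0"
        unfolding D_def by simp
    qed
  qed (use VD intB in auto)
  then have "E \<longlonglongrightarrow> 0" by simp
  moreover have "cmod ((LINT z|lborel. V z * F z t) - (LINT z|lborel. V z * F (s k z) t)) \<le> E k" for k t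
  proof -
    have i1: "integrable lborel (\<lambda>z. V z * F z t)"
      by (rule rapid_bounded_mult[OF V kernel_measurable[OF F] CM(3)])
    have i2: "integrable lborel (\<lambda>z. V z * F (s k z) t)"
      by (rule rapid_bounded_mult[OF V measurable_compose[OF s kernel_measurable[OF F]] order_trans[OF CM(3) sC]])
    have "cmod ((LINT z|lborel. V z * F z t) - (LINT z|lborel. V z * F (s k z) t)) = cmod (LINT z|lborel. V z * F z t - V z * F (s k z) t)"
      by (simp only: Bochner_Integration.integral_diff[OF i1 i2])
    also have "\<dots> \<le> (LINT z|lborel. cmod (V z) * D z (s k z))"
    proof (rule Bochner_Integration.integral_norm_bound_integral)
      fix z
      have "cmod (F z t - F (s k z) t) \<le> D z (s k z)"
        using dist_bounded[of "Bcontfun (F z)" t "Bcontfun (F (s k z))"]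
        by (simp add: D_def kernel_apply[OF F] dist_norm)
      then show "cmod (V z * F z t - V z * F (s k z) t) \<le> cmod (V z) * D z (s k z)"
        by (simp add: norm_mult mult_left_mono flip: right_diff_distrib)
    qed (use i1 i2 intVD in auto)
    finally show ?thesis unfolding E_def .
  qed
  ultimately show thesis by (rule that)
qed

text \<open>The coefficients do not depend on \<open>G\<close>. The same finite combination
  therefore serves every derivative, the Fourier side and the values of \<open>u\<close>.\<close>

lemma integral_simple_comp:
  fixes s :: "'z::euclidean_space \<Rightarrow> 'z" and V :: "'z \<Rightarrow> complex"
  assumes s: "simple_function lborel s" and V: "integrable lborel V"
  shows "(LINT z|lborel. V z * G (s z)) = (\<Sum>v\<in>range s. (LINT z|lborel. V z * indicator (s -` {v}) z) * G v)"
proof -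
  have fin: "finite (range s)" and sets: "\<And>v. s -` {v} \<in> sets borel"
    using simple_functionD[OF s] by auto
  have "(LINT z|lborel. V z * G (s z)) = (LINT z|lborel. (\<Sum>v\<in>range s. V z * indicator (s -` {v}) z * G v))"
  proof (intro Bochner_Integration.integral_cong refl)
    fix z
    have "(\<Sum>v\<in>range s. V z * indicator (s -` {v}) z * G v) = (\<Sum>v\<in>range s. if v = s z then V z * G v else 0)"
      by (intro sum.cong) (auto simp: indicator_def)
    then show "V z * G (s z) = (\<Sum>v\<in>range s. V z * indicator (s -` {v}) z * G v)"
      using fin by simp
  qed
  also have "\<dots> = (\<Sum>v\<in>range s. (LINT z|lborel. V z * indicator (s -` {v}) z * G v))"
    using integrable_mult_indicator[OF _ V] sets
    by (intro Bochner_Integration.integral_sum integrable_mult_left)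
       (simp add: scaleR_conv_of_real mult.commute[of "V _"] of_real_indicator)
  finally show ?thesis by simp
qed

end

section \<open>Differentiation under the integral sign\<close>

text \<open>\<open>smooth_fun\<close> provides derivatives along a line at parameter 0 only; moving
  the base point gives them at every parameter, as the mean value estimate requires.\<close>

lemma has_vector_derivative_line_shift:
  fixes x e :: "'a::real_vector" and f :: "'a \<Rightarrow> 'b::real_normed_vector"
  assumes "((\<lambda>t. f ((x + r *\<^sub>R e) + t *\<^sub>R e)) has_vector_derivative D) (at 0)"
  shows "((\<lambda>t. f (x + t *\<^sub>R e)) has_vector_derivative D) (at r)"
proof -
  have 1: "((\<lambda>t. t - r) has_vector_derivative 1) (at r)"
    by (auto intro!: derivative_eq_intros)
  have "((\<lambda>t. f ((x + r *\<^sub>R e) + t *\<^sub>R e)) \<circ> (\<lambda>t. t - r) has_vector_derivative 1 *\<^sub>R D) (at r)"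
    by (rule vector_diff_chain_at[OF 1]) (use assms in simp)
  then show ?thesis
    by (simp add: o_def algebra_simps)
qed

lemma has_vector_derivative_quotient_iff:
  "(f has_vector_derivative D) (at 0) \<longleftrightarrow> ((\<lambda>h. (f h - f 0) /\<^sub>R h) \<longlongrightarrow> D) (at 0)"
proof -
  have "norm (f (0 + h) - f 0 - h *\<^sub>R D) / norm h = norm ((f h - f 0) /\<^sub>R h - D)" if "h \<noteq> 0" for h
  proof -
    have "(f h - f 0) /\<^sub>R h - D = (f h - f 0 - h *\<^sub>R D) /\<^sub>R h"
      using that by (simp add: algebra_simps)
    then show ?thesis
      by (simp add: divide_inverse mult.commute)
  qed
  then have "((\<lambda>h. norm (f (0 + h) - f 0 - h *\<^sub>R D) / norm h) \<midarrow>0\<rightarrow> 0) \<longleftrightarrow> ((\<lambda>h. norm ((f h - f 0) /\<^sub>R h - D)) \<midarrow>0\<rightarrow> 0)"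
    by (intro LIM_equal) simp
  also have "\<dots> \<longleftrightarrow> ((\<lambda>h. (f h - f 0) /\<^sub>R h) \<longlongrightarrow> D) (at 0)"
    by (simp only: tendsto_norm_zero_iff LIM_zero_iff)
  finally show ?thesis
    unfolding has_vector_derivative_def has_derivative_at by (simp add: bounded_linear_scaleR_left)
qed

text \<open>The mean value inequality bounds all difference quotients by \<open>B\<close>, so
  dominated convergence applies along every sequence tending to 0.\<close>

lemma has_vector_derivative_integral:
  fixes f :: "'z::euclidean_space \<Rightarrow> real \<Rightarrow> complex"
  assumes der: "\<And>z r. (f z has_vector_derivative f' z r) (at r)"
    and bound: "\<And>z r. norm (f' z r) \<le> B z" and B: "integrable lborel B"
    and int: "\<And>r. integrable lborel (\<lambda>z. f z r)" and meas: "(\<lambda>z. f' z 0) \<in> borel_measurable borel"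
  shows "((\<lambda>r. LINT z|lborel. f z r) has_vector_derivative (LINT z|lborel. f' z 0)) (at 0)"
proof -
  have lip: "norm (f z r - f z 0) \<le> B z * \<bar>r\<bar>" for z r
  proof -
    have "norm (f z r - f z 0) \<le> B z * norm (r - 0)"
    proof (rule differentiable_bound[of UNIV "f z" "\<lambda>r h. h *\<^sub>R f' z r"])
      show "onorm (\<lambda>h. h *\<^sub>R f' z r) \<le> B z" for r
        using bound[of z r] by (intro onorm_le order_trans[OF onorm_bound]) (auto simp: mult.commute mult_left_mono)
    qed (use der in \<open>auto simp: has_vector_derivative_def\<close>)
    then show ?thesis by simp
  qed
  have "((\<lambda>r. ((LINT z|lborel. f z r) - (LINT z|lborel. f z 0)) /\<^sub>R r) \<longlongrightarrow> (LINT z|lborel. f' z 0)) (at 0)"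
    unfolding tendsto_at_iff_sequentially
  proof (intro allI impI)
    fix X :: "nat \<Rightarrow> real" assume X: "\<forall>i. X i \<in> UNIV - {0}" "X \<longlonglongrightarrow> 0"
    have "(\<lambda>k. LINT z|lborel. (f z (X k) - f z 0) /\<^sub>R X k) \<longlonglongrightarrow> (LINT z|lborel. f' z 0)"
    proof (rule integral_dominated_convergence[OF _ _ B])
      show "AE z in lborel. (\<lambda>k. (f z (X k) - f z 0) /\<^sub>R X k) \<longlonglongrightarrow> f' z 0"
      proof (rule AE_I2)
        fix z
        have "((\<lambda>r. (f z r - f z 0) /\<^sub>R r) \<longlongrightarrow> f' z 0) (at 0)"
          using der[of z 0] unfolding has_vector_derivative_quotient_iff .
        then show "(\<lambda>k. (f z (X k) - f z 0) /\<^sub>R X k) \<longlonglongrightarrow> f' z 0"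
          using X unfolding tendsto_at_iff_sequentially by (auto simp: o_def)
      qed
      show "AE z in lborel. norm ((f z (X k) - f z 0) /\<^sub>R X k) \<le> B z" for k
      proof (rule AE_I2)
        fix z
        have "\<bar>X k\<bar> > 0" using X(1) by auto
        then show "norm ((f z (X k) - f z 0) /\<^sub>R X k) \<le> B z"
          using lip[of z "X k"] by (simp add: divide_simps mult.commute flip: divide_inverse_commute del: scaleR_diff_right)
      qed
      show "(\<lambda>z. (f z (X k) - f z 0) /\<^sub>R X k) \<in> borel_measurable lborel" for k
        using int[of "X k"] int[of 0] by auto
    qed (use meas in auto)
    then show "((\<lambda>r. ((LINT z|lborel. f z r) - (LINT z|lborel. f z 0)) /\<^sub>R r) \<circ> X) \<longlonglongrightarrow> (LINT z|lborel. f' z 0)"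
      using int by (simp add: o_def)
  qed
  then show ?thesis
    unfolding has_vector_derivative_quotient_iff .
qed

context weight
begin

text \<open>Each differentiated integrand is dominated, uniformly in \<open>t\<close>, by the
  modulus of the rapid \<open>V\<close> times the moderate growth of a kernel.\<close>

lemma dpart_integral_tf_shift:
  fixes g :: "real^'n::finite \<Rightarrow> complex" and V :: "(real^'n) \<times> (real^'n) \<Rightarrow> complex"
  assumes V: "rapid V" and g: "g \<in> decaying"
    and A: "continuous_on UNIV A" "\<And>z. norm (A z) = norm z"
  shows "dpart is (\<lambda>t. LINT z|lborel. V z * tf_shift (A z) g t) = (\<lambda>t. LINT z|lborel. V z * dpart is (tf_shift (A z) g) t)"
proof (induction "is")
  case (Cons i "is")
  have K: "kernel (\<lambda>z. dpart js (tf_shift (A z) g))" for js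
    using kernel_tf_shift[OF g A, of "\<lambda>_. 1" js 0] by simp
  have [measurable]: "V \<in> borel_measurable borel" using V unfolding rapid_def by simp
  have "((\<lambda>r. LINT z|lborel. V z * dpart is (tf_shift (A z) g) (x + r *\<^sub>R axis i 1)) has_vector_derivative
      (LINT z|lborel. V z * dpart (i # is) (tf_shift (A z) g) (x + 0 *\<^sub>R axis i 1))) (at 0)" for x
  proof -
    obtain C M where CM: "\<And>z t. cmod (dpart (i # is) (tf_shift (A z) g) t) \<le> C * exp (M * w (norm z))"
      using kernel_bound[OF K] by blast
    obtain D L where DL: "\<And>z t. cmod (dpart is (tf_shift (A z) g) t) \<le> D * exp (L * w (norm z))"
      using kernel_bound[OF K] by blast
    show ?thesis
    proof (rule has_vector_derivative_integral[where
          f="\<lambda>z r. V z * dpart is (tf_shift (A z) g) (x + r *\<^sub>R axis i 1)" and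
          f'="\<lambda>z r. V z * dpart (i # is) (tf_shift (A z) g) (x + r *\<^sub>R axis i 1)" and B="\<lambda>z. C * (cmod (V z) * exp (M * w (norm z)))"])
      fix z r
      show "((\<lambda>r. V z * dpart is (tf_shift (A z) g) (x + r *\<^sub>R axis i 1)) has_vector_derivative
         V z * dpart (i # is) (tf_shift (A z) g) (x + r *\<^sub>R axis i 1)) (at r)"
        by (rule has_vector_derivative_mult_right[OF has_vector_derivative_line_shift[OF
            smooth_funD(1)[OF smooth_fun_tf_shift[OF decaying_smooth[OF g]]]]])
      show "cmod (V z * dpart (i # is) (tf_shift (A z) g) (x + r *\<^sub>R axis i 1)) \<le> C * (cmod (V z) * exp (M * w (norm z)))"
        using mult_left_mono[OF CM, of "cmod (V z)" z] by (simp add: norm_mult mult_ac del: dpart.simps)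
    next
      show "integrable lborel (\<lambda>z. V z * dpart is (tf_shift (A z) g) (x + r *\<^sub>R axis i 1))" for r
        by (rule rapid_bounded_mult[OF V kernel_measurable[OF K] DL])
      show "(\<lambda>z. V z * dpart (i # is) (tf_shift (A z) g) (x + 0 *\<^sub>R axis i 1)) \<in> borel_measurable borel"
        using kernel_measurable[OF K, of "i # is"] by (intro borel_measurable_times) auto
    qed (intro integrable_mult_right rapid_integrable V)
  qed
  from vector_derivative_at[OF this] show ?case
    by (simp add: Cons)
qed simp

text \<open>Translation becomes modulation and conversely; the phase
  \<open>cis (fst z \<bullet> snd z)\<close> arises because the two operations do not
  commute.\<close>

lemma fourier_tf_shift:
  fixes g :: "real^'n::finite \<Rightarrow> complex"
  assumes [measurable]: "g \<in> borel_measurable borel"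
  shows "fourier (tf_shift z g) = (\<lambda>\<eta>. cis (fst z \<bullet> snd z) * tf_shift (snd z, - fst z) (fourier g) \<eta>)"
proof
  fix \<eta>
  have [measurable]: "(\<lambda>t. cis (- (t \<bullet> y))) \<in> borel_measurable borel" for y :: "real^'n"
    by (intro borel_measurable_continuous_onI continuous_intros)
  have "fourier (tf_shift z g) \<eta> = (LINT t|lborel. (\<lambda>t. cis (- (fst z \<bullet> (\<eta> - snd z))) * (g t * cis (- (t \<bullet> (\<eta> - snd z))))) (t - fst z))"
    unfolding fourier_def tf_shift_def
    by (intro Bochner_Integration.integral_cong refl)
      (simp add: algebra_simps cis_mult inner_diff_left inner_diff_right)
  also have "\<dots> = (LINT t|lborel. cis (- (fst z \<bullet> (\<eta> - snd z))) * (g t * cis (- (t \<bullet> (\<eta> - snd z)))))"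
    by (rule lborel_integral_shift) measurable
  also have "\<dots> = cis (- (fst z \<bullet> (\<eta> - snd z))) * fourier g (\<eta> - snd z)"
    by (simp add: fourier_def)
  also have "cis (- (fst z \<bullet> (\<eta> - snd z))) = cis (fst z \<bullet> snd z) * cis (\<eta> \<bullet> (- fst z))"
    by (simp add: cis_mult inner_diff_right inner_commute)
  finally show "fourier (tf_shift z g) \<eta> = cis (fst z \<bullet> snd z) * tf_shift (snd z, - fst z) (fourier g) \<eta>"
    by (simp add: tf_shift_def[of "(snd z, - fst z)"])
qed

lemma fourier_lincomb:
  fixes f g :: "real^'n::finite \<Rightarrow> complex"
  assumes f: "integrable lborel f" and g: "integrable lborel g"
  shows "fourier (\<lambda>t. c * f t + d * g t) = (\<lambda>\<eta>. c * fourier f \<eta> + d * fourier g \<eta>)"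
proof
  fix \<eta>
  have [measurable]: "(\<lambda>t. cis (- (t \<bullet> y))) \<in> borel_measurable borel" for y :: "real^'n"
    by (intro borel_measurable_continuous_onI continuous_intros)
  have *: "integrable lborel (\<lambda>t. h t * cis (- (t \<bullet> \<eta>)))" if "integrable lborel h" for h :: "real^'n \<Rightarrow> complex"
    using that by (rule Bochner_Integration.integrable_bound) (use that in \<open>auto simp: norm_mult\<close>)
  have "fourier (\<lambda>t. c * f t + d * g t) \<eta> = (LINT t|lborel. c * (f t * cis (- (t \<bullet> \<eta>))) + d * (g t * cis (- (t \<bullet> \<eta>))))"
    unfolding fourier_def by (simp add: algebra_simps)
  also have "\<dots> = c * fourier f \<eta> + d * fourier g \<eta>"
    unfolding fourier_def using *[OF f] *[OF g]
    by (subst Bochner_Integration.integral_add) auto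
  finally show "fourier (\<lambda>t. c * f t + d * g t) \<eta> = c * fourier f \<eta> + d * fourier g \<eta>" .
qed

lemma S_omega_decaying: "f \<in> S_omega w \<Longrightarrow> f \<in> decaying" "f \<in> S_omega w \<Longrightarrow> fourier f \<in> decaying"
  by (auto simp: S_omega_iff)

lemma S_omega_tf_shift:
  assumes "f \<in> S_omega w"
  shows "tf_shift z f \<in> S_omega w"
proof -
  have m: "f \<in> borel_measurable borel"
    using assms by (intro borel_measurable_continuous_onI decaying_continuous S_omega_decaying)
  have "(\<lambda>\<eta>. cis (fst z \<bullet> snd z) * tf_shift (snd z, - fst z) (fourier f) \<eta> + 0 * fourier f \<eta>) \<in> decaying"
    using assms by (intro decaying_lincomb decaying_tf_shift S_omega_decaying)
  then show ?thesis
    using assms by (auto simp: S_omega_iff fourier_tf_shift[OF m] intro: decaying_tf_shift)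
qed

lemma S_omega_lincomb:
  assumes f: "f \<in> S_omega w" and g: "g \<in> S_omega w"
  shows "(\<lambda>t. c * f t + d * g t) \<in> S_omega w"
  using decaying_lincomb[OF S_omega_decaying(1)[OF f] S_omega_decaying(1)[OF g], of c d] decaying_lincomb[OF S_omega_decaying(2)[OF f] S_omega_decaying(2)[OF g], of c d]
  by (simp add: S_omega_iff fourier_lincomb[OF decaying_integrable[OF S_omega_decaying(1)[OF f]] decaying_integrable[OF S_omega_decaying(1)[OF g]]])

section \<open>The short-time Fourier transform\<close>

lemma decaying_rapid: "g \<in> decaying \<Longrightarrow> rapid g"
  unfolding rapid_def using decaying_bound[of g "[]"]
  by (auto intro!: borel_measurable_continuous_onI decaying_continuous) metis

lemma stft_fun_distr: "stft \<psi> (fun_distr f) z = (LINT t|lborel. f t * cnj (tf_shift z \<psi> t))"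
  by (simp add: stft_def fun_distr_def)

lemma stft_measurable:
  assumes f: "f \<in> decaying" and g: "g \<in> decaying"
  shows "stft g (fun_distr f) \<in> borel_measurable borel"
proof -
  have "continuous_on UNIV (\<lambda>(z, t). f t * cnj (tf_shift z g t))"
    unfolding split_beta tf_shift_def
    by (intro continuous_intros continuous_on_compose2[OF decaying_continuous[OF f]] continuous_on_compose2[OF decaying_continuous[OF g]]) auto
  then have "(\<lambda>(z, t). f t * cnj (tf_shift z g t)) \<in> borel_measurable (borel \<Otimes>\<^sub>M lborel)"
    by (simp add: borel_measurable_continuous_onI borel_prod measurable_cong_sets[OF sets_pair_measure_cong[OF refl sets_lborel] refl])
  from lborel.borel_measurable_lebesgue_integral[OF this]
  show ?thesis
    by (simp add: stft_fun_distr[abs_def])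
qed

text \<open>In the integrand either \<open>t\<close> or \<open>t - fst z\<close> must be large when
  \<open>fst z\<close> is, by subadditivity, and one of the two functions is then small. This
  controls the time variable only; the frequency variable is reached by applying the same estimate
  to the Fourier transforms.\<close>

lemma stft_bound_fst:
  assumes f: "f \<in> decaying" and g: "g \<in> decaying" and lam: "lam \<ge> 0"
  shows "\<exists>C. \<forall>z. cmod (stft g (fun_distr f) z) * exp (lam * w (norm (fst z))) \<le> C"
proof -
  obtain C where C: "\<And>x. cmod (g x) * exp (lam * w (norm x)) \<le> C"
    using decaying_rapid[OF g] unfolding rapid_def by blast
  have "cmod (stft g (fun_distr f) z) * exp (lam * w (norm (fst z))) \<le> (LINT t|lborel. C * (cmod (f t) * exp (lam * w (norm t))))" for z
  proof -
    have i: "integrable lborel (\<lambda>t. f t * cnj (tf_shift z g t))"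
    proof -
      obtain K where K: "\<And>x. norm (g x) \<le> K" using decaying_bounded[OF g] by blast
      show ?thesis
      proof (rule rapid_bounded_mult[OF decaying_rapid[OF f], where M=0])
      show "cmod (cnj (tf_shift z g t)) \<le> K * exp (0 * w (norm t))" for t
        using K by (simp add: tf_shift_def norm_mult)
      show "(\<lambda>t. cnj (tf_shift z g t)) \<in> borel_measurable borel"
        by (intro borel_measurable_continuous_onI continuous_intros decaying_continuous decaying_tf_shift g)
      qed
    qed
    have "cmod (stft g (fun_distr f) z) * exp (lam * w (norm (fst z))) = cmod (LINT t|lborel. exp (lam * w (norm (fst z))) * (f t * cnj (tf_shift z g t)))"
      by (simp add: stft_fun_distr norm_mult)
    also have "\<dots> \<le> (LINT t|lborel. C * (cmod (f t) * exp (lam * w (norm t))))"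
    proof (rule Bochner_Integration.integral_norm_bound_integral)
      show "integrable lborel (\<lambda>t. complex_of_real (exp (lam * w (norm (fst z)))) * (f t * cnj (tf_shift z g t)))"
        by (intro integrable_mult_right i)
      show "integrable lborel (\<lambda>t. C * (cmod (f t) * exp (lam * w (norm t))))"
        by (intro integrable_mult_right rapid_integrable decaying_rapid f)
      fix t
      have "w (norm (fst z)) \<le> w (norm t) + w (norm (t - fst z))"
        using w_triangle_diff[of t "t - fst z"] by simp
      then have "lam * w (norm (fst z)) \<le> lam * w (norm t) + lam * w (norm (t - fst z))"
        using lam by (simp add: mult_left_mono flip: distrib_left)
      then have "exp (lam * w (norm (fst z))) \<le> exp (lam * w (norm t)) * exp (lam * w (norm (t - fst z)))"
        by (simp flip: exp_add)
      then have "exp (lam * w (norm (fst z))) * (cmod (f t) * cmod (g (t - fst z)))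
        \<le> (exp (lam * w (norm t)) * exp (lam * w (norm (t - fst z)))) * (cmod (f t) * cmod (g (t - fst z)))"
        by (intro mult_right_mono) auto
      also have "\<dots> = (cmod (f t) * exp (lam * w (norm t))) * (cmod (g (t - fst z)) * exp (lam * w (norm (t - fst z))))"
        by simp
      also have "\<dots> \<le> (cmod (f t) * exp (lam * w (norm t))) * C"
        by (intro mult_left_mono C) auto
      finally show "cmod (complex_of_real (exp (lam * w (norm (fst z)))) * (f t * cnj (tf_shift z g t))) \<le> C * (cmod (f t) * exp (lam * w (norm t)))"
        by (simp add: norm_mult tf_shift_def mult.commute)
    qed
    finally show ?thesis .
  qed
  then show ?thesis by blast
qed

text \<open>Parseval for \<open>f\<close> and \<open>tf_shift z g\<close>. It exchanges the roles of
  time and frequency up to a constant and a phase.\<close>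

lemma stft_fourier:
  fixes f g :: "real^'n::finite \<Rightarrow> complex"
  assumes f: "f \<in> S_omega w" and g: "g \<in> S_omega w"
  shows "cmod (stft (fourier g) (fun_distr (fourier f)) (snd z, - fst z)) = (2 * pi) ^ CARD('n) * cmod (stft g (fun_distr f) z)"
proof -
  have gz: "tf_shift z g \<in> S_omega w" by (rule S_omega_tf_shift[OF g])
  obtain K where K: "\<And>x. norm (tf_shift z g x) \<le> K"
    using decaying_bounded[OF S_omega_decaying(1)[OF gz]] by blast
  have m: "g \<in> borel_measurable borel"
    using g by (intro borel_measurable_continuous_onI decaying_continuous S_omega_decaying)
  have "(2 * pi) ^ CARD('n) * stft g (fun_distr f) z = (LINT \<xi>|lborel. fourier f \<xi> * cnj (fourier (tf_shift z g) \<xi>))"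
    unfolding stft_fun_distr
    by (rule fourier_parseval[symmetric, OF _ K]) (intro decaying_continuous decaying_integrable S_omega_decaying gz f)+
  also have "\<dots> = cnj (cis (fst z \<bullet> snd z)) * stft (fourier g) (fun_distr (fourier f)) (snd z, - fst z)"
    unfolding stft_fun_distr fourier_tf_shift[OF m] complex_cnj_mult integral_mult_right_zero[symmetric]
    by (simp only: mult.left_commute)
  finally have "cmod ((2 * pi) ^ CARD('n) * stft g (fun_distr f) z)
     = cmod (cnj (cis (fst z \<bullet> snd z)) * stft (fourier g) (fun_distr (fourier f)) (snd z, - fst z))"
    by (rule arg_cong)
  then show ?thesis
    by (simp add: norm_mult norm_power)
qed

text \<open>Decay in time comes from \<open>stft_bound_fst\<close> directly, decay in frequency from
  the same bound for the Fourier transforms. Multiplying the two bounds and taking a square root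
  gives joint decay, which is why both are used with the exponent \<open>2 * lam\<close>.\<close>

lemma stft_rapid:
  fixes f g :: "real^'n::finite \<Rightarrow> complex"
  assumes f: "f \<in> S_omega w" and g: "g \<in> S_omega w"
  shows "rapid (stft g (fun_distr f))"
  unfolding rapid_def
proof (intro conjI allI)
  show "stft g (fun_distr f) \<in> borel_measurable borel"
    by (intro stft_measurable S_omega_decaying f g)
  fix lam0 :: real
  define lam where "lam = max lam0 0"
  have lam: "lam \<ge> 0" "lam0 \<le> lam" unfolding lam_def by auto
  obtain C1 where C1: "\<And>z. cmod (stft g (fun_distr f) z) * exp (2 * lam * w (norm (fst z))) \<le> C1"
    using stft_bound_fst[of f g "2 * lam"] f g lam S_omega_decaying by (metis mult_nonneg_nonneg zero_le_numeral)
  obtain C2 where C2: "\<And>z. cmod (stft (fourier g) (fun_distr (fourier f)) z) * exp (2 * lam * w (norm (fst z))) \<le> C2"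
    using stft_bound_fst[of "fourier f" "fourier g" "2 * lam"] f g lam S_omega_decaying by (metis mult_nonneg_nonneg zero_le_numeral)
  have "cmod (stft g (fun_distr f) z) * exp (lam0 * w (norm z)) \<le> sqrt (C1 * C2)" for z
  proof -
    let ?v = "cmod (stft g (fun_distr f) z)"
    have pi1: "(1::real) \<le> (2 * pi) ^ CARD('n)"
      using pi_gt3 by (intro one_le_power) linarith
    have "?v * exp (2 * lam * w (norm (snd z))) \<le> ((2 * pi) ^ CARD('n) * ?v) * exp (2 * lam * w (norm (snd z)))"
      using pi1 by (intro mult_right_mono) (auto simp: mult_le_cancel_right1)
    also have "\<dots> \<le> C2"
      using C2[of "(snd z, - fst z)"] by (simp add: stft_fourier[OF f g])
    finally have 2: "?v * exp (2 * lam * w (norm (snd z))) \<le> C2" .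
    have "norm z \<le> norm (fst z) + norm (snd z)"
      using norm_Pair_le[of "fst z" "snd z"] by simp
    then have "w (norm z) \<le> w (norm (fst z)) + w (norm (snd z))"
      using w_mono[of "norm z" "norm (fst z) + norm (snd z)"] w_add[of "norm (fst z)" "norm (snd z)"] by simp
    then have "lam * w (norm z) \<le> lam * w (norm (fst z)) + lam * w (norm (snd z))"
      using lam by (simp add: mult_left_mono flip: distrib_left)
    moreover have "lam0 * w (norm z) \<le> lam * w (norm z)"
      using lam w_nonneg[of "norm z"] by (intro mult_right_mono) auto
    ultimately have le: "2 * (lam0 * w (norm z)) \<le> 2 * lam * w (norm (fst z)) + 2 * lam * w (norm (snd z))"
      by simp
    have "(?v * exp (lam0 * w (norm z)))\<^sup>2 = ?v * ?v * exp (2 * (lam0 * w (norm z)))"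
      by (simp add: power2_eq_square mult_ac flip: exp_add)
    also have "\<dots> \<le> ?v * ?v * exp (2 * lam * w (norm (fst z)) + 2 * lam * w (norm (snd z)))"
      using le by (intro mult_left_mono) auto
    also have "\<dots> = (?v * exp (2 * lam * w (norm (fst z)))) * (?v * exp (2 * lam * w (norm (snd z))))"
      by (simp add: exp_add)
    also have "\<dots> \<le> C1 * C2"
      by (intro mult_mono C1 2) (auto intro: order_trans[OF _ C1])
    finally show ?thesis
      by (rule real_le_rsqrt)
  qed
  then show "\<exists>C. \<forall>z. cmod (stft g (fun_distr f) z) * exp (lam0 * w (norm z)) \<le> C" by blast
qed

abbreviation (input) stft_const :: "(real^'n::finite \<Rightarrow> complex) \<Rightarrow> complex" where
  "stft_const \<psi> \<equiv> complex_of_real ((2 * pi) ^ CARD('n) * (LINT t|lborel. (cmod (\<psi> t))\<^sup>2))"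

lemma kernel_tf_id:
  "g \<in> decaying \<Longrightarrow> kernel (\<lambda>z t. dpart is (tf_shift z g) t * exp (real N * w (norm t)))"
  using kernel_tf_shift[of g "\<lambda>z. z" "\<lambda>_. 1" "is" N] by simp

text \<open>For fixed \<open>x\<close> the function of frequency
  \<open>stft \<psi> (fun_distr f) (x, \<xi>)\<close> is the Fourier transform of
  \<open>f s * cnj (\<psi> (s - x))\<close>. Inverting it at \<open>t\<close> and multiplying by
  \<open>\<psi> (t - x)\<close> leaves \<open>f t\<close> times
  \<open>(cmod (\<psi> (t - x)))\<^sup>2\<close>, whose integral over \<open>x\<close> is the
  squared norm of the window.\<close>

lemma stft_inversion:
  fixes f \<psi> :: "real^'n::finite \<Rightarrow> complex"
  assumes f: "f \<in> S_omega w" and p: "\<psi> \<in> S_omega w"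
  shows "(LINT z|lborel. stft \<psi> (fun_distr f) z * tf_shift z \<psi> t) = stft_const \<psi> * f t"
proof -
  let ?V = "stft \<psi> (fun_distr f)"
  note fW = S_omega_decaying(1)[OF f] and pW = S_omega_decaying(1)[OF p]
  have V: "rapid ?V" by (rule stft_rapid[OF f p])
  have K: "kernel (\<lambda>z. tf_shift z \<psi>)"
    using kernel_tf_id[OF pW, of "[]" 0] by simp
  obtain C M where CM: "\<And>z t. cmod (tf_shift z \<psi> t) \<le> C * exp (M * w (norm z))"
    using kernel_bound[OF K] by blast
  have "integrable lborel (\<lambda>z. ?V z * tf_shift z \<psi> t)"
    by (rule rapid_bounded_mult[OF V kernel_measurable[OF K] CM])
  then have "(LINT z|lborel. ?V z * tf_shift z \<psi> t) = (LINT x|lborel. LINT \<xi>|lborel. ?V (x, \<xi>) * tf_shift (x, \<xi>) \<psi> t)"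
    by (subst lborel_Fubini(2)) (simp_all add: case_prod_beta')
  also have "\<dots> = (LINT x|lborel. ((2 * pi) ^ CARD('n) * f t) * complex_of_real ((cmod (\<psi> (t - x)))\<^sup>2))"
  proof (intro Bochner_Integration.integral_cong refl)
    fix x
    define g where "g s = f s * cnj (\<psi> (s - x))" for s
    have Fg: "fourier g \<xi> = ?V (x, \<xi>)" for \<xi>
      unfolding fourier_def stft_fun_distr g_def tf_shift_def
      by (simp add: cis_cnj mult_ac)
    obtain Kp where Kp: "\<And>x. norm (\<psi> x) \<le> Kp" using decaying_bounded[OF pW] by blast
    obtain Kf where Kf: "\<And>x. norm (f x) \<le> Kf" using decaying_bounded[OF fW] by blast
    have "(LINT \<xi>|lborel. fourier g \<xi> * cis (t \<bullet> \<xi>)) = (2 * pi) ^ CARD('n) * g t"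
    proof (rule fourier_inversion)
      show "continuous_on UNIV g"
        unfolding g_def
        by (intro continuous_intros continuous_on_compose2[OF decaying_continuous[OF pW]] decaying_continuous fW) auto
      show "norm (g s) \<le> Kf * Kp" for s
        unfolding g_def norm_mult complex_mod_cnj
        by (intro mult_mono Kf Kp) (auto intro: order_trans[OF _ Kf])
      show "integrable lborel g"
        unfolding g_def
      proof (rule rapid_bounded_mult[OF decaying_rapid[OF fW], where M=0 and C=Kp])
        show "(\<lambda>s. cnj (\<psi> (s - x))) \<in> borel_measurable borel"
          by (intro borel_measurable_continuous_onI continuous_intros continuous_on_compose2[OF decaying_continuous[OF pW]]) auto
      qed (simp add: Kp)
      obtain L where L: "L > 0" "integrable lborel (\<lambda>z::real^'n. exp (- L * w (norm z)))"
        using integrable_exp_w[where 'a="real^'n"] by (metis order_refl)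
      obtain C where C: "\<And>z. cmod (?V z) * exp (L * w (norm z)) \<le> C"
        using V unfolding rapid_def by blast
      \<comment> \<open>Joint decay restricts to the slice at \<open>x\<close>, because
        \<open>norm \<xi>\<close> is at most \<open>norm (x, \<xi>)\<close>.\<close>
      show "integrable lborel (fourier g)"
      proof (rule Bochner_Integration.integrable_bound)
        show "integrable lborel (\<lambda>\<xi>::real^'n. C * exp (- L * w (norm \<xi>)))"
          by (intro integrable_mult_right L)
        show "fourier g \<in> borel_measurable lborel"
          unfolding Fg[abs_def]
          using V by (auto simp: rapid_def intro: measurable_compose[of "\<lambda>\<xi>. (x, \<xi>)" borel borel ?V])
        show "AE \<xi> in lborel. norm (fourier g \<xi>) \<le> norm (C * exp (- L * w (norm \<xi>)))"
        proof (rule AE_I2)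
          fix \<xi> :: "real^'n"
          have "w (norm \<xi>) \<le> w (norm (x, \<xi>))"
            by (intro w_mono norm_snd_le) auto
          then have "cmod (?V (x, \<xi>)) * exp (L * w (norm \<xi>)) \<le> cmod (?V (x, \<xi>)) * exp (L * w (norm (x, \<xi>)))"
            using L by (intro mult_left_mono) auto
          also have "\<dots> \<le> C" by (rule C)
          finally have "cmod (?V (x, \<xi>)) \<le> C * exp (- L * w (norm \<xi>))"
            by (simp add: exp_minus field_simps)
          then show "norm (fourier g \<xi>) \<le> norm (C * exp (- L * w (norm \<xi>)))"
            by (simp add: Fg)
        qed
      qed
    qed
    then have "(LINT \<xi>|lborel. ?V (x, \<xi>) * cis (t \<bullet> \<xi>)) * \<psi> (t - x) = (2 * pi) ^ CARD('n) * g t * \<psi> (t - x)"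
      by (simp add: Fg)
    moreover have "(LINT \<xi>|lborel. ?V (x, \<xi>) * tf_shift (x, \<xi>) \<psi> t) = (LINT \<xi>|lborel. ?V (x, \<xi>) * cis (t \<bullet> \<xi>)) * \<psi> (t - x)"
      unfolding integral_mult_left_zero[symmetric] by (simp add: tf_shift_def mult_ac)
    ultimately show "(LINT \<xi>|lborel. ?V (x, \<xi>) * tf_shift (x, \<xi>) \<psi> t) = ((2 * pi) ^ CARD('n) * f t) * complex_of_real ((cmod (\<psi> (t - x)))\<^sup>2)"
      unfolding complex_norm_square by (simp add: g_def mult_ac)
  qed
  also have "\<dots> = ((2 * pi) ^ CARD('n) * f t) * complex_of_real (LINT x|lborel. (cmod (\<psi> (t - x)))\<^sup>2)"
    by (simp only: integral_mult_right_zero integral_complex_of_real)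
  also have "(LINT x|lborel. (cmod (\<psi> (t - x)))\<^sup>2) = (LINT x|lborel. (cmod (\<psi> x))\<^sup>2)"
    by (rule lborel_integral_reflect)
       (intro borel_measurable_continuous_onI continuous_intros decaying_continuous pW)
  finally show ?thesis by (simp add: mult_ac)
qed

text \<open>The Fourier transform is taken under the integral of \<open>stft_inversion\<close>. The
  shifts decay in \<open>t\<close> up to moderate growth in \<open>z\<close>, which the rapid
  transform of \<open>f\<close> compensates.\<close>

lemma stft_inversion_fourier:
  fixes f \<psi> :: "real^'n::finite \<Rightarrow> complex"
  assumes f: "f \<in> S_omega w" and p: "\<psi> \<in> S_omega w"
  shows "(LINT z|lborel. stft \<psi> (fun_distr f) z * fourier (tf_shift z \<psi>) \<eta>) = stft_const \<psi> * fourier f \<eta>"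
proof -
  let ?V = "stft \<psi> (fun_distr f)"
  note pW = S_omega_decaying(1)[OF p]
  have V: "rapid ?V" by (rule stft_rapid[OF f p])
  have [measurable]: "?V \<in> borel_measurable borel" using V unfolding rapid_def by simp
  obtain L where L: "L > 0" "integrable lborel (\<lambda>z::real^'n. exp (- L * w (norm z)))"
    using integrable_exp_w[where 'a="real^'n"] by (metis order_refl)
  obtain C M where CM: "\<And>z t. cmod (tf_shift z \<psi> t) * exp (L * w (norm t)) \<le> C * exp (M * w (norm z))"
    using dpart_tf_shift_bound[OF pW less_imp_le[OF L(1)], of "[]"] by auto
  have "(LINT z|lborel. ?V z * fourier (tf_shift z \<psi>) \<eta>) = (LINT z|lborel. LINT t|lborel. ?V z * tf_shift z \<psi> t * cis (- (t \<bullet> \<eta>)))"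
    by (simp add: fourier_def mult.assoc)
  also have "\<dots> = (LINT t|lborel. LINT z|lborel. ?V z * tf_shift z \<psi> t * cis (- (t \<bullet> \<eta>)))"
  proof (rule lborel_Fubini(1)[symmetric], rule integrable_lborel_pairI)
    show "integrable lborel (\<lambda>z. C * (cmod (?V z) * exp (M * w (norm z))))"
      by (intro integrable_mult_right rapid_integrable V)
    show "integrable lborel (\<lambda>z::real^'n. exp (- L * w (norm z)))" by fact
    have "(\<lambda>p. tf_shift (fst p) \<psi> (snd p) * cis (- (snd p \<bullet> \<eta>))) \<in> borel_measurable borel"
      unfolding tf_shift_def
      by (intro borel_measurable_continuous_onI continuous_intros continuous_on_compose2[OF decaying_continuous[OF pW]]) auto
    moreover have "(\<lambda>p. ?V (fst p)) \<in> borel_measurable (borel :: (((real^'n) \<times> (real^'n)) \<times> (real^'n)) measure)"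
      by (rule measurable_compose[of fst borel borel]) 
        (auto intro: borel_measurable_continuous_onI continuous_on_fst[OF continuous_on_id])
    ultimately have "(\<lambda>p. ?V (fst p) * (tf_shift (fst p) \<psi> (snd p) * cis (- (snd p \<bullet> \<eta>)))) \<in> borel_measurable borel"
      by (rule borel_measurable_times[rotated])
    then show "(\<lambda>(z, t). ?V z * tf_shift z \<psi> t * cis (- (t \<bullet> \<eta>))) \<in> borel_measurable borel"
      by (simp add: split_beta mult.assoc)
    fix z t
    have "cmod (tf_shift z \<psi> t) \<le> C * exp (M * w (norm z)) * exp (- L * w (norm t))"
      using CM[of z t] by (simp add: exp_minus field_simps)
    from mult_left_mono[OF this, of "cmod (?V z)"]
    show "cmod (case (z, t) of (z, t) \<Rightarrow> ?V z * tf_shift z \<psi> t * cis (- (t \<bullet> \<eta>))) \<le> C * (cmod (?V z) * exp (M * w (norm z))) * exp (- L * w (norm t))"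
      by (simp add: norm_mult mult_ac)
  qed
  also have "\<dots> = (LINT t|lborel. stft_const \<psi> * f t * cis (- (t \<bullet> \<eta>)))"
    by (simp only: integral_mult_left_zero stft_inversion[OF f p])
  also have "\<dots> = stft_const \<psi> * fourier f \<eta>"
    by (simp only: mult.assoc integral_mult_right_zero fourier_def)
  finally show ?thesis .
qed

section \<open>Action of ultradistributions\<close>

lemma seminorm_S_le:
  assumes "\<And>x. cmod (dpart is h x) * exp (real N * w (norm x)) \<le> e1"
    and "\<And>\<xi>. cmod (dpart is (fourier h) \<xi>) * exp (real N * w (norm \<xi>)) \<le> e2"
  shows "seminorm_S w N is h \<le> e1 + e2"
  unfolding seminorm_S_def by (intro add_mono cSUP_least assms) auto

lemma seminorm_S_nonneg:
  assumes h: "h \<in> S_omega w"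
  shows "seminorm_S w N is h \<ge> 0"
proof -
  have "0 \<le> (SUP x. cmod (dpart is g x) * exp (real N * w (norm x)))" if g: "g \<in> decaying" for g :: "real^'a \<Rightarrow> complex"
  proof -
    obtain C where "\<And>x. cmod (dpart is g x) * exp (real N * w (norm x)) \<le> C"
      using decaying_bound[OF g] by metis
    then show ?thesis
      by (intro cSUP_upper2[of _ _ 0] bdd_aboveI2) auto
  qed
  with h show ?thesis
    unfolding seminorm_S_def by (auto simp: S_omega_iff)
qed

lemma finite_lists_length_le_UNIV: "finite {is::'n::finite list. length is \<le> N}"
  using finite_lists_length_le[of "UNIV :: 'n set" N] by simp

lemma S_omega_dual_bound:
  fixes u :: "'n::finite udistr"
  assumes "u \<in> S_omega_dual w"
  obtains C N where "C \<ge> 0"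
    "\<And>f. f \<in> S_omega w \<Longrightarrow> cmod (u f) \<le> C * (\<Sum>is\<in>{is::'n list. length is \<le> N}. seminorm_S w N is f)"
proof -
  obtain C N where C: "\<forall>f\<in>S_omega w. cmod (u f) \<le> C * (\<Sum>is\<in>{is::'n list. length is \<le> N}. seminorm_S w N is f)"
    using assms unfolding S_omega_dual_def by blast
  show thesis
  \<comment> \<open>Seminorms are nonnegative on \<open>S_omega w\<close>, so the constant may be
    replaced by its absolute value.\<close>
  proof (rule that[of "\<bar>C\<bar>" N])
    fix f :: "real^'n \<Rightarrow> complex" assume f: "f \<in> S_omega w"
    have "C * (\<Sum>is\<in>{is::'n list. length is \<le> N}. seminorm_S w N is f) \<le> \<bar>C\<bar> * (\<Sum>is\<in>{is::'n list. length is \<le> N}. seminorm_S w N is f)"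
      by (intro mult_right_mono sum_nonneg seminorm_S_nonneg f) auto
    with C f show "cmod (u f) \<le> \<bar>C\<bar> * (\<Sum>is\<in>{is::'n list. length is \<le> N}. seminorm_S w N is f)" by force
  qed simp
qed

lemma S_omega_dual_lincomb:
  assumes u: "u \<in> S_omega_dual w" and f: "f \<in> S_omega w" and g: "g \<in> S_omega w"
  shows "u (\<lambda>t. c * f t + d * g t) = cnj c * u f + cnj d * u g"
proof -
  have "(\<lambda>t. c * f t) \<in> S_omega w" "(\<lambda>t. d * g t) \<in> S_omega w"
    using S_omega_lincomb[OF f f, of c 0] S_omega_lincomb[OF g g, of d 0] by simp_all
  with u f g show ?thesis
    unfolding S_omega_dual_def by simp
qed

text \<open>Bundled into one induction, because membership of the partial sum in
  \<open>S_omega w\<close> is what makes the other three identities extend by one term.\<close>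

lemma S_omega_finite_sum:
  fixes g :: "'v \<Rightarrow> real^'n::finite \<Rightarrow> complex"
  assumes "finite I" and g: "\<And>v. g v \<in> S_omega w" and u: "u \<in> S_omega_dual w"
  shows "(\<lambda>t. \<Sum>v\<in>I. a v * g v t) \<in> S_omega w \<and>
     u (\<lambda>t. \<Sum>v\<in>I. a v * g v t) = (\<Sum>v\<in>I. cnj (a v) * u (g v)) \<and>
     (\<forall>is. dpart is (\<lambda>t. \<Sum>v\<in>I. a v * g v t) = (\<lambda>t. \<Sum>v\<in>I. a v * dpart is (g v) t)) \<and>
     (\<forall>is. dpart is (fourier (\<lambda>t. \<Sum>v\<in>I. a v * g v t)) = (\<lambda>t. \<Sum>v\<in>I. a v * dpart is (fourier (g v)) t))"
  using assms(1)
proof (induction rule: finite_induct)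
  case empty
  note gW = S_omega_decaying[OF g]
  \<comment> \<open>The zero function is written as a combination of \<open>g undefined\<close> with
    coefficients 0; any index would do, since every \<open>g v\<close> lies in
    \<open>S_omega w\<close>.\<close>
  have 1: "(\<lambda>t::real^'n. 0) \<in> S_omega w"
    using S_omega_lincomb[OF g g, of 0 undefined 0 undefined] by simp
  have 2: "u (\<lambda>t. 0) = 0"
    using S_omega_dual_lincomb[OF u g g, of 0 undefined 0 undefined] by simp
  have 3: "dpart is (\<lambda>t. 0) = (\<lambda>t. 0)" for "is" :: "'n list"
    using dpart_lincomb[OF decaying_smooth[OF gW(1)] decaying_smooth[OF gW(1)], of "is" 0 undefined 0 undefined] by simp
  have 4: "fourier (\<lambda>t::real^'n. 0) = (\<lambda>t. 0)"
    by (simp add: fourier_def[abs_def])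
  show ?case using 1 2 3 by (simp add: 4)
next
  case (insert v I)
  let ?h = "\<lambda>t. \<Sum>v\<in>I. a v * g v t"
  have h: "?h \<in> S_omega w" using insert.IH by blast
  note gW = S_omega_decaying[OF g] and hW = S_omega_decaying[OF h]
  have e: "(\<lambda>t. \<Sum>v\<in>insert v I. a v * g v t) = (\<lambda>t. a v * g v t + 1 * ?h t)"
    using insert by simp
  have 1: "(\<lambda>t. a v * g v t + 1 * ?h t) \<in> S_omega w"
    by (intro S_omega_lincomb g h)
  have 2: "u (\<lambda>t. a v * g v t + 1 * ?h t) = cnj (a v) * u (g v) + 1 * u ?h"
    by (subst S_omega_dual_lincomb[OF u g h]) simp
  have 3: "dpart is (\<lambda>t. a v * g v t + 1 * ?h t) = (\<lambda>t. a v * dpart is (g v) t + 1 * dpart is ?h t)" for "is"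
    by (rule dpart_lincomb[OF decaying_smooth[OF gW(1)] decaying_smooth[OF hW(1)]])
  have 4: "fourier (\<lambda>t. a v * g v t + 1 * ?h t) = (\<lambda>t. a v * fourier (g v) t + 1 * fourier ?h t)"
    by (rule fourier_lincomb[OF decaying_integrable[OF gW(1)] decaying_integrable[OF hW(1)]])
  have 5: "dpart is (\<lambda>t. a v * fourier (g v) t + 1 * fourier ?h t) = (\<lambda>t. a v * dpart is (fourier (g v)) t + 1 * dpart is (fourier ?h) t)" for "is"
    by (rule dpart_lincomb[OF decaying_smooth[OF gW(2)] decaying_smooth[OF hW(2)]])
  show ?case
    unfolding e 2 3 4 5 using 1 insert by simp
qed

section \<open>Seminorms of shifted windows as kernels\<close>

definition tf_rot :: "(real^'n::finite) \<times> (real^'n) \<Rightarrow> (real^'n) \<times> (real^'n)" where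
  "tf_rot z = (snd z, - fst z)"

lemma tf_rot: "continuous_on UNIV tf_rot" "norm (tf_rot z) = norm z"
  unfolding tf_rot_def by (auto intro!: continuous_intros simp: norm_Pair norm_prod_def add.commute)

definition tf_phase :: "(real^'n::finite) \<times> (real^'n) \<Rightarrow> complex" where
  "tf_phase z = cis (fst z \<bullet> snd z)"

lemma tf_phase: "continuous_on UNIV tf_phase" "cmod (tf_phase z) = 1"
  unfolding tf_phase_def by (auto intro!: continuous_intros)

lemma dpart_fourier_tf_shift:
  assumes g: "g \<in> S_omega w"
  shows "dpart is (fourier (tf_shift z g)) t = tf_phase z * dpart is (tf_shift (tf_rot z) (fourier g)) t"
proof -
  have m: "g \<in> borel_measurable borel"
    using g by (intro borel_measurable_continuous_onI decaying_continuous S_omega_decaying)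
  have s: "smooth_fun (tf_shift (tf_rot z) (fourier g))"
    by (intro smooth_fun_tf_shift decaying_smooth S_omega_decaying g)
  have "fourier (tf_shift z g) = (\<lambda>\<eta>. tf_phase z * tf_shift (tf_rot z) (fourier g) \<eta> + 0 * tf_shift (tf_rot z) (fourier g) \<eta>)"
    by (simp add: fourier_tf_shift[OF m] tf_phase_def tf_rot_def)
  then show ?thesis
    by (simp only: dpart_lincomb[OF s s]) simp
qed

text \<open>For \<open>tf_shift z g\<close>, the suprema over \<open>t\<close> of the moduli of this
  function and of \<open>freq_kernel\<close> are the two summands of \<open>seminorm_S\<close>.
  Seminorm estimates thus become supremum estimates for kernels.\<close>

definition time_kernel :: "(real^'n::finite \<Rightarrow> complex) \<Rightarrow> nat \<Rightarrow> 'n list \<Rightarrow> (real^'n) \<times> (real^'n) \<Rightarrow> real^'n \<Rightarrow> complex" where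
  "time_kernel g N is z t = dpart is (tf_shift z g) t * exp (real N * w (norm t))"

definition freq_kernel :: "(real^'n::finite \<Rightarrow> complex) \<Rightarrow> nat \<Rightarrow> 'n list \<Rightarrow> (real^'n) \<times> (real^'n) \<Rightarrow> real^'n \<Rightarrow> complex" where
  "freq_kernel g N is z t = dpart is (fourier (tf_shift z g)) t * exp (real N * w (norm t))"

lemma kernel_time_freq:
  assumes g: "g \<in> S_omega w"
  shows "kernel (time_kernel g N is)" "kernel (freq_kernel g N is)"
proof -
  show "kernel (time_kernel g N is)"
    unfolding time_kernel_def[abs_def] by (rule kernel_tf_id[OF S_omega_decaying(1)[OF g]])
  show "kernel (freq_kernel g N is)"
    unfolding freq_kernel_def[abs_def] dpart_fourier_tf_shift[OF g]
    by (rule kernel_tf_shift[OF S_omega_decaying(2)[OF g] tf_rot tf_phase])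
qed

text \<open>The inversion formula, differentiated and weighted, on both sides and with the same
  density. On the frequency side the phase is first moved into the rapid factor, so that
  \<open>dpart_integral_tf_shift\<close> applies with \<open>A = tf_rot\<close>.\<close>

lemma integral_time_freq_kernel:
  fixes f g :: "real^'n::finite \<Rightarrow> complex"
  assumes f: "f \<in> S_omega w" and g: "g \<in> S_omega w"
  defines "h \<equiv> \<lambda>t. stft_const g * f t"
  shows "dpart is h t * exp (real N * w (norm t)) = (LINT z|lborel. stft g (fun_distr f) z * time_kernel g N is z t)"
    and "dpart is (fourier h) t * exp (real N * w (norm t)) = (LINT z|lborel. stft g (fun_distr f) z * freq_kernel g N is z t)"
proof -
  let ?V = "stft g (fun_distr f)"
  have V: "rapid ?V" by (rule stft_rapid[OF f g])
  have VP: "rapid (\<lambda>z. ?V z * tf_phase z)"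
    using V borel_measurable_continuous_onI[OF tf_phase(1)] unfolding rapid_def
    by (auto simp: norm_mult tf_phase intro!: borel_measurable_times)
  have h1: "h = (\<lambda>t. LINT z|lborel. ?V z * tf_shift z g t)"
    unfolding h_def stft_inversion[OF f g] ..
  have "fourier h = (\<lambda>\<eta>. stft_const g * fourier f \<eta>)"
    using fourier_lincomb[of f f "stft_const g" 0] decaying_integrable[OF S_omega_decaying(1)[OF f]] unfolding h_def by simp
  also have "\<dots> = (\<lambda>\<eta>. LINT z|lborel. (?V z * tf_phase z) * tf_shift (tf_rot z) (fourier g) \<eta>)"
    unfolding stft_inversion_fourier[OF f g, symmetric]
    using dpart_fourier_tf_shift[OF g, of "[]"] by (simp add: mult.assoc)
  finally have h2: "fourier h = (\<lambda>\<eta>. LINT z|lborel. (?V z * tf_phase z) * tf_shift (tf_rot z) (fourier g) \<eta>)" .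
  show "dpart is h t * exp (real N * w (norm t)) = (LINT z|lborel. ?V z * time_kernel g N is z t)"
    unfolding h1 time_kernel_def mult.assoc[symmetric] integral_mult_left_zero
    by (subst dpart_integral_tf_shift[OF V S_omega_decaying(1)[OF g], of "\<lambda>z. z"]) (auto intro: continuous_on_id)
  show "dpart is (fourier h) t * exp (real N * w (norm t)) = (LINT z|lborel. ?V z * freq_kernel g N is z t)"
    unfolding h2 freq_kernel_def mult.assoc[symmetric] integral_mult_left_zero dpart_fourier_tf_shift[OF g]
    by (subst dpart_integral_tf_shift[OF VP S_omega_decaying(2)[OF g] tf_rot]) simp
qed

text \<open>The continuity bound of \<open>u\<close> evaluated at shifts, whose seminorms grow
  moderately by \<open>kernel_bound\<close>. Finitely many exponents are merged into one.\<close>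

lemma S_omega_dual_tf_shift_bound:
  assumes u: "u \<in> S_omega_dual w" and g: "g \<in> S_omega w"
  shows "\<exists>C M. C \<ge> 0 \<and> M \<ge> 0 \<and> (\<forall>z. cmod (u (tf_shift z g)) \<le> C * exp (M * w (norm z)))"
proof -
  obtain C N where C: "C \<ge> 0" "\<And>f. f \<in> S_omega w \<Longrightarrow> cmod (u f) \<le> C * (\<Sum>is\<in>{is. length is \<le> N}. seminorm_S w N is f)"
    using S_omega_dual_bound[OF u] by metis
  have "\<exists>D M. D \<ge> 0 \<and> M \<ge> 0 \<and> (\<forall>z. (\<Sum>is\<in>I. seminorm_S w N is (tf_shift z g)) \<le> D * exp (M * w (norm z)))" if "finite I" for I
    using that
  proof (induction rule: finite_induct)
    case empty
    show ?case by (intro exI[of _ 0]) simp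
  next
    case (insert "is" I)
    obtain D M where D: "D \<ge> 0" "M \<ge> 0" "\<And>z. (\<Sum>is\<in>I. seminorm_S w N is (tf_shift z g)) \<le> D * exp (M * w (norm z))"
      using insert.IH by blast
    obtain D1 M1 where D1: "D1 \<ge> 0" "M1 \<ge> 0" "\<And>z t. cmod (time_kernel g N is z t) \<le> D1 * exp (M1 * w (norm z))"
      using kernel_bound[OF kernel_time_freq(1)[OF g]] by blast
    obtain D2 M2 where D2: "D2 \<ge> 0" "M2 \<ge> 0" "\<And>z t. cmod (freq_kernel g N is z t) \<le> D2 * exp (M2 * w (norm z))"
      using kernel_bound[OF kernel_time_freq(2)[OF g]] by blast
    have mono: "d * exp (m * w (norm z)) \<le> d * exp ((M + M1 + M2) * w (norm z))" if "d \<ge> 0" "m \<le> M + M1 + M2" for d m and z :: "(real^'a) \<times> (real^'a)"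
      using that w_nonneg[of "norm z"] by (intro mult_left_mono) (auto intro!: mult_right_mono)
    have "(\<Sum>is\<in>insert is I. seminorm_S w N is (tf_shift z g)) \<le> (D + D1 + D2) * exp ((M + M1 + M2) * w (norm z))" for z
    proof -
      have "seminorm_S w N is (tf_shift z g) \<le> D1 * exp (M1 * w (norm z)) + D2 * exp (M2 * w (norm z))"
        using D1(3)[of z] D2(3)[of z] by (intro seminorm_S_le) (simp_all add: time_kernel_def freq_kernel_def norm_mult)
      also have "\<dots> \<le> D1 * exp ((M + M1 + M2) * w (norm z)) + D2 * exp ((M + M1 + M2) * w (norm z))"
        using D D1 D2 by (intro add_mono mono) auto
      finally have "seminorm_S w N is (tf_shift z g) \<le> (D1 + D2) * exp ((M + M1 + M2) * w (norm z))"
        by (simp add: distrib_right)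
      moreover have "(\<Sum>is\<in>I. seminorm_S w N is (tf_shift z g)) \<le> D * exp ((M + M1 + M2) * w (norm z))"
        by (rule order_trans[OF D(3) mono]) (use D D1 D2 in auto)
      ultimately show ?thesis
        using insert(1,2) by (simp add: distrib_right)
    qed
    moreover have "D + D1 + D2 \<ge> 0" "M + M1 + M2 \<ge> 0" using D D1 D2 by auto
    ultimately show ?case by blast
  qed
  from this[OF finite_lists_length_le_UNIV] obtain D M where
    D: "D \<ge> 0" "M \<ge> 0" "\<And>z. (\<Sum>is\<in>{is. length is \<le> N}. seminorm_S w N is (tf_shift z g)) \<le> D * exp (M * w (norm z))"
    by blast
  have "cmod (u (tf_shift z g)) \<le> (C * D) * exp (M * w (norm z))" for z
    using order_trans[OF C(2)[OF S_omega_tf_shift[OF g]] mult_left_mono[OF D(3) C(1)]] by (simp add: mult.assoc)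
  moreover have "C * D \<ge> 0" using C D by simp
  ultimately show ?thesis using D(2) by blast
qed

lemma S_omega_dual_tf_shift_continuous:
  fixes u :: "'n::finite udistr"
  assumes u: "u \<in> S_omega_dual w" and g: "g \<in> S_omega w"
  shows "continuous_on UNIV (\<lambda>z. u (tf_shift z g))"
proof -
  obtain C N where C: "C \<ge> 0" "\<And>f. f \<in> S_omega w \<Longrightarrow> cmod (u f) \<le> C * (\<Sum>is\<in>{is. length is \<le> N}. seminorm_S w N is f)"
    using S_omega_dual_bound[OF u] by metis
  \<comment> \<open>An upper bound for the seminorm of \<open>tf_shift z g\<close> minus
    \<open>tf_shift y g\<close>, continuous in \<open>z\<close> by
    \<open>kernel_continuous\<close>.\<close>
  define D where "D is z y = dist (Bcontfun (time_kernel g N is z)) (Bcontfun (time_kernel g N is y)) + dist (Bcontfun (freq_kernel g N is z)) (Bcontfun (freq_kernel g N is y))" for "is" z y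
  have le: "cmod (u (tf_shift z g) - u (tf_shift y g)) \<le> C * (\<Sum>is\<in>{is. length is \<le> N}. D is z y)" for z y
  proof -
    let ?h = "\<lambda>t. 1 * tf_shift z g t + (-1) * tf_shift y g t"
    note zS = S_omega_tf_shift[OF g, of z] and yS = S_omega_tf_shift[OF g, of y]
    have hS: "?h \<in> S_omega w" by (intro S_omega_lincomb zS yS)
    have "cmod (u (tf_shift z g) - u (tf_shift y g)) = cmod (u ?h)"
      using S_omega_dual_lincomb[OF u zS yS, of 1 "-1"] by simp
    also have "\<dots> \<le> C * (\<Sum>is\<in>{is. length is \<le> N}. seminorm_S w N is ?h)"
      by (rule C(2)[OF hS])
    also have "\<dots> \<le> C * (\<Sum>is\<in>{is. length is \<le> N}. D is z y)"
    proof (intro mult_left_mono C(1) sum_mono)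
      fix "is" :: "'n list"
      show "seminorm_S w N is ?h \<le> D is z y"
        unfolding D_def
      proof (rule seminorm_S_le)
        fix x
        have "dpart is ?h x * exp (real N * w (norm x)) = time_kernel g N is z x - time_kernel g N is y x"
          unfolding dpart_lincomb[OF decaying_smooth[OF S_omega_decaying(1)[OF zS]] decaying_smooth[OF S_omega_decaying(1)[OF yS]]] time_kernel_def
          by (simp add: algebra_simps)
        then have "cmod (dpart is ?h x) * exp (real N * w (norm x)) = dist (time_kernel g N is z x) (time_kernel g N is y x)"
          by (metis dist_norm norm_mult norm_exp_eq_Re norm_of_real abs_exp_cancel)
        then show "cmod (dpart is ?h x) * exp (real N * w (norm x)) \<le> dist (Bcontfun (time_kernel g N is z)) (Bcontfun (time_kernel g N is y))"
          using dist_bounded[of "Bcontfun (time_kernel g N is z)" x "Bcontfun (time_kernel g N is y)"] by (simp add: kernel_apply[OF kernel_time_freq(1)[OF g]])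
        have "fourier ?h = (\<lambda>t. 1 * fourier (tf_shift z g) t + (-1) * fourier (tf_shift y g) t)"
          by (rule fourier_lincomb[OF decaying_integrable[OF S_omega_decaying(1)[OF zS]] decaying_integrable[OF S_omega_decaying(1)[OF yS]]])
        then have "dpart is (fourier ?h) x * exp (real N * w (norm x)) = freq_kernel g N is z x - freq_kernel g N is y x"
          unfolding freq_kernel_def
          by (simp only: dpart_lincomb[OF decaying_smooth[OF S_omega_decaying(2)[OF zS]] decaying_smooth[OF S_omega_decaying(2)[OF yS]]]) (simp add: algebra_simps)
        then have "cmod (dpart is (fourier ?h) x) * exp (real N * w (norm x)) = dist (freq_kernel g N is z x) (freq_kernel g N is y x)"
          by (metis dist_norm norm_mult norm_exp_eq_Re norm_of_real abs_exp_cancel)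
        then show "cmod (dpart is (fourier ?h) x) * exp (real N * w (norm x)) \<le> dist (Bcontfun (freq_kernel g N is z)) (Bcontfun (freq_kernel g N is y))"
          using dist_bounded[of "Bcontfun (freq_kernel g N is z)" x "Bcontfun (freq_kernel g N is y)"] by (simp add: kernel_apply[OF kernel_time_freq(2)[OF g]])
      qed
    qed
    finally show ?thesis .
  qed
  have Dlim: "((\<lambda>z. C * (\<Sum>is\<in>{is. length is \<le> N}. D is z y)) \<longlongrightarrow> 0) (at y)" for y
  proof -
    have "((\<lambda>z. C * (\<Sum>is\<in>{is. length is \<le> N}. D is z y)) \<longlongrightarrow> C * (\<Sum>is\<in>{is::'n list. length is \<le> N}. D is y y)) (at y)"
      unfolding D_def
      by (intro tendsto_intros isContD kernel_continuous[OF kernel_time_freq(1)[OF g], unfolded continuous_on_eq_continuous_at[OF open_UNIV], rule_format]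
          kernel_continuous[OF kernel_time_freq(2)[OF g], unfolded continuous_on_eq_continuous_at[OF open_UNIV], rule_format]) auto
    then show ?thesis by (simp add: D_def)
  qed
  have "((\<lambda>z. u (tf_shift z g)) \<longlongrightarrow> u (tf_shift y g)) (at y)" for y
    by (rule LIM_zero_cancel) (rule Lim_null_comparison[OF always_eventually Dlim], use le in blast)
  then show ?thesis
    unfolding continuous_on_def by simp
qed

text \<open>The values \<open>u (h' k)\<close> have two limits that must agree: \<open>u h\<close>,
  since \<open>h' k\<close> tends to \<open>h\<close> in all seminorms bounding \<open>u\<close>,
  and the integral on the left, by dominated convergence for the continuous and moderately growing
  function \<open>z \<mapsto> u (tf_shift z g)\<close>.\<close>

lemma S_omega_dual_inversion:
  fixes u :: "'n::finite udistr"
  assumes u: "u \<in> S_omega_dual w" and f: "f \<in> S_omega w" and g: "g \<in> S_omega w"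
  shows "(LINT z|lborel. u (tf_shift z g) * cnj (stft g (fun_distr f) z)) = stft_const g * u f"
proof -
  let ?V = "stft g (fun_distr f)" and ?U = "\<lambda>z. u (tf_shift z g)"
  define h where "h = (\<lambda>t. stft_const g * f t)"
  have V: "rapid ?V" by (rule stft_rapid[OF f g])
  have Vm [measurable]: "?V \<in> borel_measurable borel" using V unfolding rapid_def by simp
  have Vi: "integrable lborel ?V"
    using rapid_bounded_mult[OF V, of "\<lambda>_. 1" 1 0] by simp
  \<comment> \<open>The constant is real, so conjugate-linearity leaves it unchanged.\<close>
  have hS: "h \<in> S_omega w" and uh: "u h = stft_const g * u f"
    using S_omega_lincomb[OF f f, of "stft_const g" 0] S_omega_dual_lincomb[OF u f f, of "stft_const g" 0]
    unfolding h_def by simp_all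
  \<comment> \<open>Simple approximations of the identity map. The base point 0 yields the bound by
    \<open>2 * norm z\<close>, under which weights at most double.\<close>
  obtain s :: "nat \<Rightarrow> (real^'n) \<times> (real^'n) \<Rightarrow> (real^'n) \<times> (real^'n)" where
    s: "\<And>k. simple_function lborel (s k)" "\<And>z. (\<lambda>k. s k z) \<longlonglongrightarrow> z" "\<And>k z. norm (s k z) \<le> 2 * norm z"
    using borel_measurable_implies_sequence_metric[of "\<lambda>z::(real^'n) \<times> (real^'n). z" lborel 0] by (auto simp: dist_norm)
  have sm [measurable]: "s k \<in> borel_measurable borel" for k
    using borel_measurable_simple_function[OF s(1)] by simp
  \<comment> \<open>The mass of the transform on the cell where \<open>s k\<close> equals
    \<open>v\<close>; \<open>h' k\<close> is then the inversion integral with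
    \<open>tf_shift (s k z) g\<close> in place of \<open>tf_shift z g\<close>.\<close>
  define a where "a k v = (LINT z|lborel. ?V z * indicator (s k -` {v}) z)" for k v
  define h' where "h' k = (\<lambda>t. \<Sum>v\<in>range (s k). a k v * tf_shift v g t)" for k
  have fin: "finite (range (s k))" for k
    using simple_functionD(1)[OF s(1)] by simp
  note sum = S_omega_finite_sum[where g="\<lambda>v. tf_shift v g", OF fin S_omega_tf_shift[OF g] u]
  have h'S: "h' k \<in> S_omega w" for k
    unfolding h'_def using sum by blast
  obtain C N where C: "C \<ge> 0" "\<And>f. f \<in> S_omega w \<Longrightarrow> cmod (u f) \<le> C * (\<Sum>is\<in>{is. length is \<le> N}. seminorm_S w N is f)"
    using S_omega_dual_bound[OF u] by metis
  have "\<exists>E. E \<longlonglongrightarrow> 0 \<and> (\<forall>k t. cmod (dpart is h t * exp (real N * w (norm t)) - dpart is (h' k) t * exp (real N * w (norm t))) \<le> E k)" for "is"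
  proof -
    have "dpart is (h' k) t * exp (real N * w (norm t)) = (LINT z|lborel. ?V z * time_kernel g N is (s k z) t)" for k t
      unfolding integral_simple_comp[OF s(1) Vi, of "\<lambda>v. time_kernel g N is v t"] a_def[symmetric] h'_def
      using sum by (simp add: time_kernel_def sum_distrib_right mult.assoc)
    note e = this
    obtain E where "E \<longlonglongrightarrow> 0"
      "\<And>k t. cmod ((LINT z|lborel. ?V z * time_kernel g N is z t) - (LINT z|lborel. ?V z * time_kernel g N is (s k z) t)) \<le> E k"
      using kernel_approx[OF kernel_time_freq(1)[OF g, of N "is"] V sm s(2,3)] by blast
    then show ?thesis
      unfolding h_def integral_time_freq_kernel(1)[OF f g] e by blast
  qed
  then obtain E1 where E1: "\<And>is. E1 is \<longlonglongrightarrow> 0"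
    "\<And>is k t. cmod (dpart is h t * exp (real N * w (norm t)) - dpart is (h' k) t * exp (real N * w (norm t))) \<le> E1 is k"
    by metis
  have "\<exists>E. E \<longlonglongrightarrow> 0 \<and> (\<forall>k t. cmod (dpart is (fourier h) t * exp (real N * w (norm t)) - dpart is (fourier (h' k)) t * exp (real N * w (norm t))) \<le> E k)" for "is"
  proof -
    have "dpart is (fourier (h' k)) t * exp (real N * w (norm t)) = (LINT z|lborel. ?V z * freq_kernel g N is (s k z) t)" for k t
      unfolding integral_simple_comp[OF s(1) Vi, of "\<lambda>v. freq_kernel g N is v t"] a_def[symmetric] h'_def
      using sum by (simp add: freq_kernel_def sum_distrib_right mult.assoc)
    note e = this
    obtain E where "E \<longlonglongrightarrow> 0"
      "\<And>k t. cmod ((LINT z|lborel. ?V z * freq_kernel g N is z t) - (LINT z|lborel. ?V z * freq_kernel g N is (s k z) t)) \<le> E k"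
      using kernel_approx[OF kernel_time_freq(2)[OF g, of N "is"] V sm s(2,3)] by blast
    then show ?thesis
      unfolding h_def integral_time_freq_kernel(2)[OF f g] e by blast
  qed
  then obtain E2 where E2: "\<And>is. E2 is \<longlonglongrightarrow> 0"
    "\<And>is k t. cmod (dpart is (fourier h) t * exp (real N * w (norm t)) - dpart is (fourier (h' k)) t * exp (real N * w (norm t))) \<le> E2 is k"
    by metis
  have le: "cmod (u (h' k) - u h) \<le> C * (\<Sum>is\<in>{is. length is \<le> N}. E1 is k + E2 is k)" for k
  proof -
    let ?d = "\<lambda>t. 1 * h t + (-1) * h' k t"
    have dS: "?d \<in> S_omega w" by (intro S_omega_lincomb hS h'S)
    have "cmod (u (h' k) - u h) = cmod (u ?d)"
      using S_omega_dual_lincomb[OF u hS h'S, of 1 "-1" k] by (simp add: norm_minus_commute)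
    also have "\<dots> \<le> C * (\<Sum>is\<in>{is. length is \<le> N}. seminorm_S w N is ?d)"
      by (rule C(2)[OF dS])
    also have "\<dots> \<le> C * (\<Sum>is\<in>{is. length is \<le> N}. E1 is k + E2 is k)"
    proof (intro mult_left_mono C(1) sum_mono seminorm_S_le)
      fix "is" :: "'n list" and x
      have "cmod (dpart is ?d x) * exp (real N * w (norm x)) = cmod (dpart is ?d x * exp (real N * w (norm x)))"
        by (simp add: norm_mult)
      also have "\<dots> = cmod (dpart is h x * exp (real N * w (norm x)) - dpart is (h' k) x * exp (real N * w (norm x)))"
        unfolding dpart_lincomb[OF decaying_smooth[OF S_omega_decaying(1)[OF hS]] decaying_smooth[OF S_omega_decaying(1)[OF h'S]]]
        by (simp add: algebra_simps)
      also have "\<dots> \<le> E1 is k" by (rule E1)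
      finally show "cmod (dpart is ?d x) * exp (real N * w (norm x)) \<le> E1 is k" .
      have fd: "fourier ?d = (\<lambda>t. 1 * fourier h t + (-1) * fourier (h' k) t)"
        by (rule fourier_lincomb[OF decaying_integrable[OF S_omega_decaying(1)[OF hS]] decaying_integrable[OF S_omega_decaying(1)[OF h'S]]])
      have "cmod (dpart is (fourier ?d) x) * exp (real N * w (norm x)) = cmod (dpart is (fourier ?d) x * exp (real N * w (norm x)))"
        by (simp add: norm_mult)
      also have "\<dots> = cmod (dpart is (fourier h) x * exp (real N * w (norm x)) - dpart is (fourier (h' k)) x * exp (real N * w (norm x)))"
        unfolding fd dpart_lincomb[OF decaying_smooth[OF S_omega_decaying(2)[OF hS]] decaying_smooth[OF S_omega_decaying(2)[OF h'S]]]
        by (simp add: algebra_simps)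
      also have "\<dots> \<le> E2 is k" by (rule E2)
      finally show "cmod (dpart is (fourier ?d) x) * exp (real N * w (norm x)) \<le> E2 is k" .
    qed
    finally show ?thesis .
  qed
  have "(\<lambda>k. C * (\<Sum>is\<in>{is. length is \<le> N}. E1 is k + E2 is k)) \<longlonglongrightarrow> C * (\<Sum>is\<in>{is::'n list. length is \<le> N}. 0 + 0)"
    by (intro tendsto_intros E1 E2)
  then have lim0: "(\<lambda>k. C * (\<Sum>is\<in>{is. length is \<le> N}. E1 is k + E2 is k)) \<longlonglongrightarrow> 0" by simp
  have "(\<lambda>k. u (h' k) - u h) \<longlonglongrightarrow> 0"
    by (rule Lim_null_comparison[OF always_eventually lim0]) (use le in blast)
  then have lim1: "(\<lambda>k. u (h' k)) \<longlonglongrightarrow> u h"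
    by (rule LIM_zero_cancel)
  \<comment> \<open>Conjugate-linearity conjugates the coefficients, and
    \<open>integral_simple_comp\<close> is read backwards with the conjugated density.\<close>
  have uh': "u (h' k) = (LINT z|lborel. cnj (?V z) * ?U (s k z))" for k
  proof -
    have "u (h' k) = (\<Sum>v\<in>range (s k). cnj (a k v) * ?U v)"
      unfolding h'_def using sum by blast
    also have "\<dots> = (\<Sum>v\<in>range (s k). (LINT z|lborel. cnj (?V z) * indicator (s k -` {v}) z) * ?U v)"
    proof -
      have "cnj (a k v) = (LINT z|lborel. cnj (?V z) * indicator (s k -` {v}) z)" for v
        unfolding a_def Bochner_Integration.integral_cnj[symmetric]
        by (intro Bochner_Integration.integral_cong) (auto simp: indicator_def)
      then show ?thesis by simp
    qed
    also have "\<dots> = (LINT z|lborel. cnj (?V z) * ?U (s k z))"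
      by (rule integral_simple_comp[OF s(1), symmetric]) (use Vi in simp)
    finally show ?thesis .
  qed
  obtain B M where B: "B \<ge> 0" "M \<ge> 0" "\<And>z. cmod (?U z) \<le> B * exp (M * w (norm z))"
    using S_omega_dual_tf_shift_bound[OF u g] by blast
  note Uc = S_omega_dual_tf_shift_continuous[OF u g]
  have [measurable]: "(\<lambda>z. cnj (?V z)) \<in> borel_measurable borel"
    by (rule measurable_compose[OF Vm borel_measurable_continuous_onI]) (intro continuous_intros)
  have "(\<lambda>k. u (h' k)) \<longlonglongrightarrow> (LINT z|lborel. cnj (?V z) * ?U z)"
    unfolding uh'
  proof (rule integral_dominated_convergence[where w="\<lambda>z. B * (cmod (?V z) * exp (2 * M * w (norm z)))"])
    show "integrable lborel (\<lambda>z. B * (cmod (?V z) * exp (2 * M * w (norm z))))"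
      by (intro integrable_mult_right rapid_integrable V)
    show "(\<lambda>z. cnj (?V z) * ?U (s k z)) \<in> borel_measurable lborel" for k
      using measurable_compose[OF sm borel_measurable_continuous_onI[OF Uc]] by simp
    show "AE z in lborel. (\<lambda>k. cnj (?V z) * ?U (s k z)) \<longlonglongrightarrow> cnj (?V z) * ?U z"
    proof (rule AE_I2)
      fix z
      have "(\<lambda>k. ?U (s k z)) \<longlonglongrightarrow> ?U z"
        using Uc s(2)[of z] by (intro isCont_tendsto_compose[of z ?U]) (simp_all add: continuous_on_eq_continuous_at del: split_paired_All)
      then show "(\<lambda>k. cnj (?V z) * ?U (s k z)) \<longlonglongrightarrow> cnj (?V z) * ?U z"
        by (intro tendsto_intros)
    qed
    show "AE z in lborel. norm (cnj (?V z) * ?U (s k z)) \<le> B * (cmod (?V z) * exp (2 * M * w (norm z)))" for k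
    proof (rule AE_I2)
      fix z
      have "M * w (norm (s k z)) \<le> 2 * M * w (norm z)"
        using mult_left_mono[OF w_double[OF s(3)[of k z]] B(2)] by simp
      then have "cmod (?U (s k z)) \<le> B * exp (2 * M * w (norm z))"
        using B(1) by (intro order_trans[OF B(3)] mult_left_mono) auto
      from mult_left_mono[OF this, of "cmod (?V z)"]
      show "norm (cnj (?V z) * ?U (s k z)) \<le> B * (cmod (?V z) * exp (2 * M * w (norm z)))"
        by (simp add: norm_mult mult_ac)
    qed
  qed (use borel_measurable_continuous_onI[OF Uc] in simp)
  from LIMSEQ_unique[OF this lim1] show ?thesis
    by (simp add: uh mult.commute)
qed

end

section \<open>Comparison of wave front sets\<close>

text \<open>The set where a continuous function is nonzero is open, and a nonempty open set is not
  negligible.\<close>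

lemma continuous_L2_norm_pos:
  fixes g :: "'a::euclidean_space \<Rightarrow> complex"
  assumes cont: "continuous_on UNIV g" and "g \<noteq> (\<lambda>_. 0)" and int: "integrable lborel (\<lambda>t. (cmod (g t))\<^sup>2)"
  shows "(LINT t|lborel. (cmod (g t))\<^sup>2) > 0"
proof -
  have "(LINT t|lborel. (cmod (g t))\<^sup>2) \<noteq> 0"
  proof
    assume "(LINT t|lborel. (cmod (g t))\<^sup>2) = 0"
    then have "AE t in lborel. (cmod (g t))\<^sup>2 = 0"
      using integral_nonneg_eq_0_iff_AE[OF int] by simp
    then have ae: "AE t in lborel. t \<notin> {t. g t \<noteq> 0}" by simp
    have op: "open {t. g t \<noteq> 0}"
      using cont by (intro open_Collect_neq continuous_intros)
    then have "{t. g t \<noteq> 0} \<in> null_sets lborel"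
      using ae by (subst AE_iff_null_sets) auto
    then have "negligible {t. g t \<noteq> 0}"
      by (simp add: negligible_iff_null_sets null_sets_completionI)
    with open_not_negligible[OF op] assms(2) show False by auto
  qed
  moreover have "(LINT t|lborel. (cmod (g t))\<^sup>2) \<ge> 0" by (rule Bochner_Integration.integral_nonneg) simp
  ultimately show ?thesis by linarith
qed

lemma WF_coeff_cong_rapid:
  assumes "\<And>lam. lam > 0 \<Longrightarrow> \<exists>C. \<forall>\<sigma>\<in>L. exp (lam * w (norm \<sigma>)) * cmod (c1 \<sigma> - c2 \<sigma>) \<le> C"
  shows "WF_coeff w L c1 = WF_coeff w L c2"
proof -
  \<comment> \<open>Stated for a generic pair, so that exchanging the two families gives the other
    direction.\<close>
  have *: "\<exists>C. \<forall>\<sigma>\<in>L \<inter> G. exp (lam * w (norm \<sigma>)) * cmod (c' \<sigma>) \<le> C"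
    if "\<And>\<sigma>. cmod (c' \<sigma> - c \<sigma>) = cmod (c1 \<sigma> - c2 \<sigma>)" and lam: "lam > 0"
      and bdd: "\<exists>C. \<forall>\<sigma>\<in>L \<inter> G. exp (lam * w (norm \<sigma>)) * cmod (c \<sigma>) \<le> C" for c c' lam G
  proof -
    obtain C where C: "\<forall>\<sigma>\<in>L \<inter> G. exp (lam * w (norm \<sigma>)) * cmod (c \<sigma>) \<le> C" using bdd by blast
    obtain D where D: "\<forall>\<sigma>\<in>L. exp (lam * w (norm \<sigma>)) * cmod (c1 \<sigma> - c2 \<sigma>) \<le> D" using assms[OF lam] by blast
    have "exp (lam * w (norm \<sigma>)) * cmod (c' \<sigma>) \<le> C + D" if "\<sigma> \<in> L \<inter> G" for \<sigma>
    proof -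
      have "cmod (c' \<sigma>) \<le> cmod (c \<sigma>) + cmod (c' \<sigma> - c \<sigma>)"
        using norm_triangle_ineq[of "c \<sigma>" "c' \<sigma> - c \<sigma>"] by simp
      then have "exp (lam * w (norm \<sigma>)) * cmod (c' \<sigma>) \<le> exp (lam * w (norm \<sigma>)) * (cmod (c \<sigma>) + cmod (c' \<sigma> - c \<sigma>))"
        by (intro mult_left_mono) auto
      also have "\<dots> \<le> C + D"
        using C D that \<open>\<And>\<sigma>. cmod (c' \<sigma> - c \<sigma>) = cmod (c1 \<sigma> - c2 \<sigma>)\<close> unfolding distrib_left by (intro add_mono) auto
      finally show ?thesis .
    qed
    then show ?thesis by blast
  qed
  have "(\<forall>lam>0. \<exists>C. \<forall>\<sigma>\<in>L \<inter> G. exp (lam * w (norm \<sigma>)) * cmod (c1 \<sigma>) \<le> C) \<longleftrightarrow>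
        (\<forall>lam>0. \<exists>C. \<forall>\<sigma>\<in>L \<inter> G. exp (lam * w (norm \<sigma>)) * cmod (c2 \<sigma>) \<le> C)" for G
    using *[of c1 c2 _ G] *[of c2 c1 _ G] by (metis norm_minus_commute)
  then show ?thesis
    unfolding WF_coeff_def by simp
qed

context weight
begin

section \<open>Modulation spaces and their pairing\<close>

lemma stft_measurable_dual:
  assumes "u \<in> S_omega_dual w" "g \<in> S_omega w"
  shows "stft g u \<in> borel_measurable borel"
  unfolding stft_def[abs_def]
  by (rule borel_measurable_continuous_onI[OF S_omega_dual_tf_shift_continuous[OF assms]])

lemma stft_const_nonzero:
  assumes g: "g \<in> S_omega w" and nz: "g \<noteq> (\<lambda>_. 0)"
  shows "stft_const g \<noteq> 0"
proof -
  note gW = S_omega_decaying(1)[OF g]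
  obtain K where K: "\<And>x. norm (g x) \<le> K" using decaying_bounded[OF gW] by blast
  have "integrable lborel (\<lambda>t. (cmod (g t))\<^sup>2)"
  proof (rule Bochner_Integration.integrable_bound)
    show "integrable lborel (\<lambda>t. K *\<^sub>R g t)" by (intro integrable_scaleR_right decaying_integrable gW)
    show "(\<lambda>t. (cmod (g t))\<^sup>2) \<in> borel_measurable lborel"
      using borel_measurable_continuous_onI[OF decaying_continuous[OF gW]] by simp
    show "AE t in lborel. norm ((cmod (g t))\<^sup>2) \<le> norm (K *\<^sub>R g t)"
    proof (rule AE_I2)
      fix t
      have "cmod (g t) * cmod (g t) \<le> K * cmod (g t)" by (intro mult_right_mono K) simp
      also have "\<dots> \<le> \<bar>K\<bar> * cmod (g t)" by (intro mult_right_mono) auto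
      finally show "norm ((cmod (g t))\<^sup>2) \<le> norm (K *\<^sub>R g t)" by (simp add: power2_eq_square)
    qed
  qed
  from continuous_L2_norm_pos[OF decaying_continuous[OF gW] nz this] show ?thesis by simp
qed

text \<open>The normalised inversion formula: the pairing built from short-time Fourier transforms
  extends evaluation on test functions.\<close>

lemma M2_pair_fun_distr:
  assumes "u \<in> S_omega_dual w" "f \<in> S_omega w" "g \<in> S_omega w" "g \<noteq> (\<lambda>_. 0)"
  shows "M2_pair g u (fun_distr f) = u f"
  using S_omega_dual_inversion[OF assms(1-3)] stft_const_nonzero[OF assms(3,4)]
  by (simp only: M2_pair_def stft_def) simp

lemma rapid_square_integrable:
  assumes V: "rapid V"
  shows "integrable lborel (\<lambda>z. (cmod (V z) * exp (\<mu> * w (norm z)))\<^sup>2)"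
proof -
  have [measurable]: "V \<in> borel_measurable borel" using V unfolding rapid_def by simp
  obtain C where C: "\<And>z. cmod (V z) * exp (0 * w (norm z)) \<le> C"
    using V unfolding rapid_def by blast
  show ?thesis
  proof (rule Bochner_Integration.integrable_bound)
    show "integrable lborel (\<lambda>z. C * (cmod (V z) * exp (2 * \<mu> * w (norm z))))"
      by (intro integrable_mult_right rapid_integrable V)
    show "AE z in lborel. norm ((cmod (V z) * exp (\<mu> * w (norm z)))\<^sup>2) \<le> norm (C * (cmod (V z) * exp (2 * \<mu> * w (norm z))))"
    proof (rule AE_I2)
      fix z
      have "(cmod (V z) * exp (\<mu> * w (norm z)))\<^sup>2 = cmod (V z) * (cmod (V z) * exp (2 * \<mu> * w (norm z)))"
        by (simp add: power2_eq_square mult_ac flip: exp_add)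
      also have "\<dots> \<le> C * (cmod (V z) * exp (2 * \<mu> * w (norm z)))"
        using C[of z] by (intro mult_right_mono) auto
      finally show "norm ((cmod (V z) * exp (\<mu> * w (norm z)))\<^sup>2) \<le> norm (C * (cmod (V z) * exp (2 * \<mu> * w (norm z))))"
        by simp
    qed
  qed measurable
qed

lemma M2_norm_square: "(M2_norm w g \<mu> d)\<^sup>2 = (LINT z|lborel. (cmod (stft g d z) * exp (\<mu> * w (norm z)))\<^sup>2)"
  unfolding M2_norm_def by (simp add: integral_nonneg_AE)

text \<open>The scaling parameter \<open>r\<close> makes the arithmetic-geometric mean inequality do the work of the
  Cauchy-Schwarz inequality.\<close>

lemma stft_product:
  assumes u: "stft g u \<in> borel_measurable borel" "integrable lborel (\<lambda>z. (cmod (stft g u z) * exp (- \<mu> * w (norm z)))\<^sup>2)"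
    and d: "stft g d \<in> borel_measurable borel" "integrable lborel (\<lambda>z. (cmod (stft g d z) * exp (\<mu> * w (norm z)))\<^sup>2)"
  shows "integrable lborel (\<lambda>z. stft g u z * cnj (stft g d z))"
    and "r \<ge> 0 \<Longrightarrow> r * cmod (LINT z|lborel. stft g u z * cnj (stft g d z))
       \<le> ((M2_norm w g (- \<mu>) u)\<^sup>2 + r\<^sup>2 * (M2_norm w g \<mu> d)\<^sup>2) / 2"
proof -
  let ?F = "\<lambda>z. cmod (stft g u z) * exp (- \<mu> * w (norm z))" and ?G = "\<lambda>z. cmod (stft g d z) * exp (\<mu> * w (norm z))"
  have le: "r * cmod (stft g u z * cnj (stft g d z)) \<le> ((?F z)\<^sup>2 + r\<^sup>2 * (?G z)\<^sup>2) / 2" for r z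
  proof -
    have "cmod (stft g u z * cnj (stft g d z)) = ?F z * ?G z"
      by (simp add: norm_mult exp_minus)
    moreover have "2 * (?F z) * (r * ?G z) \<le> (?F z)\<^sup>2 + (r * ?G z)\<^sup>2"
      by (rule sum_squares_bound)
    ultimately show ?thesis by (simp add: power_mult_distrib mult_ac)
  qed
  have m: "(\<lambda>z. stft g u z * cnj (stft g d z)) \<in> borel_measurable borel"
    using u(1) measurable_compose[OF d(1) borel_measurable_continuous_onI[OF continuous_on_cnj[OF continuous_on_id]]] by simp
  have R: "integrable lborel (\<lambda>z. ((?F z)\<^sup>2 + r\<^sup>2 * (?G z)\<^sup>2) / 2)" for r :: real
    using u(2) d(2) by (intro integrable_divide Bochner_Integration.integrable_add integrable_mult_right)
  show I: "integrable lborel (\<lambda>z. stft g u z * cnj (stft g d z))"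
    by (rule Bochner_Integration.integrable_bound[OF R[of 1]]) (use m le[of 1] in \<open>auto intro!: order_trans[OF _ abs_ge_self]\<close>)
  assume r: "r \<ge> 0"
  have "r * cmod (LINT z|lborel. stft g u z * cnj (stft g d z)) \<le> r * (LINT z|lborel. cmod (stft g u z * cnj (stft g d z)))"
    using r by (intro mult_left_mono integral_norm_bound)
  also have "\<dots> = (LINT z|lborel. r * cmod (stft g u z * cnj (stft g d z)))"
    by (simp only: integral_mult_right_zero)
  also have "\<dots> \<le> (LINT z|lborel. ((?F z)\<^sup>2 + r\<^sup>2 * (?G z)\<^sup>2) / 2)"
    using I by (intro integral_mono R le) auto
  also have "\<dots> = ((M2_norm w g (- \<mu>) u)\<^sup>2 + r\<^sup>2 * (M2_norm w g \<mu> d)\<^sup>2) / 2"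
    unfolding M2_norm_square using u(2) d(2) by simp
  finally show "r * cmod (LINT z|lborel. stft g u z * cnj (stft g d z)) \<le> ((M2_norm w g (- \<mu>) u)\<^sup>2 + r\<^sup>2 * (M2_norm w g \<mu> d)\<^sup>2) / 2" .
qed

text \<open>The transform of \<open>u\<close> grows at most like
  \<open>exp (M * w (norm z))\<close>; the parameter \<open>M + L\<close> cancels this growth and
  leaves, after squaring, an integrable weight.\<close>

lemma S_omega_dual_M2:
  fixes u :: "'n::finite udistr"
  assumes u: "u \<in> S_omega_dual w" and g: "g \<in> S_omega w"
  obtains \<mu> where "\<mu> \<ge> 0" "u \<in> M2 w g (- \<mu>)"
proof -
  obtain C M where CM: "C \<ge> 0" "M \<ge> 0" "\<And>z. cmod (u (tf_shift z g)) \<le> C * exp (M * w (norm z))"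
    using S_omega_dual_tf_shift_bound[OF u g] by blast
  obtain L where L: "L > 0" "\<And>lam. lam \<ge> L \<Longrightarrow> integrable lborel (\<lambda>z::(real^'n) \<times> (real^'n). exp (- lam * w (norm z)))"
    using integrable_exp_w[where 'a="(real^'n) \<times> (real^'n)"] by metis
  have [measurable]: "stft g u \<in> borel_measurable borel" by (rule stft_measurable_dual[OF u g])
  have "integrable lborel (\<lambda>z. (cmod (stft g u z) * exp (- (M + L) * w (norm z)))\<^sup>2)"
  proof (rule Bochner_Integration.integrable_bound)
    show "integrable lborel (\<lambda>z::(real^'n) \<times> (real^'n). C\<^sup>2 * exp (- (2 * L) * w (norm z)))"
      using L by (intro integrable_mult_right L) auto
    show "AE z in lborel. norm ((cmod (stft g u z) * exp (- (M + L) * w (norm z)))\<^sup>2) \<le> norm (C\<^sup>2 * exp (- (2 * L) * w (norm z)))"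
    proof (rule AE_I2)
      fix z :: "(real^'n) \<times> (real^'n)"
      have "cmod (stft g u z) * exp (- (M + L) * w (norm z)) \<le> (C * exp (M * w (norm z))) * exp (- (M + L) * w (norm z))"
        unfolding stft_def by (intro mult_right_mono CM) auto
      also have "\<dots> = C * exp (- L * w (norm z))"
        by (simp add: algebra_simps flip: exp_add)
      finally have "(cmod (stft g u z) * exp (- (M + L) * w (norm z)))\<^sup>2 \<le> (C * exp (- L * w (norm z)))\<^sup>2"
        by (intro power_mono) auto
      also have "\<dots> = C\<^sup>2 * exp (- (2 * L) * w (norm z))"
        by (simp add: power_mult_distrib power2_eq_square flip: exp_add)
      finally show "norm ((cmod (stft g u z) * exp (- (M + L) * w (norm z)))\<^sup>2) \<le> norm (C\<^sup>2 * exp (- (2 * L) * w (norm z)))"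
        by simp
    qed
  qed measurable
  with u CM L show thesis
    by (intro that[of "M + L"]) (auto simp: M2_def)
qed

text \<open>Common core of (i) and (ii), with \<open>d \<sigma>\<close> standing for
  \<open>x\<^sub>\<sigma> - y\<^sub>\<sigma>\<close> as an ultradistribution. A single term of the
  sum controls the pairing at \<sigma>, and the resulting bound does not depend on \<sigma>.\<close>

lemma WF_coeff_eq_of_M2_close:
  assumes g: "g \<in> S_omega w" and u: "u \<in> M2 w g (- \<mu>)"
    and m: "\<And>\<sigma>. \<sigma> \<in> L \<Longrightarrow> stft g (d \<sigma>) \<in> borel_measurable borel"
    and int: "\<And>\<sigma>. \<sigma> \<in> L \<Longrightarrow> integrable lborel (\<lambda>z. (cmod (stft g (d \<sigma>) z) * exp (\<mu> * w (norm z)))\<^sup>2)"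
    and diff: "\<And>\<sigma>. \<sigma> \<in> L \<Longrightarrow> c1 \<sigma> - c2 \<sigma> = M2_pair g u (d \<sigma>)"
    and small: "\<And>lam. lam \<ge> 0 \<Longrightarrow> \<exists>\<epsilon>>0. (\<lambda>\<sigma>. exp (lam * w (norm \<sigma>)) * (M2_norm w g \<mu> (d \<sigma>))\<^sup>2) summable_on L \<and>
        (\<Sum>\<^sub>\<infinity>\<sigma>\<in>L. exp (lam * w (norm \<sigma>)) * (M2_norm w g \<mu> (d \<sigma>))\<^sup>2) \<le> \<epsilon>"
  shows "WF_coeff w L c1 = WF_coeff w L c2"
proof (rule WF_coeff_cong_rapid)
  fix lam :: real assume lam: "lam > 0"
  \<comment> \<open>The norm enters squared, so decay of order \<open>lam\<close> needs smallness of
    order \<open>2 * lam\<close>; the scaling parameter of \<open>stft_product\<close> will be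
    \<open>exp (lam * w (norm \<sigma>))\<close>.\<close>
  then obtain \<epsilon> where sm: "(\<lambda>\<sigma>. exp (2 * lam * w (norm \<sigma>)) * (M2_norm w g \<mu> (d \<sigma>))\<^sup>2) summable_on L"
    and \<epsilon>: "(\<Sum>\<^sub>\<infinity>\<sigma>\<in>L. exp (2 * lam * w (norm \<sigma>)) * (M2_norm w g \<mu> (d \<sigma>))\<^sup>2) \<le> \<epsilon>"
    using small[of "2 * lam"] by auto
  have uS: "u \<in> S_omega_dual w" and ui: "integrable lborel (\<lambda>z. (cmod (stft g u z) * exp (- \<mu> * w (norm z)))\<^sup>2)"
    using u unfolding M2_def by auto
  have "exp (lam * w (norm \<sigma>)) * cmod (c1 \<sigma> - c2 \<sigma>) \<le> (((M2_norm w g (- \<mu>) u)\<^sup>2 + \<epsilon>) / 2) / cmod (stft_const g)" if \<sigma>: "\<sigma> \<in> L" for \<sigma>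
  proof -
    let ?r = "exp (lam * w (norm \<sigma>))"
    have "?r\<^sup>2 * (M2_norm w g \<mu> (d \<sigma>))\<^sup>2 = (\<Sum>\<sigma>\<in>{\<sigma>}. exp (2 * lam * w (norm \<sigma>)) * (M2_norm w g \<mu> (d \<sigma>))\<^sup>2)"
      by (simp add: power2_eq_square flip: exp_add)
    also have "\<dots> \<le> (\<Sum>\<^sub>\<infinity>\<sigma>\<in>L. exp (2 * lam * w (norm \<sigma>)) * (M2_norm w g \<mu> (d \<sigma>))\<^sup>2)"
      by (intro finite_sum_le_infsum[OF sm]) (use \<sigma> in auto)
    finally have "?r\<^sup>2 * (M2_norm w g \<mu> (d \<sigma>))\<^sup>2 \<le> \<epsilon>" using \<epsilon> by simp
    then have "?r * cmod (LINT z|lborel. stft g u z * cnj (stft g (d \<sigma>) z)) \<le> ((M2_norm w g (- \<mu>) u)\<^sup>2 + \<epsilon>) / 2"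
      using stft_product(2)[OF stft_measurable_dual[OF uS g] ui m[OF \<sigma>] int[OF \<sigma>], of ?r] by simp
    then have "?r * cmod (LINT z|lborel. stft g u z * cnj (stft g (d \<sigma>) z)) / cmod (stft_const g) \<le> (((M2_norm w g (- \<mu>) u)\<^sup>2 + \<epsilon>) / 2) / cmod (stft_const g)"
      by (rule divide_right_mono) simp
    then show ?thesis
      unfolding diff[OF \<sigma>] M2_pair_def norm_divide by simp
  qed
  then show "\<exists>C. \<forall>\<sigma>\<in>L. exp (lam * w (norm \<sigma>)) * cmod (c1 \<sigma> - c2 \<sigma>) \<le> C" by blast
qed

lemma M2_diff_integrable:
  assumes a: "stft g a \<in> borel_measurable borel" "integrable lborel (\<lambda>z. (cmod (stft g a z) * exp (\<mu> * w (norm z)))\<^sup>2)"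
    and b: "stft g b \<in> borel_measurable borel" "integrable lborel (\<lambda>z. (cmod (stft g b z) * exp (\<mu> * w (norm z)))\<^sup>2)"
  shows "stft g (a - b) \<in> borel_measurable borel" "integrable lborel (\<lambda>z. (cmod (stft g (a - b) z) * exp (\<mu> * w (norm z)))\<^sup>2)"
proof -
  have e: "stft g (a - b) = (\<lambda>z. stft g a z - stft g b z)"
    by (simp add: stft_def[abs_def])
  show m: "stft g (a - b) \<in> borel_measurable borel"
    unfolding e using a b by simp
  show "integrable lborel (\<lambda>z. (cmod (stft g (a - b) z) * exp (\<mu> * w (norm z)))\<^sup>2)"
  proof (rule Bochner_Integration.integrable_bound)
    show "integrable lborel (\<lambda>z. 2 * (cmod (stft g a z) * exp (\<mu> * w (norm z)))\<^sup>2 + 2 * (cmod (stft g b z) * exp (\<mu> * w (norm z)))\<^sup>2)"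
      using a b by (intro Bochner_Integration.integrable_add integrable_mult_right)
    show "(\<lambda>z. (cmod (stft g (a - b) z) * exp (\<mu> * w (norm z)))\<^sup>2) \<in> borel_measurable lborel"
      using m by simp
    show "AE z in lborel. norm ((cmod (stft g (a - b) z) * exp (\<mu> * w (norm z)))\<^sup>2)
       \<le> norm (2 * (cmod (stft g a z) * exp (\<mu> * w (norm z)))\<^sup>2 + 2 * (cmod (stft g b z) * exp (\<mu> * w (norm z)))\<^sup>2)"
    proof (rule AE_I2)
      fix z
      let ?x = "cmod (stft g a z) * exp (\<mu> * w (norm z))" and ?y = "cmod (stft g b z) * exp (\<mu> * w (norm z))"
      have "cmod (stft g (a - b) z) * exp (\<mu> * w (norm z)) \<le> ?x + ?y"
        unfolding e distrib_right[symmetric] by (intro mult_right_mono norm_triangle_ineq4) auto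
      then have "(cmod (stft g (a - b) z) * exp (\<mu> * w (norm z)))\<^sup>2 \<le> (?x + ?y)\<^sup>2"
        by (intro power_mono) auto
      also have "\<dots> \<le> 2 * ?x\<^sup>2 + 2 * ?y\<^sup>2"
        using sum_squares_bound[of ?x ?y] by (simp add: power2_sum)
      finally show "norm ((cmod (stft g (a - b) z) * exp (\<mu> * w (norm z)))\<^sup>2) \<le> norm (2 * ?x\<^sup>2 + 2 * ?y\<^sup>2)"
        by simp
    qed
  qed
qed

end

theorem theorem3p5:
  fixes w :: "real \<Rightarrow> real" and \<phi> \<psi> :: "real^'n::finite \<Rightarrow> complex" and a b :: real
  assumes "weight_function w"
    and "\<phi> \<in> S_omega w" and "\<phi> \<noteq> (\<lambda>_. 0)"
    and "a > 0" and "b > 0"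
    and "is_frame (gabor_lattice a b) (\<lambda>\<sigma>. tf_shift \<sigma> \<phi>)"
    and "\<psi> \<in> S_omega w" and "\<psi> \<noteq> (\<lambda>_. 0)"
  shows
   "(\<forall>\<mu>\<ge>0. \<forall>y :: (real^'n) \<times> (real^'n) \<Rightarrow> 'n udistr.
       (\<forall>\<sigma>\<in>gabor_lattice a b. y \<sigma> \<in> M2 w \<psi> \<mu>) \<and>
       (\<forall>lam\<ge>0. \<exists>\<epsilon>>0.
          (\<lambda>\<sigma>. exp (lam * w (norm \<sigma>)) * (M2_norm w \<psi> \<mu> (fun_distr (tf_shift \<sigma> \<phi>) - y \<sigma>))\<^sup>2)
             summable_on gabor_lattice a b \<and>
          (\<Sum>\<^sub>\<infinity>\<sigma>\<in>gabor_lattice a b.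
             exp (lam * w (norm \<sigma>)) * (M2_norm w \<psi> \<mu> (fun_distr (tf_shift \<sigma> \<phi>) - y \<sigma>))\<^sup>2) \<le> \<epsilon>)
       \<longrightarrow> (\<forall>u\<in>M2 w \<psi> (- \<mu>).
             WF_gabor w \<phi> (gabor_lattice a b) u =
             WF_coeff w (gabor_lattice a b) (\<lambda>\<sigma>. M2_pair \<psi> u (y \<sigma>))))
  \<and>
   (\<forall>y :: (real^'n) \<times> (real^'n) \<Rightarrow> real^'n \<Rightarrow> complex.
       (\<forall>\<sigma>\<in>gabor_lattice a b. y \<sigma> \<in> S_omega w) \<and>
       (\<forall>lam\<ge>0. \<forall>\<mu>\<ge>0. \<exists>\<epsilon>>0.
          (\<lambda>\<sigma>. exp (lam * w (norm \<sigma>)) *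
                (M2_norm w \<psi> \<mu> (fun_distr (\<lambda>t. tf_shift \<sigma> \<phi> t - y \<sigma> t)))\<^sup>2)
             summable_on gabor_lattice a b \<and>
          (\<Sum>\<^sub>\<infinity>\<sigma>\<in>gabor_lattice a b.
             exp (lam * w (norm \<sigma>)) *
               (M2_norm w \<psi> \<mu> (fun_distr (\<lambda>t. tf_shift \<sigma> \<phi> t - y \<sigma> t)))\<^sup>2) \<le> \<epsilon>)
       \<longrightarrow> (\<forall>u\<in>S_omega_dual w.
             WF_gabor w \<phi> (gabor_lattice a b) u =
             WF_coeff w (gabor_lattice a b) (\<lambda>\<sigma>. u (y \<sigma>))))"
proof (intro conjI allI impI ballI; elim conjE)
  interpret weight w by standard (fact assms(1))
  note g = assms(7) and nz = assms(8)
  have xS: "tf_shift \<sigma> \<phi> \<in> S_omega w" for \<sigma>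
    by (rule S_omega_tf_shift[OF assms(2)])
  {
    fix \<mu> :: real and y :: "(real^'n) \<times> (real^'n) \<Rightarrow> 'n udistr" and u
    assume y: "\<forall>\<sigma>\<in>gabor_lattice a b. y \<sigma> \<in> M2 w \<psi> \<mu>"
      and small: "\<forall>lam\<ge>0. \<exists>\<epsilon>>0.
          (\<lambda>\<sigma>. exp (lam * w (norm \<sigma>)) * (M2_norm w \<psi> \<mu> (fun_distr (tf_shift \<sigma> \<phi>) - y \<sigma>))\<^sup>2)
             summable_on gabor_lattice a b \<and>
          (\<Sum>\<^sub>\<infinity>\<sigma>\<in>gabor_lattice a b.
             exp (lam * w (norm \<sigma>)) * (M2_norm w \<psi> \<mu> (fun_distr (tf_shift \<sigma> \<phi>) - y \<sigma>))\<^sup>2) \<le> \<epsilon>"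
      and u: "u \<in> M2 w \<psi> (- \<mu>)"
    have uS: "u \<in> S_omega_dual w" and ui: "integrable lborel (\<lambda>z. (cmod (stft \<psi> u z) * exp (- \<mu> * w (norm z)))\<^sup>2)"
      using u unfolding M2_def by auto
    note um = stft_measurable_dual[OF uS g]
    have x: "stft \<psi> (fun_distr (tf_shift \<sigma> \<phi>)) \<in> borel_measurable borel"
        "integrable lborel (\<lambda>z. (cmod (stft \<psi> (fun_distr (tf_shift \<sigma> \<phi>)) z) * exp (\<mu> * w (norm z)))\<^sup>2)" for \<sigma>
      using rapid_measurable[OF stft_rapid[OF xS g]] rapid_square_integrable[OF stft_rapid[OF xS g]] by auto
    have y': "stft \<psi> (y \<sigma>) \<in> borel_measurable borel"
        "integrable lborel (\<lambda>z. (cmod (stft \<psi> (y \<sigma>) z) * exp (\<mu> * w (norm z)))\<^sup>2)" if "\<sigma> \<in> gabor_lattice a b" for \<sigma>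
      using y that stft_measurable_dual[OF _ g] unfolding M2_def by auto
    show "WF_gabor w \<phi> (gabor_lattice a b) u = WF_coeff w (gabor_lattice a b) (\<lambda>\<sigma>. M2_pair \<psi> u (y \<sigma>))"
      unfolding WF_gabor_def
    proof (rule WF_coeff_eq_of_M2_close[OF g u, where d="\<lambda>\<sigma>. fun_distr (tf_shift \<sigma> \<phi>) - y \<sigma>"])
      fix \<sigma> :: "(real^'n) \<times> (real^'n)" assume \<sigma>: "\<sigma> \<in> gabor_lattice a b"
      show "stft \<psi> (fun_distr (tf_shift \<sigma> \<phi>) - y \<sigma>) \<in> borel_measurable borel"
        "integrable lborel (\<lambda>z. (cmod (stft \<psi> (fun_distr (tf_shift \<sigma> \<phi>) - y \<sigma>) z) * exp (\<mu> * w (norm z)))\<^sup>2)"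
        by (rule M2_diff_integrable[OF x y'[OF \<sigma>]])+
      \<comment> \<open>Splitting the pairing requires both integrals to exist, which
        \<open>stft_product\<close> guarantees. The first pairing is then evaluation of
        \<open>u\<close>; the second stays as it is, since \<open>y \<sigma>\<close> need not be a
        test function.\<close>
      have "M2_pair \<psi> u (fun_distr (tf_shift \<sigma> \<phi>) - y \<sigma>) = M2_pair \<psi> u (fun_distr (tf_shift \<sigma> \<phi>)) - M2_pair \<psi> u (y \<sigma>)"
        using Bochner_Integration.integral_diff[OF stft_product(1)[OF um ui x] stft_product(1)[OF um ui y'[OF \<sigma>]]]
        unfolding M2_pair_def diff_divide_distrib[symmetric]
        by (simp add: stft_def right_diff_distrib)
      then show "u (tf_shift \<sigma> \<phi>) - M2_pair \<psi> u (y \<sigma>) = M2_pair \<psi> u (fun_distr (tf_shift \<sigma> \<phi>) - y \<sigma>)"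
        by (simp add: M2_pair_fun_distr[OF uS xS g nz])
    qed (use small in blast)
  }
  {
    fix y :: "(real^'n) \<times> (real^'n) \<Rightarrow> real^'n \<Rightarrow> complex" and u :: "'n udistr"
    assume y: "\<forall>\<sigma>\<in>gabor_lattice a b. y \<sigma> \<in> S_omega w"
      and small: "\<forall>lam\<ge>0. \<forall>\<mu>\<ge>0. \<exists>\<epsilon>>0.
          (\<lambda>\<sigma>. exp (lam * w (norm \<sigma>)) *
                (M2_norm w \<psi> \<mu> (fun_distr (\<lambda>t. tf_shift \<sigma> \<phi> t - y \<sigma> t)))\<^sup>2)
             summable_on gabor_lattice a b \<and>
          (\<Sum>\<^sub>\<infinity>\<sigma>\<in>gabor_lattice a b.
             exp (lam * w (norm \<sigma>)) *
               (M2_norm w \<psi> \<mu> (fun_distr (\<lambda>t. tf_shift \<sigma> \<phi> t - y \<sigma> t)))\<^sup>2) \<le> \<epsilon>"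
      and u: "u \<in> S_omega_dual w"
    \<comment> \<open>The parameter depends on \<open>u\<close>; the smallness hypothesis, being
      available for every \<mu>, is then used for this one.\<close>
    obtain \<mu> where \<mu>: "\<mu> \<ge> 0" and uM: "u \<in> M2 w \<psi> (- \<mu>)"
      using S_omega_dual_M2[OF u g] by blast
    have dS: "(\<lambda>t. tf_shift \<sigma> \<phi> t - y \<sigma> t) \<in> S_omega w"
      and ud: "u (\<lambda>t. tf_shift \<sigma> \<phi> t - y \<sigma> t) = u (tf_shift \<sigma> \<phi>) - u (y \<sigma>)" if "\<sigma> \<in> gabor_lattice a b" for \<sigma>
      using S_omega_lincomb[OF xS, of "y \<sigma>" 1 \<sigma> "-1"] S_omega_dual_lincomb[OF u xS, of "y \<sigma>" 1 \<sigma> "-1"] y that by auto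
    show "WF_gabor w \<phi> (gabor_lattice a b) u = WF_coeff w (gabor_lattice a b) (\<lambda>\<sigma>. u (y \<sigma>))"
      unfolding WF_gabor_def
    proof (rule WF_coeff_eq_of_M2_close[OF g uM, where d="\<lambda>\<sigma>. fun_distr (\<lambda>t. tf_shift \<sigma> \<phi> t - y \<sigma> t)"])
      fix \<sigma> :: "(real^'n) \<times> (real^'n)" assume \<sigma>: "\<sigma> \<in> gabor_lattice a b"
      show "stft \<psi> (fun_distr (\<lambda>t. tf_shift \<sigma> \<phi> t - y \<sigma> t)) \<in> borel_measurable borel"
        "integrable lborel (\<lambda>z. (cmod (stft \<psi> (fun_distr (\<lambda>t. tf_shift \<sigma> \<phi> t - y \<sigma> t)) z) * exp (\<mu> * w (norm z)))\<^sup>2)"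
        using rapid_measurable[OF stft_rapid[OF dS[OF \<sigma>] g]] rapid_square_integrable[OF stft_rapid[OF dS[OF \<sigma>] g]] by auto
      show "u (tf_shift \<sigma> \<phi>) - u (y \<sigma>) = M2_pair \<psi> u (fun_distr (\<lambda>t. tf_shift \<sigma> \<phi> t - y \<sigma> t))"
        by (simp add: M2_pair_fun_distr[OF u dS[OF \<sigma>] g nz] ud[OF \<sigma>])
    qed (use small \<mu> in blast)
  }
qed

end
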